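(* Let $\psi$ be a complete Bernstein function and let $D = (a,b)$ be a finite interval in $\mathbb{R}$. Let $\lambda_n$ ($n = 1, 2, \ldots$) denote the Dirichlet eigenvalues of $\psi(-\Delta)$ in $D$, arranged in nondecreasing order and repeated according to multiplicity. Then $$\psi\Bigl(\bigl(\tfrac{(n-1)\pi}{b-a}\bigr)^2\Bigr) \le \lambda_n \le \psi\Bigl(\bigl(\tfrac{n\pi}{b-a}\bigr)^2\Bigr) \qquad \text{for } n = 1, 2, \ldots$$ Moreover, if $\psi$ does not extend to a meromorphic function in $\mathbb{C}\setminus\{0\}$, then both inequalities are strict for every $n$, and so all the eigenvalues $\lambda_n$ are simple.
   Context: A function $\psi : [0,\infty) \to [0,\infty)$ is a complete Bernstein function if $$\psi(\xi) = c_1 \xi + c_0 + \frac{1}{\pi} \int_{(0,\infty)} \frac{\xi}{\xi+s}\, \mu(ds),$$ where $c_0, c_1 \ge 0$ and $\mu$ is a nonnegative Borel measure on $(0,\infty)$ such that the integral is finite for some (equivalently, all) $\xi > 0$. This formula defines a holomorphic function on $\mathbb{C} \setminus (-\infty,0]$; "$\psi$ extends to a meromorphic function in $\mathbb{C}\setminus\{0\}$" means that there is a meromorphic function on $\mathbb{C} \setminus \{0\}$ agreeing with $\psi$ on $(0,\infty)$. Write $\psi(\infty) = \lim_{\xi\to\infty}\psi(\xi) \in [0,\infty]$. Identify $L^2(D)$ with $\{u \in L^2(\mathbb{R}) : u = 0 \text{ a.e. in } \mathbb{R} \setminus D\}$. The Dirichlet operator $\psi(-\Delta)$ in $D$ is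 the self-adjoint operator on $L^2(D)$ associated with the quadratic form $$\mathscr{E}^{\mathrm{SD}}(u) = \frac{1}{2\pi} \int_{\mathbb{R}} \psi(\xi^2)\, |\mathscr{F}u(\xi)|^2\,d\xi, \qquad \mathscr{F}u(\xi) = \int_{\mathbb{R}} e^{-i\xi x} u(x)\,dx,$$ with domain the set of $u \in L^2(D)$ for which this is finite (and $\mathscr{E}^{\mathrm{SD}}(u) = \infty$ otherwise). Its $n$th eigenvalue (counting multiplicities) is given by the Courant–Fischer formula $$\lambda_n = \min\bigl\{ \max\{\mathscr{E}^{\mathrm{SD}}(u) : u \in E,\ \|u\|_2 = 1\} : E \text{ is an } n\text{-dimensional subspace of } L^2(D)\bigr\}.$$ The spectrum is purely discrete when $\psi(\infty) = \infty$; when $\psi(\infty) < \infty$, the $\lambda_n$ given by this formula converge to $\psi(\infty)$, the only point of the essential spectrum. *)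

theory Defs
  imports "HOL-Complex_Analysis.Complex_Analysis"
begin

(* psi is a total function here; only its values on [0,oo) are constrained and used. *)
definition complete_bernstein :: "(real \<Rightarrow> real) \<Rightarrow> bool" where
  "complete_bernstein \<psi> \<longleftrightarrow>
     (\<exists>c\<^sub>0 c\<^sub>1 \<mu>. c\<^sub>0 \<ge> 0 \<and> c\<^sub>1 \<ge> 0 \<and>
        sets \<mu> = sets (restrict_space borel {0::real<..}) \<and>
        (\<exists>\<xi>>0. integrable \<mu> (\<lambda>s. \<xi> / (\<xi> + s))) \<and>
        (\<forall>\<xi>\<ge>0. \<psi> \<xi> = c\<^sub>1 * \<xi> + c\<^sub>0 + 1 / pi * (\<integral>s. \<xi> / (\<xi> + s) \<partial>\<mu>)))"

(* The library's meromorphic_on ignores the values taken at a discrete set of points, but the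
   agreement with psi on the half-line is required at every point. *)
definition extends_meromorphically :: "(real \<Rightarrow> real) \<Rightarrow> bool" where
  "extends_meromorphically \<psi> \<longleftrightarrow>
     (\<exists>f. f meromorphic_on (- {0}) \<and> (\<forall>x>0. f (complex_of_real x) = complex_of_real (\<psi> x)))"

(* L^2(D), D a subset of the real line, as a set of representatives: complex functions on the
   line vanishing a.e. outside D.  Functions that agree a.e. are not identified, so linear
   independence and equality below are taken modulo null sets. *)
definition L2_on :: "real set \<Rightarrow> (real \<Rightarrow> complex) set" where
  "L2_on D = {u \<in> borel_measurable lborel.
     integrable lborel (\<lambda>x. (cmod (u x))\<^sup>2) \<and> (AE x in lborel. x \<notin> D \<longrightarrow> u x = 0)}"

definition L2_norm :: "(real \<Rightarrow> complex) \<Rightarrow> real" where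
  "L2_norm u = sqrt (\<integral>x. (cmod (u x))\<^sup>2 \<partial>lborel)"

definition L2_inner :: "(real \<Rightarrow> complex) \<Rightarrow> (real \<Rightarrow> complex) \<Rightarrow> complex" where
  "L2_inner u v = (\<integral>x. u x * cnj (v x) \<partial>lborel)"

(* E is the set of all representatives of the elements of an n-dimensional complex linear
   subspace of L^2(D); e 0, ..., e (n - 1) represent a basis. *)
definition L2_subspace_of_dim :: "real set \<Rightarrow> nat \<Rightarrow> (real \<Rightarrow> complex) set \<Rightarrow> bool" where
  "L2_subspace_of_dim D n E \<longleftrightarrow>
     (\<exists>e :: nat \<Rightarrow> real \<Rightarrow> complex.
        (\<forall>i<n. e i \<in> L2_on D) \<and>
        (\<forall>c :: nat \<Rightarrow> complex.
           (AE x in lborel. (\<Sum>i<n. c i * e i x) = 0) \<longrightarrow> (\<forall>i<n. c i = 0)) \<and>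
        E = {u \<in> L2_on D.
               \<exists>c :: nat \<Rightarrow> complex. AE x in lborel. u x = (\<Sum>i<n. c i * e i x)})"

(* The defining integral converges absolutely for u in L^2(D) with D bounded, the only case used. *)
definition fourier :: "(real \<Rightarrow> complex) \<Rightarrow> real \<Rightarrow> complex" where
  "fourier u \<xi> = (\<integral>x. exp (- (\<i> * complex_of_real (\<xi> * x))) * u x \<partial>lborel)"

definition dirichlet_form :: "(real \<Rightarrow> real) \<Rightarrow> (real \<Rightarrow> complex) \<Rightarrow> ennreal" where
  "dirichlet_form \<psi> u =
     ennreal (1 / (2 * pi)) * (\<integral>\<^sup>+\<xi>. ennreal (\<psi> (\<xi>\<^sup>2) * (cmod (fourier u \<xi>))\<^sup>2) \<partial>lborel)"

definition form_domain :: "(real \<Rightarrow> real) \<Rightarrow> real set \<Rightarrow> (real \<Rightarrow> complex) set" where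
  "form_domain \<psi> D = {u \<in> L2_on D. dirichlet_form \<psi> u < \<infinity>}"

(* The sesquilinear form obtained from dirichlet_form by polarization. *)
definition dirichlet_sesq :: "(real \<Rightarrow> real) \<Rightarrow> (real \<Rightarrow> complex) \<Rightarrow> (real \<Rightarrow> complex) \<Rightarrow> complex" where
  "dirichlet_sesq \<psi> u v =
     complex_of_real (1 / (2 * pi)) *
       (\<integral>\<xi>. complex_of_real (\<psi> (\<xi>\<^sup>2)) * fourier u \<xi> * cnj (fourier v \<xi>) \<partial>lborel)"

(* Graph of the Dirichlet operator psi(-Laplacian) in D, i.e. of the self-adjoint operator
   associated with the closed form above: u is mapped to f. *)
definition dirichlet_operator ::
    "(real \<Rightarrow> real) \<Rightarrow> real set \<Rightarrow> ((real \<Rightarrow> complex) \<times> (real \<Rightarrow> complex)) set" where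
  "dirichlet_operator \<psi> D = {(u, f). u \<in> form_domain \<psi> D \<and> f \<in> L2_on D \<and>
     (\<forall>v \<in> form_domain \<psi> D. dirichlet_sesq \<psi> u v = L2_inner f v)}"

definition dirichlet_eigenspace :: "(real \<Rightarrow> real) \<Rightarrow> real set \<Rightarrow> real \<Rightarrow> (real \<Rightarrow> complex) set" where
  "dirichlet_eigenspace \<psi> D l =
     {u. (u, \<lambda>x. complex_of_real l * u x) \<in> dirichlet_operator \<psi> D}"

definition simple_dirichlet_eigenvalue :: "(real \<Rightarrow> real) \<Rightarrow> real set \<Rightarrow> real \<Rightarrow> bool" where
  "simple_dirichlet_eigenvalue \<psi> D l \<longleftrightarrow> L2_subspace_of_dim D 1 (dirichlet_eigenspace \<psi> D l)"

(* The n-th eigenvalue, n = 1, 2, ..., counted with multiplicity, by the Courant-Fischer formula.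
   INF and SUP stand for the min and max there; the values lie in [0,oo] because the form is
   infinite outside its domain. *)
definition dirichlet_eigenvalue :: "(real \<Rightarrow> real) \<Rightarrow> real set \<Rightarrow> nat \<Rightarrow> ennreal" where
  "dirichlet_eigenvalue \<psi> D n =
     (INF E \<in> {E. L2_subspace_of_dim D n E}.
        SUP u \<in> {u \<in> E. L2_norm u = 1}. dirichlet_form \<psi> u)"

end

theory Submission
  imports Defs "HOL-Probability.Characteristic_Functions" "HOL-Probability.Sinc_Integral"
begin

text \<open>
  By the integral representation of \<open>\<psi>\<close> and a limit \<open>s \<rightarrow> \<infinity>\<close> for the linear term, everything reduces to
  \<open>\<xi> / (\<xi> + s) = 1 - s / (\<xi> + s)\<close>, that is, to the resolvent of the Laplacian on the line, compressed to the
  interval. Its kernel \<open>exp (- \<theta> \<bar>x - y\<bar>) / (2 \<theta>)\<close>, \<open>\<theta> = \<surd>s\<close>, lies between the Dirichlet and the Neumann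
  Green functions of the interval, and both differences are explicit nonnegative kernels of rank two
  in \<open>exp (\<plusminus> \<theta> x)\<close>. Integrating against \<open>\<mu>\<close> bounds the form of \<open>\<psi>(-\<Delta>)\<close> from below by the form diagonal in
  cosines with entries \<open>\<psi>((k \<pi> / (b - a))\<^sup>2)\<close>, and on spans of sines from above by the analogous form; the
  Courant-Fischer formula gives the weak inequalities.

  The difference of the two forms controls the \<open>\<mu>\<close>-integral of the squared Laplace transform of \<open>u\<close>. This transform
  does not vanish for a single cosine or sine, so the inequalities are strict as soon as \<open>\<mu> \<noteq> 0\<close>; and
  \<open>\<mu> = 0\<close> makes \<open>\<psi>\<close> affine, hence entire. For simplicity, the strict upper bound makes the variational
  problems coercive modulo finitely many cosine coefficients, so minimisers exist, and a second eigenfunction at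
  \<open>\<lambda>\<^sub>n\<close> would force \<open>\<lambda>\<^bsub>n+1\<^esub> \<le> \<lambda>\<^sub>n\<close>.
\<close>

section \<open>Square-integrable functions\<close>

text \<open>The differences have rank two because resolvents of the Laplacian on one interval, at
  one parameter but with different boundary conditions, differ only by solutions of f'' = \<theta>^2
  f, which two exponentials span. Each correction is arranged as a sum of two weighted squares;
  dropping one of them leaves the same quantity \<open>tail\<close> on both sides, so a single
  functional \<open>gap_form\<close> measures the loss in the lower and in the upper bound.

  The obstacle is that \<psi> may be bounded. Minimising sequences are then not automatically
  compact, and the minimax values could meet the essential spectrum at \<psi>(\<infinity>). This
  fixes the order of the strict statements. The strict upper bound comes first, since explicit sine
  sums as trial functions suffice for it. The strict lower bound has to wait: a strict inequality
  for every single trial function says nothing strict about an infimum, and it becomes conclusive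
  only when the infimum is attained, that is, after eigenfunctions have been constructed with the
  help of the upper bound.\<close>

definition square_integrable :: "'a measure \<Rightarrow> ('a \<Rightarrow> complex) \<Rightarrow> bool" where
  "square_integrable M f \<longleftrightarrow> f \<in> borel_measurable M \<and> integrable M (\<lambda>x. (cmod (f x))\<^sup>2)"

definition hinner :: "'a measure \<Rightarrow> ('a \<Rightarrow> complex) \<Rightarrow> ('a \<Rightarrow> complex) \<Rightarrow> complex" where
  "hinner M f g = (\<integral>x. f x * cnj (g x) \<partial>M)"

definition sqnorm :: "'a measure \<Rightarrow> ('a \<Rightarrow> complex) \<Rightarrow> real" where
  "sqnorm M f = (\<integral>x. (cmod (f x))\<^sup>2 \<partial>M)"

lemma square_integrable_measurable [measurable_dest]:
  "square_integrable M f \<Longrightarrow> f \<in> borel_measurable M"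
  by (simp add: square_integrable_def)

lemma square_integrableD: "square_integrable M f \<Longrightarrow> integrable M (\<lambda>x. (cmod (f x))\<^sup>2)"
  by (simp add: square_integrable_def)

lemma norm_mult_le_squares: "cmod (z * cnj w) \<le> (cmod z)\<^sup>2 + (cmod w)\<^sup>2"
proof -
  have "cmod z * cmod w \<le> ((cmod z)\<^sup>2 + (cmod w)\<^sup>2) / 2"
    using sum_squares_bound[of "cmod z" "cmod w"] by simp
  also have "\<dots> \<le> (cmod z)\<^sup>2 + (cmod w)\<^sup>2"
    using zero_le_power2[of "cmod z"] zero_le_power2[of "cmod w"] by (simp add: field_simps)
  finally show ?thesis by (simp add: norm_mult)
qed

lemma square_integrable_mult_cnj:
  assumes f: "square_integrable M f" and g: "square_integrable M g"
  shows "integrable M (\<lambda>x. f x * cnj (g x))"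
proof (rule Bochner_Integration.integrable_bound)
  show "integrable M (\<lambda>x. (cmod (f x))\<^sup>2 + (cmod (g x))\<^sup>2)"
    using f g by (auto simp: square_integrable_def)
  have cnjm: "cnj \<in> borel_measurable borel"
    by (intro borel_measurable_continuous_onI continuous_intros)
  show "(\<lambda>x. f x * cnj (g x)) \<in> borel_measurable M"
    using f g measurable_compose[OF _ cnjm, of g M] by (auto simp: square_integrable_def)
  show "AE x in M. norm (f x * cnj (g x)) \<le> norm ((cmod (f x))\<^sup>2 + (cmod (g x))\<^sup>2)"
    using norm_mult_le_squares by auto
qed

lemma square_integrable_add:
  assumes f: "square_integrable M f" and g: "square_integrable M g"
  shows "square_integrable M (\<lambda>x. f x + g x)"
  unfolding square_integrable_def
proof
  show [measurable]: "(\<lambda>x. f x + g x) \<in> borel_measurable M"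
    using f g by (auto simp: square_integrable_def)
  show "integrable M (\<lambda>x. (cmod (f x + g x))\<^sup>2)"
  proof (rule Bochner_Integration.integrable_bound)
    show "integrable M (\<lambda>x. 2 * (cmod (f x))\<^sup>2 + 2 * (cmod (g x))\<^sup>2)"
      using f g by (auto simp: square_integrable_def)
    show "(\<lambda>x. (cmod (f x + g x))\<^sup>2) \<in> borel_measurable M" by measurable
    have "(cmod (z + w))\<^sup>2 \<le> 2 * (cmod z)\<^sup>2 + 2 * (cmod w)\<^sup>2" for z w
    proof -
      have "(cmod (z + w))\<^sup>2 \<le> (cmod z + cmod w)\<^sup>2"
        by (intro power_mono norm_triangle_ineq) auto
      also have "\<dots> \<le> 2 * (cmod z)\<^sup>2 + 2 * (cmod w)\<^sup>2"
        using sum_squares_bound[of "cmod z" "cmod w"] by (simp add: power2_sum)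
      finally show ?thesis .
    qed
    then show "AE x in M. norm ((cmod (f x + g x))\<^sup>2) \<le> norm (2 * (cmod (f x))\<^sup>2 + 2 * (cmod (g x))\<^sup>2)"
      by auto
  qed
qed

lemma square_integrable_scale:
  "square_integrable M f \<Longrightarrow> square_integrable M (\<lambda>x. c * f x)"
  by (auto simp: square_integrable_def norm_mult power_mult_distrib)

lemma square_integrable_diff:
  "square_integrable M f \<Longrightarrow> square_integrable M g \<Longrightarrow> square_integrable M (\<lambda>x. f x - g x)"
  using square_integrable_add[of M f "\<lambda>x. (-1) * g x"] square_integrable_scale[of M g "-1"] by simp

lemma square_integrable_zero [simp]: "square_integrable M (\<lambda>x. 0)"
  by (simp add: square_integrable_def)

lemma square_integrable_sum:
  "(\<And>i. i \<in> I \<Longrightarrow> square_integrable M (f i)) \<Longrightarrow> square_integrable M (\<lambda>x. \<Sum>i\<in>I. f i x)"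
  by (induction I rule: infinite_finite_induct) (auto intro: square_integrable_add)

lemma hinner_add_left:
  assumes "square_integrable M f" "square_integrable M g" "square_integrable M h"
  shows "hinner M (\<lambda>x. f x + g x) h = hinner M f h + hinner M g h"
  unfolding hinner_def by (simp add: distrib_right square_integrable_mult_cnj assms)

lemma hinner_scale_left: "hinner M (\<lambda>x. c * f x) h = c * hinner M f h"
  unfolding hinner_def by (simp add: mult.assoc)

lemma hinner_cnj: "cnj (hinner M f g) = hinner M g f"
proof -
  have "hinner M g f = (\<integral>x. cnj (f x * cnj (g x)) \<partial>M)"
    unfolding hinner_def by (intro Bochner_Integration.integral_cong) (auto simp: mult.commute)
  also have "\<dots> = cnj (hinner M f g)"
    unfolding hinner_def by (rule Bochner_Integration.integral_cnj)
  finally show ?thesis by (rule sym)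
qed

lemma hinner_scale_right: "hinner M h (\<lambda>x. c * f x) = cnj c * hinner M h f"
  unfolding hinner_cnj[of M _ h, symmetric] by (simp only: hinner_scale_left complex_cnj_mult)

lemma hinner_add_right:
  assumes "square_integrable M f" "square_integrable M g" "square_integrable M h"
  shows "hinner M h (\<lambda>x. f x + g x) = hinner M h f + hinner M h g"
  unfolding hinner_cnj[of M _ h, symmetric] by (simp only: hinner_add_left assms complex_cnj_add)

lemma hinner_diff_left:
  assumes "square_integrable M f" "square_integrable M g" "square_integrable M h"
  shows "hinner M (\<lambda>x. f x - g x) h = hinner M f h - hinner M g h"
  unfolding hinner_def by (simp add: left_diff_distrib square_integrable_mult_cnj assms)

lemma hinner_sum_left:
  assumes "\<And>i. i \<in> I \<Longrightarrow> square_integrable M (f i)" "square_integrable M h"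
  shows "hinner M (\<lambda>x. \<Sum>i\<in>I. c i * f i x) h = (\<Sum>i\<in>I. c i * hinner M (f i) h)"
  using assms(1)
proof (induction I rule: infinite_finite_induct)
  case (insert i I)
  then show ?case
    by (simp add: hinner_add_left square_integrable_scale square_integrable_sum assms(2) hinner_scale_left)
qed (auto simp: hinner_def)

lemma hinner_sum_right:
  assumes "\<And>i. i \<in> I \<Longrightarrow> square_integrable M (f i)" "square_integrable M h"
  shows "hinner M h (\<lambda>x. \<Sum>i\<in>I. c i * f i x) = (\<Sum>i\<in>I. cnj (c i) * hinner M h (f i))"
proof -
  have "hinner M h (\<lambda>x. \<Sum>i\<in>I. c i * f i x) = cnj (hinner M (\<lambda>x. \<Sum>i\<in>I. c i * f i x) h)"
    by (simp only: hinner_cnj)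
  also have "\<dots> = (\<Sum>i\<in>I. cnj (c i) * hinner M h (f i))"
    by (subst hinner_sum_left[OF assms]) (auto simp: hinner_cnj)
  finally show ?thesis .
qed

lemma hinner_self: "hinner M f f = complex_of_real (sqnorm M f)"
proof -
  have "hinner M f f = (\<integral>x. complex_of_real ((cmod (f x))\<^sup>2) \<partial>M)"
    unfolding hinner_def complex_norm_square ..
  then show ?thesis by (simp only: integral_complex_of_real sqnorm_def)
qed

lemma sqnorm_nonneg [simp]: "0 \<le> sqnorm M f"
  by (simp add: sqnorm_def)

lemma sqnorm_Re: "sqnorm M f = Re (hinner M f f)"
  by (simp add: hinner_self)

lemma sqnorm_scale: "sqnorm M (\<lambda>x. c * f x) = (cmod c)\<^sup>2 * sqnorm M f"
  by (simp add: sqnorm_def norm_mult power_mult_distrib)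

lemma sqnorm_add:
  assumes f: "square_integrable M f" and g: "square_integrable M g"
  shows "sqnorm M (\<lambda>x. f x + g x) = sqnorm M f + 2 * Re (hinner M f g) + sqnorm M g"
proof -
  have "hinner M (\<lambda>x. f x + g x) (\<lambda>x. f x + g x) =
      hinner M f f + hinner M f g + hinner M g f + hinner M g g"
    using assms by (simp add: hinner_add_left hinner_add_right square_integrable_add)
  moreover have "Re (hinner M g f) = Re (hinner M f g)"
    unfolding hinner_cnj[of M f g, symmetric] by simp
  ultimately show ?thesis by (simp add: sqnorm_Re)
qed

lemma sqnorm_diff:
  assumes f: "square_integrable M f" and g: "square_integrable M g"
  shows "sqnorm M (\<lambda>x. f x - g x) = sqnorm M f - 2 * Re (hinner M f g) + sqnorm M g"
  using sqnorm_add[OF f square_integrable_scale[OF g, of "-1"]]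
  by (simp only: hinner_scale_right sqnorm_scale) simp

text \<open>The discriminant bound for a quadratic in a complex variable, with the degenerate case q
  = 0 included. It serves twice: for Cauchy-Schwarz, and with p = 0 to turn minimality of a form
  into an eigenvalue equation.\<close>

lemma complex_quadratic_nonneg_bound:
  assumes nonneg: "\<And>t. 0 \<le> p + 2 * Re (cnj t * z) + (cmod t)\<^sup>2 * q" and "0 \<le> q"
  shows "(cmod z)\<^sup>2 \<le> p * q"
proof (cases "q = 0")
  case True
  have "z = 0"
  proof (rule ccontr)
    assume "z \<noteq> 0"
    \<comment> \<open>With q = 0 nothing balances the linear term, and this multiple of z makes it
      exceed p.\<close>
    define x where "x = (\<bar>p\<bar> + 1) / (cmod z)\<^sup>2"
    have "Re (cnj (- of_real x * z) * z) = - x * (cmod z)\<^sup>2"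
      unfolding cmod_power2 by (simp add: power2_eq_square algebra_simps)
    then have "0 \<le> p - 2 * (x * (cmod z)\<^sup>2)"
      using nonneg[of "- of_real x * z"] True by simp
    also have "x * (cmod z)\<^sup>2 = \<bar>p\<bar> + 1" using \<open>z \<noteq> 0\<close> by (simp add: x_def)
    finally show False by (simp add: abs_if split: if_splits)
  qed
  then show ?thesis using True by simp
next
  case False
  then have q: "q > 0" using \<open>0 \<le> q\<close> by simp
  \<comment> \<open>The test point t = - z / q is the minimiser of the quadratic.\<close>
  have "Re (cnj (- of_real (1 / q) * z) * z) = - (1 / q) * (cmod z)\<^sup>2"
    unfolding cmod_power2 by (simp add: power2_eq_square algebra_simps add_divide_distrib)
  note Re_eq = this
  have abs_eq: "(cmod (- of_real (1 / q) * z))\<^sup>2 * q = (cmod z)\<^sup>2 / q"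
    using q by (simp add: norm_mult norm_divide power_mult_distrib power_divide power2_eq_square)
  have "0 \<le> p + 2 * (- (1 / q) * (cmod z)\<^sup>2) + (cmod z)\<^sup>2 / q"
    using nonneg[of "- of_real (1 / q) * z"] by (simp only: Re_eq abs_eq)
  then have "0 \<le> p - (cmod z)\<^sup>2 / q" by simp
  then show ?thesis using q by (simp add: field_simps)
qed

lemma hinner_Cauchy_Schwarz:
  assumes f: "square_integrable M f" and g: "square_integrable M g"
  shows "(cmod (hinner M f g))\<^sup>2 \<le> sqnorm M f * sqnorm M g"
proof (rule complex_quadratic_nonneg_bound)
  fix t
  have "0 \<le> sqnorm M (\<lambda>x. f x + t * g x)" by simp
  then show "0 \<le> sqnorm M f + 2 * Re (cnj t * hinner M f g) + (cmod t)\<^sup>2 * sqnorm M g"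
    by (simp add: sqnorm_add f g square_integrable_scale hinner_scale_right sqnorm_scale)
qed simp

lemma sqnorm_triangle:
  assumes f: "square_integrable M f" and g: "square_integrable M g"
  shows "sqrt (sqnorm M (\<lambda>x. f x + g x)) \<le> sqrt (sqnorm M f) + sqrt (sqnorm M g)"
proof (rule real_le_lsqrt)
  have "Re (hinner M f g) \<le> cmod (hinner M f g)" by (rule complex_Re_le_cmod)
  also have "\<dots> \<le> sqrt (sqnorm M f) * sqrt (sqnorm M g)"
    unfolding real_sqrt_mult[symmetric]
    by (rule real_le_rsqrt[OF hinner_Cauchy_Schwarz[OF f g]])
  finally show "sqnorm M (\<lambda>x. f x + g x) \<le> (sqrt (sqnorm M f) + sqrt (sqnorm M g))\<^sup>2"
    by (simp add: sqnorm_add f g power2_sum)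
qed auto

lemma sqnorm_cong_AE:
  assumes "f \<in> borel_measurable M" "g \<in> borel_measurable M" "AE x in M. f x = g x"
  shows "sqnorm M f = sqnorm M g"
  unfolding sqnorm_def using assms by (intro integral_cong_AE) auto

lemma hinner_cong_AE:
  assumes "square_integrable M f" "square_integrable M g" "square_integrable M f'" "square_integrable M g'"
    "AE x in M. f x = f' x" "AE x in M. g x = g' x"
  shows "hinner M f g = hinner M f' g'"
  unfolding hinner_def using assms square_integrable_mult_cnj[of M f g] square_integrable_mult_cnj[of M f' g']
  by (intro integral_cong_AE) auto

lemma sqnorm_eq_0_iff:
  assumes f: "square_integrable M f"
  shows "sqnorm M f = 0 \<longleftrightarrow> (AE x in M. f x = 0)"
  unfolding sqnorm_def using integral_nonneg_eq_0_iff_AE[OF square_integrableD[OF f]] by simp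

lemma nn_integral_cmod_square:
  assumes f: "square_integrable M f"
  shows "(\<integral>\<^sup>+x. ennreal ((cmod (f x))\<^sup>2) \<partial>M) = ennreal (sqnorm M f)"
  unfolding sqnorm_def by (rule nn_integral_eq_integral[OF square_integrableD[OF f]]) simp

lemma square_integrable_if_nn_integral:
  assumes "f \<in> borel_measurable M" "(\<integral>\<^sup>+x. ennreal ((cmod (f x))\<^sup>2) \<partial>M) < \<infinity>"
  shows "square_integrable M f"
  unfolding square_integrable_def using assms by (auto intro!: integrableI_bounded)

section \<open>Completeness of the space of square-integrable functions\<close>

lemma square_integrable_Cauchy_fast:
  assumes f: "\<And>j. square_integrable M (f j)"
    and fast: "\<And>j. sqnorm M (\<lambda>x. f (Suc j) x - f j x) \<le> (1/8)^j"
  shows "AE x in M. convergent (\<lambda>j. f j x)"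
proof -
  note [measurable] = square_integrable_measurable[OF f]
  let ?d = "\<lambda>j x. f (Suc j) x - f j x"
  \<comment> \<open>The weight 2^j turns the assumed rate (1/8)^j into the still summable (1/4)^j.
    Where the weighted sum is finite, the increments are at most a constant times (1 / sqrt 2)^j, so
    the telescoping series converges absolutely.\<close>
  have "(\<integral>\<^sup>+x. (\<Sum>j. ennreal (2^j * (cmod (?d j x))\<^sup>2)) \<partial>M) =
      (\<Sum>j. \<integral>\<^sup>+x. ennreal (2^j * (cmod (?d j x))\<^sup>2) \<partial>M)"
    by (rule nn_integral_suminf) measurable
  also have "\<dots> \<le> (\<Sum>j. ennreal ((1/4)^j))"
  proof (rule suminf_le)
    fix j
    have "(\<integral>\<^sup>+x. ennreal (2^j * (cmod (?d j x))\<^sup>2) \<partial>M) = ennreal (2^j) * ennreal (sqnorm M (?d j))"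
      using f by (simp add: ennreal_mult nn_integral_cmult nn_integral_cmod_square square_integrable_diff)
    also have "\<dots> = ennreal (2^j * sqnorm M (?d j))" by (simp add: ennreal_mult)
    also have "\<dots> \<le> ennreal (2^j * (1/8)^j)"
      using fast[of j] by (intro ennreal_leI mult_left_mono) auto
    also have "2^j * (1/8)^j = ((1/4)^j :: real)" by (simp add: power_mult_distrib[symmetric])
    finally show "(\<integral>\<^sup>+x. ennreal (2^j * (cmod (?d j x))\<^sup>2) \<partial>M) \<le> ennreal ((1/4)^j)" .
  qed auto
  also have "\<dots> < \<infinity>"
    by (subst suminf_ennreal2) (auto simp: summable_geometric)
  finally have "AE x in M. (\<Sum>j. ennreal (2^j * (cmod (?d j x))\<^sup>2)) \<noteq> \<infinity>"
    by (intro nn_integral_PInf_AE) auto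
  then show ?thesis
  proof eventually_elim
    case (elim x)
    define S where "S = (\<Sum>j. ennreal (2^j * (cmod (?d j x))\<^sup>2))"
    have "S \<noteq> \<infinity>" using elim unfolding S_def .
    then obtain K where "S = ennreal K" "0 \<le> K" by (cases S) auto
    then have K: "(\<Sum>j. ennreal (2^j * (cmod (?d j x))\<^sup>2)) = ennreal K" "0 \<le> K"
      by (simp_all only: S_def)
    have le: "cmod (?d j x) \<le> sqrt K * (1 / sqrt 2)^j" for j
    proof -
      have "ennreal (2^j * (cmod (?d j x))\<^sup>2) \<le> ennreal K"
        unfolding K(1)[symmetric]
        using sum_le_suminf[OF summableI, of "{j}" "\<lambda>j. ennreal (2^j * (cmod (?d j x))\<^sup>2)"]
        by (simp only: finite.emptyI finite.insertI sum.insert sum.empty empty_iff not_False_eq_True add_0_right zero_le True_implies_equals)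
      then have "2^j * (cmod (?d j x))\<^sup>2 \<le> K" using K(2) by (simp add: ennreal_le_iff)
      then have "sqrt (2^j * (cmod (?d j x))\<^sup>2) \<le> sqrt K" by (rule real_sqrt_le_mono)
      then have "sqrt 2 ^ j * cmod (?d j x) \<le> sqrt K" by (simp add: real_sqrt_mult real_sqrt_power)
      then have "cmod (?d j x) \<le> sqrt K / sqrt 2 ^ j"
        by (subst pos_le_divide_eq) (auto simp: mult.commute)
      then show ?thesis by (simp only: power_divide power_one times_divide_eq_right mult_1_right)
    qed
    have "summable (\<lambda>j. sqrt K * (1 / sqrt 2)^j)"
      by (intro summable_mult summable_geometric) simp
    then have "summable (\<lambda>j. ?d j x)"
      by (rule summable_comparison_test'[where N=0]) (use le in auto)
    then have "convergent (\<lambda>n. \<Sum>j<n. ?d j x)"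
      by (simp add: summable_iff_convergent)
    then have "convergent (\<lambda>n. (f n x - f 0 x) + f 0 x)"
      unfolding sum_lessThan_telescope[of "\<lambda>j. f j x"] by (rule convergent_add[OF _ convergent_const])
    then show ?case by simp
  qed
qed

lemma subseq_Cauchy_fast:
  fixes d :: "nat \<Rightarrow> nat \<Rightarrow> real" and e :: "nat \<Rightarrow> real"
  assumes C: "\<And>e. e > 0 \<Longrightarrow> \<exists>N. \<forall>m\<ge>N. \<forall>n\<ge>N. d m n < e" and e: "\<And>j. e j > 0"
  shows "\<exists>r. strict_mono r \<and> (\<forall>j. d (r (Suc j)) (r j) \<le> e j)"
proof -
  have "\<forall>j. \<exists>N. \<forall>m\<ge>N. \<forall>n\<ge>N. d m n < e j"
    by (intro allI C e)
  then obtain N where "\<forall>j. \<forall>m\<ge>N j. \<forall>n\<ge>N j. d m n < e j"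
    by (rule choice[THEN exE])
  then have N: "\<And>j m n. m \<ge> N j \<Longrightarrow> n \<ge> N j \<Longrightarrow> d m n < e j"
    by simp
  define r where "r = rec_nat (N 0) (\<lambda>j k. max (Suc k) (N (Suc j)))"
  have r: "r 0 = N 0" "\<And>j. r (Suc j) = max (Suc (r j)) (N (Suc j))" by (auto simp: r_def)
  have ge: "r j \<ge> N j" for j by (cases j) (auto simp: r)
  have mono: "strict_mono r" by (rule strict_monoI_Suc) (simp add: r less_max_iff_disj)
  have "d (r (Suc j)) (r j) \<le> e j" for j
  proof -
    have "r j < r (Suc j)" using mono by (simp add: strict_mono_Suc_iff)
    then have "r (Suc j) \<ge> N j" using ge[of j] by linarith
    then show ?thesis using N[OF _ ge] by (simp add: less_imp_le)
  qed
  with mono show ?thesis by blast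
qed

text \<open>Riesz-Fischer. The subsequence converging almost everywhere is part of the conclusion
  because it carries the condition of vanishing outside the interval over to the limit.\<close>

lemma square_integrable_complete:
  assumes f: "\<And>j. square_integrable M (f j)"
    and C: "\<And>e. e > 0 \<Longrightarrow> \<exists>N. \<forall>m\<ge>N. \<forall>n\<ge>N. sqnorm M (\<lambda>x. f m x - f n x) < e"
  shows "\<exists>g r. square_integrable M g \<and> strict_mono r \<and> (AE x in M. (\<lambda>j. f (r j) x) \<longlonglongrightarrow> g x) \<and>
           (\<lambda>n. sqnorm M (\<lambda>x. f n x - g x)) \<longlonglongrightarrow> 0"
proof -
  note [measurable] = square_integrable_measurable[OF f]
  obtain r where r: "strict_mono r" "\<And>j. sqnorm M (\<lambda>x. f (r (Suc j)) x - f (r j) x) \<le> (1/8)^j"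
    using subseq_Cauchy_fast[where d = "\<lambda>m n. sqnorm M (\<lambda>x. f m x - f n x)" and e = "\<lambda>j. (1/8)^j", OF C]
    by auto
  have conv: "AE x in M. convergent (\<lambda>j. f (r j) x)"
    by (rule square_integrable_Cauchy_fast) (use f r in auto)
  define g where "g x = lim (\<lambda>j. f (r j) x)" for x
  have [measurable]: "g \<in> borel_measurable M"
    unfolding g_def by (rule borel_measurable_lim_metric) measurable
  have lim: "AE x in M. (\<lambda>j. f (r j) x) \<longlonglongrightarrow> g x"
    using conv by eventually_elim (simp add: g_def convergent_LIMSEQ_iff)
  \<comment> \<open>The distance from f n to the limit is controlled by the distances from f n to
    late members of the subsequence.\<close>
  have Fatou: "(\<integral>\<^sup>+x. ennreal ((cmod (f n x - g x))\<^sup>2) \<partial>M) \<le> ennreal e"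
    if e: "e > 0" and N: "\<forall>m\<ge>N. \<forall>n\<ge>N. sqnorm M (\<lambda>x. f m x - f n x) < e" "n \<ge> N" for e N n
  proof -
    have "(\<integral>\<^sup>+x. ennreal ((cmod (f n x - g x))\<^sup>2) \<partial>M) =
        (\<integral>\<^sup>+x. liminf (\<lambda>j. ennreal ((cmod (f n x - f (r j) x))\<^sup>2)) \<partial>M)"
    proof (rule nn_integral_cong_AE)
      show "AE x in M. ennreal ((cmod (f n x - g x))\<^sup>2) = liminf (\<lambda>j. ennreal ((cmod (f n x - f (r j) x))\<^sup>2))"
        using lim
      proof eventually_elim
        case (elim x)
        have "(\<lambda>j. ennreal ((cmod (f n x - f (r j) x))\<^sup>2)) \<longlonglongrightarrow> ennreal ((cmod (f n x - g x))\<^sup>2)"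
          by (intro tendsto_ennrealI tendsto_intros elim)
        then show ?case by (rule lim_imp_Liminf[OF trivial_limit_sequentially, symmetric])
      qed
    qed
    also have "\<dots> \<le> liminf (\<lambda>j. \<integral>\<^sup>+x. ennreal ((cmod (f n x - f (r j) x))\<^sup>2) \<partial>M)"
      by (rule nn_integral_liminf) measurable
    also have "\<dots> \<le> ennreal e"
    proof (rule Liminf_le)
      show "\<forall>\<^sub>F j in sequentially. (\<integral>\<^sup>+x. ennreal ((cmod (f n x - f (r j) x))\<^sup>2) \<partial>M) \<le> ennreal e"
        using eventually_ge_at_top[of N]
      proof eventually_elim
        case (elim j)
        have "r j \<ge> N" using elim seq_suble[OF r(1), of j] by linarith
        then have "sqnorm M (\<lambda>x. f n x - f (r j) x) \<le> e" using N by (simp add: less_imp_le)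
        then show ?case using f by (simp add: nn_integral_cmod_square square_integrable_diff ennreal_leI)
      qed
    qed simp
    finally show ?thesis .
  qed
  have sd: "\<exists>N. \<forall>n\<ge>N. square_integrable M (\<lambda>x. f n x - g x) \<and> sqnorm M (\<lambda>x. f n x - g x) \<le> e" if e: "e > 0" for e
  proof -
    obtain N where N: "\<forall>m\<ge>N. \<forall>n\<ge>N. sqnorm M (\<lambda>x. f m x - f n x) < e" using C[OF e] by blast
    have "square_integrable M (\<lambda>x. f n x - g x) \<and> sqnorm M (\<lambda>x. f n x - g x) \<le> e" if "n \<ge> N" for n
    proof -
      have le: "(\<integral>\<^sup>+x. ennreal ((cmod (f n x - g x))\<^sup>2) \<partial>M) \<le> ennreal e" by (rule Fatou[OF e N that])
      then have "(\<integral>\<^sup>+x. ennreal ((cmod (f n x - g x))\<^sup>2) \<partial>M) < \<infinity>"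
        by (rule le_less_trans) simp
      then have s: "square_integrable M (\<lambda>x. f n x - g x)"
        by (intro square_integrable_if_nn_integral) measurable
      have "ennreal (sqnorm M (\<lambda>x. f n x - g x)) \<le> ennreal e"
        using le by (simp only: nn_integral_cmod_square[OF s])
      then show ?thesis using s e by (simp add: ennreal_le_iff)
    qed
    then show ?thesis by blast
  qed
  obtain n where "\<forall>m\<ge>n. square_integrable M (\<lambda>x. f m x - g x) \<and> sqnorm M (\<lambda>x. f m x - g x) \<le> 1"
    using sd[OF zero_less_one] by (rule exE)
  then have n: "square_integrable M (\<lambda>x. f n x - g x)" by simp
  have "square_integrable M (\<lambda>x. f n x - (f n x - g x))"
    by (rule square_integrable_diff[OF f n])
  then have g: "square_integrable M g" by simp
  have lim0: "(\<lambda>n. sqnorm M (\<lambda>x. f n x - g x)) \<longlonglongrightarrow> 0"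
  proof (rule LIMSEQ_I)
    fix e :: real assume "e > 0"
    then have e2: "e / 2 > 0" by simp
    obtain N where N: "\<forall>n\<ge>N. square_integrable M (\<lambda>x. f n x - g x) \<and> sqnorm M (\<lambda>x. f n x - g x) \<le> e/2"
      using sd[OF e2] by (rule exE)
    show "\<exists>N. \<forall>n\<ge>N. norm (sqnorm M (\<lambda>x. f n x - g x) - 0) < e"
    proof (intro exI[of _ N] allI impI)
      fix n assume "n \<ge> N"
      then have "sqnorm M (\<lambda>x. f n x - g x) \<le> e/2" using N by blast
      then show "norm (sqnorm M (\<lambda>x. f n x - g x) - 0) < e" using \<open>e > 0\<close> by simp
    qed
  qed
  show ?thesis
    by (rule exI[of _ g], rule exI[of _ r], intro conjI g r(1) lim lim0)
qed

section \<open>The resolvent of the Laplacian on the line\<close>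

text \<open>Every exchange of two integrals over the line has this shape: two integrable factors
  coupled by a bounded kernel, either an imaginary exponential or the kernel of the
  resolvent.\<close>

lemma integral_swap_kernel:
  fixes f g :: "real \<Rightarrow> complex" and k :: "real \<Rightarrow> real \<Rightarrow> complex"
  assumes f: "integrable lborel f" and g: "integrable lborel g"
    and k [measurable]: "(\<lambda>(x, y). k x y) \<in> borel_measurable (borel \<Otimes>\<^sub>M borel)"
    and bound: "\<And>x y. cmod (k x y) \<le> c"
  shows "(\<integral>x. f x * (\<integral>y. g y * k x y \<partial>lborel) \<partial>lborel) =
         (\<integral>y. g y * (\<integral>x. f x * k x y \<partial>lborel) \<partial>lborel)"
proof -
  have [measurable]: "f \<in> borel_measurable borel" "g \<in> borel_measurable borel"
    using f g by (auto dest: borel_measurable_integrable)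
  have fg: "integrable (lborel \<Otimes>\<^sub>M lborel) (\<lambda>(x, y). f x * g y)"
  proof (rule lborel_pair.Fubini_integrable)
    show "integrable lborel (\<lambda>x. \<integral>y. norm (case (x, y) of (x, y) \<Rightarrow> f x * g y) \<partial>lborel)"
      using f by (simp add: norm_mult)
    show "AE x in lborel. integrable lborel (\<lambda>y. case (x, y) of (x, y) \<Rightarrow> f x * g y)"
      using g by simp
  qed measurable
  have "integrable (lborel \<Otimes>\<^sub>M lborel) (\<lambda>(x, y). f x * (g y * k x y))"
  proof (rule Bochner_Integration.integrable_bound)
    show "integrable (lborel \<Otimes>\<^sub>M lborel) (\<lambda>z. c * cmod (case z of (x, y) \<Rightarrow> f x * g y))"
      using fg by simp
    show "(\<lambda>(x, y). f x * (g y * k x y)) \<in> borel_measurable (lborel \<Otimes>\<^sub>M lborel)"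
      by measurable
    have "cmod (f x * (g y * k x y)) \<le> norm (c * cmod (f x * g y))" for x y
    proof -
      have "cmod (f x * (g y * k x y)) = cmod (k x y) * cmod (f x * g y)"
        by (simp add: norm_mult)
      also have "\<dots> \<le> c * cmod (f x * g y)"
        by (intro mult_right_mono bound) simp
      also have "\<dots> \<le> norm (c * cmod (f x * g y))" by simp
      finally show ?thesis .
    qed
    then show "AE z in lborel \<Otimes>\<^sub>M lborel. norm (case z of (x, y) \<Rightarrow> f x * (g y * k x y))
        \<le> norm (c * cmod (case z of (x, y) \<Rightarrow> f x * g y))"
      by (simp add: case_prod_beta)
  qed
  from lborel_pair.Fubini_integral[OF this]
  have "(\<integral>y. (\<integral>x. f x * (g y * k x y) \<partial>lborel) \<partial>lborel) = (\<integral>x. (\<integral>y. f x * (g y * k x y) \<partial>lborel) \<partial>lborel)" .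
  moreover have "(\<integral>x. f x * (g y * k x y) \<partial>lborel) = g y * (\<integral>x. f x * k x y \<partial>lborel)" for y
  proof -
    have "(\<integral>x. f x * (g y * k x y) \<partial>lborel) = (\<integral>x. g y * (f x * k x y) \<partial>lborel)"
      by (simp only: mult.left_commute)
    then show ?thesis by simp
  qed
  ultimately show ?thesis by simp
qed

lemma has_bochner_integral_exp_half_line:
  fixes z :: complex
  assumes z: "Re z > 0"
  shows "has_bochner_integral lborel (\<lambda>x. indicator {0..} x *\<^sub>R exp (- z * complex_of_real x)) (1 / z)"
proof -
  let ?f = "\<lambda>x. exp (- z * complex_of_real x)"
  have z0: "z \<noteq> 0" using z by auto
  have norm_f: "norm (?f x) = exp (- (x * Re z))" for x
    by (simp add: norm_exp mult.commute)
  have int: "integrable lborel (\<lambda>x. indicator {0..} x *\<^sub>R ?f x)"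
  proof (rule Bochner_Integration.integrable_bound)
    show "integrable lborel (\<lambda>x. indicator {0<..} x *\<^sub>R exp (- (x * Re z)))"
      using integrable_I0i_exp_mscale[OF z] by (simp add: set_integrable_def)
    show "(\<lambda>x. indicator {0..} x *\<^sub>R ?f x) \<in> borel_measurable lborel" by measurable
    show "AE x in lborel. norm (indicator {0..} x *\<^sub>R ?f x) \<le> norm (indicator {0<..} x *\<^sub>R exp (- (x * Re z)))"
      using AE_lborel_singleton[of 0]
      by eventually_elim (simp add: norm_f indicator_def)
  qed
  have "(\<lambda>n. \<integral>x. indicator {0..real n} x *\<^sub>R ?f x \<partial>lborel) \<longlonglongrightarrow> (\<integral>x. indicator {0..} x *\<^sub>R ?f x \<partial>lborel)"
  proof (rule integral_dominated_convergence)
    show "integrable lborel (\<lambda>x. norm (indicator {0..} x *\<^sub>R ?f x))" using int by (rule integrable_norm)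
    show "AE x in lborel. (\<lambda>n. indicator {0..real n} x *\<^sub>R ?f x) \<longlonglongrightarrow> indicator {0..} x *\<^sub>R ?f x"
    proof (rule AE_I2)
      fix x :: real
      have "\<forall>\<^sub>F n in sequentially. indicator {0..real n} x *\<^sub>R ?f x = indicator {0..} x *\<^sub>R ?f x"
        using eventually_ge_at_top[of "nat \<lceil>x\<rceil>"]
      proof eventually_elim
        case (elim n)
        then have "x \<le> real n" by linarith
        then show ?case by (simp add: indicator_def)
      qed
      then show "(\<lambda>n. indicator {0..real n} x *\<^sub>R ?f x) \<longlonglongrightarrow> indicator {0..} x *\<^sub>R ?f x"
        by (rule tendsto_eventually)
    qed
    show "AE x in lborel. norm (indicator {0..real n} x *\<^sub>R ?f x) \<le> norm (indicator {0..} x *\<^sub>R ?f x)" for n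
      by (rule AE_I2) (auto simp: indicator_def)
  qed measurable
  moreover have "(\<integral>x. indicator {0..real n} x *\<^sub>R ?f x \<partial>lborel) = (1 - exp (- z * of_real (real n))) / z" for n
  proof -
    have "(\<integral>x. indicator {0..real n} x *\<^sub>R ?f x \<partial>lborel) =
        (- exp (- z * of_real (real n)) / z) - (- exp (- z * of_real 0) / z)"
    proof (rule integral_FTC_Icc)
      fix x :: real
      have "((\<lambda>w. - exp (- z * w) / z) has_field_derivative exp (- z * of_real x)) (at (of_real x))"
        using z0 by (auto intro!: derivative_eq_intros simp: field_simps)
      then show "((\<lambda>x. - exp (- z * of_real x) / z) has_vector_derivative ?f x) (at x within {0..real n})"
        by (rule has_vector_derivative_real_field)
    qed (auto intro!: continuous_intros)
    then show ?thesis by (simp add: diff_divide_distrib)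
  qed
  moreover have "(\<lambda>n. (1 - exp (- z * of_real (real n))) / z) \<longlonglongrightarrow> (1 - 0) / z"
  proof (intro tendsto_intros z0)
    have "(\<lambda>n. exp (- (real n * Re z))) \<longlonglongrightarrow> 0"
      using z by real_asymp
    then show "(\<lambda>n. exp (- z * of_real (real n))) \<longlonglongrightarrow> 0"
      by (subst tendsto_norm_zero_iff[symmetric]) (simp only: norm_f)
  qed
  ultimately have "(\<integral>x. indicator {0..} x *\<^sub>R ?f x \<partial>lborel) = 1 / z"
    using LIMSEQ_unique by fastforce
  with int show ?thesis by (simp add: has_bochner_integral_iff)
qed

text \<open>The half-lines contribute 1 / (\<theta> - i t) and 1 / (\<theta> + i t); the negative
  one is reduced to the positive one by reflection.\<close>

lemma has_bochner_integral_exp_abs: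
  assumes th: "\<theta> > 0"
  shows "has_bochner_integral lborel (\<lambda>x. complex_of_real (exp (- \<theta> * \<bar>x\<bar>)) * exp (\<i> * complex_of_real (t * x)))
           (complex_of_real (2 * \<theta> / (t\<^sup>2 + \<theta>\<^sup>2)))"
proof -
  let ?z = "complex_of_real \<theta> - \<i> * complex_of_real t"
  let ?w = "complex_of_real \<theta> + \<i> * complex_of_real t"
  have 1: "has_bochner_integral lborel (\<lambda>x. indicator {0..} x *\<^sub>R exp (- ?z * complex_of_real x)) (1 / ?z)"
    by (rule has_bochner_integral_exp_half_line) (use th in simp)
  have "has_bochner_integral lborel (\<lambda>x. indicator {0..} x *\<^sub>R exp (- ?w * complex_of_real x)) (1 / ?w)"
    by (rule has_bochner_integral_exp_half_line) (use th in simp)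
  then have "has_bochner_integral lborel (\<lambda>x. indicator {0..} (0 + (-1) * x) *\<^sub>R exp (- ?w * complex_of_real (0 + (-1) * x))) ((1 / ?w) /\<^sub>R \<bar>-1\<bar>)"
    by (subst (asm) lborel_has_bochner_integral_real_affine_iff[of "-1" _ _ 0]) simp_all
  then have 2: "has_bochner_integral lborel (\<lambda>x. indicator {0..} (- x) *\<^sub>R exp (- ?w * complex_of_real (- x))) (1 / ?w)"
    by simp
  have 3: "has_bochner_integral lborel (\<lambda>x. indicator {0..} x *\<^sub>R exp (- ?z * complex_of_real x) +
      indicator {0..} (- x) *\<^sub>R exp (- ?w * complex_of_real (- x))) (1 / ?z + 1 / ?w)"
    by (rule has_bochner_integral_add[OF 1 2])
  have nz: "?z \<noteq> 0" "?w \<noteq> 0" using th by (auto simp: complex_eq_iff)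
  have "?z * ?w = complex_of_real (t\<^sup>2 + \<theta>\<^sup>2)"
    by (simp add: algebra_simps power2_eq_square)
  moreover have "1 / ?z + 1 / ?w = (?w + ?z) / (?z * ?w)" using nz by (simp add: field_simps)
  ultimately have val: "1 / ?z + 1 / ?w = complex_of_real (2 * \<theta> / (t\<^sup>2 + \<theta>\<^sup>2))" by simp
  show ?thesis
    unfolding val[symmetric]
  proof (rule has_bochner_integral_cong_AE[THEN iffD1, OF _ _ _ 3])
    show "AE x in lborel. indicator {0..} x *\<^sub>R exp (- ?z * complex_of_real x) +
        indicator {0..} (- x) *\<^sub>R exp (- ?w * complex_of_real (- x)) =
        complex_of_real (exp (- \<theta> * \<bar>x\<bar>)) * exp (\<i> * complex_of_real (t * x))"
      using AE_lborel_singleton[of 0]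
    proof eventually_elim
      case (elim x)
      then show ?case
        by (cases "x > 0") (simp_all add: indicator_def exp_of_real[symmetric] exp_add[symmetric] algebra_simps)
    qed
  qed measurable
qed

lemma integrable_lorentz:
  assumes "\<theta> > (0::real)"
  shows "integrable lborel (\<lambda>x::real. 1 / (x\<^sup>2 + \<theta>\<^sup>2))"
proof (rule Bochner_Integration.integrable_bound)
  show "integrable lborel (\<lambda>x::real. max 1 (1 / \<theta>\<^sup>2) * inverse (1 + x\<^sup>2))"
    using integrable_inverse_1_plus_square by (simp add: set_integrable_def)
  show "(\<lambda>x::real. 1 / (x\<^sup>2 + \<theta>\<^sup>2)) \<in> borel_measurable lborel" by measurable
  have "1 / (x\<^sup>2 + \<theta>\<^sup>2) \<le> max 1 (1 / \<theta>\<^sup>2) * inverse (1 + x\<^sup>2)" for x :: real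
  proof -
    have pos: "x\<^sup>2 + \<theta>\<^sup>2 > 0" "1 + x\<^sup>2 > 0" using assms by (auto intro: add_nonneg_pos add_pos_nonneg)
    have "1 + x\<^sup>2 = 1 * x\<^sup>2 + (1 / \<theta>\<^sup>2) * \<theta>\<^sup>2" using assms by simp
    also have "\<dots> \<le> max 1 (1 / \<theta>\<^sup>2) * x\<^sup>2 + max 1 (1 / \<theta>\<^sup>2) * \<theta>\<^sup>2"
      by (intro add_mono mult_right_mono) auto
    finally have "1 + x\<^sup>2 \<le> max 1 (1 / \<theta>\<^sup>2) * (x\<^sup>2 + \<theta>\<^sup>2)" by (simp add: distrib_left)
    then have "1 * (1 + x\<^sup>2) \<le> max 1 (1 / \<theta>\<^sup>2) * (x\<^sup>2 + \<theta>\<^sup>2)" by simp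
    then have "1 / (x\<^sup>2 + \<theta>\<^sup>2) \<le> max 1 (1 / \<theta>\<^sup>2) / (1 + x\<^sup>2)"
      using pos by (subst frac_le_eq) (auto simp: divide_le_0_iff)
    then show ?thesis by (simp add: divide_inverse)
  qed
  moreover have "0 \<le> 1 / (x\<^sup>2 + \<theta>\<^sup>2)" for x by simp
  ultimately show "AE x in lborel. norm (1 / (x\<^sup>2 + \<theta>\<^sup>2)) \<le> norm (max 1 (1 / \<theta>\<^sup>2) * inverse (1 + x\<^sup>2))"
    by (auto simp: abs_mult)
qed

text \<open>A restatement of the characteristic function of the standard normal law: the density
  reproduces itself up to the factor sqrt (2 * pi), which makes it a convenient regulariser for
  inversion.\<close>

lemma integral_gauss_iexp:
  "(\<integral>x. complex_of_real (std_normal_density x) * exp (\<i> * complex_of_real (t * x)) \<partial>lborel) =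
     complex_of_real (sqrt (2 * pi) * std_normal_density t)"
proof -
  have "(\<integral>x. complex_of_real (std_normal_density x) * exp (\<i> * complex_of_real (t * x)) \<partial>lborel) =
      (\<integral>x. std_normal_density x *\<^sub>R exp (\<i> * complex_of_real (t * x)) \<partial>lborel)"
    by (simp add: scaleR_conv_of_real)
  also have "\<dots> = char std_normal_distribution t"
    unfolding char_def by (subst integral_density) (auto simp: normal_density_nonneg)
  also have "\<dots> = complex_of_real (exp (- (t\<^sup>2) / 2))"
    by (simp only: char_std_normal_distribution)
  also have "exp (- (t\<^sup>2) / 2) = sqrt (2 * pi) * std_normal_density t"
    by (simp add: std_normal_density_def)
  finally show ?thesis .
qed

text \<open>Fourier inversion for the Laplace density, by Gaussian regularisation.\<close>

lemma integral_lorentz_iexp: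
  assumes th: "\<theta> > 0"
  shows "(\<integral>x. complex_of_real (1 / (x\<^sup>2 + \<theta>\<^sup>2)) * exp (- (\<i> * complex_of_real (t * x))) \<partial>lborel) =
     complex_of_real (pi / \<theta> * exp (- \<theta> * \<bar>t\<bar>))"
proof -
  define \<phi> where "\<phi> x = complex_of_real (std_normal_density x)" for x
  define g where "g x = complex_of_real (exp (- \<theta> * \<bar>x\<bar>))" for x
  define h where "h x = complex_of_real (2 * \<theta> / (x\<^sup>2 + \<theta>\<^sup>2))" for x
  have [measurable]: "\<phi> \<in> borel_measurable borel" "g \<in> borel_measurable borel" "h \<in> borel_measurable borel"
    unfolding \<phi>_def g_def h_def by measurable
  have int_phi: "integrable lborel \<phi>" unfolding \<phi>_def by simp
  have int_g: "integrable lborel g"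
    using has_bochner_integral_exp_abs[OF th, of 0] by (simp add: has_bochner_integral_iff g_def[abs_def])
  have int_h: "integrable lborel h"
    using integrable_mult_right[OF integrable_lorentz[OF th], of "2 * \<theta>"]
    by (simp add: h_def[abs_def] del: of_real_divide)
  have ft_g: "(\<integral>x. g x * exp (\<i> * complex_of_real (s * x)) \<partial>lborel) = h s" for s
    using has_bochner_integral_exp_abs[OF th, of s] by (simp add: has_bochner_integral_iff g_def h_def)
  \<comment> \<open>Fubini shifts the transform from one factor to the other. As k grows, the left
    side averages g over a Gaussian of width 1 / k around t, while on the right the Gaussian cutoff
    of the Lorentzian tends to a constant.\<close>
  have eq: "complex_of_real (sqrt (2 * pi)) * (\<integral>x. \<phi> x * g (t + x / k) \<partial>lborel) =
      (\<integral>x. \<phi> (x / k) * (h x * exp (- (\<i> * complex_of_real (t * x)))) \<partial>lborel)" if k: "k > 0" for k :: real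
  proof -
    have "(\<integral>x. \<phi> (x / k) * (h x * exp (- (\<i> * complex_of_real (t * x)))) \<partial>lborel) =
        k *\<^sub>R (\<integral>x. \<phi> x * (h (k * x) * exp (- (\<i> * complex_of_real (t * (k * x))))) \<partial>lborel)"
      using k by (subst lborel_integral_real_affine[of k _ 0]) auto
    also have "(\<integral>x. \<phi> x * (h (k * x) * exp (- (\<i> * complex_of_real (t * (k * x))))) \<partial>lborel) =
        (\<integral>x. \<phi> x * (\<integral>y. g y * exp (\<i> * complex_of_real (k * x * (y - t))) \<partial>lborel) \<partial>lborel)"
    proof (rule Bochner_Integration.integral_cong[OF refl])
      fix x
      have "(\<integral>y. g y * exp (\<i> * complex_of_real (k * x * (y - t))) \<partial>lborel) =
          (\<integral>y. (g y * exp (\<i> * complex_of_real (k * x * y))) * exp (- (\<i> * complex_of_real (t * (k * x)))) \<partial>lborel)"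
        by (simp add: algebra_simps exp_add exp_diff exp_minus divide_inverse)
      also have "\<dots> = h (k * x) * exp (- (\<i> * complex_of_real (t * (k * x))))"
        using ft_g[of "k * x"] by simp
      finally show "\<phi> x * (h (k * x) * exp (- (\<i> * complex_of_real (t * (k * x))))) =
          \<phi> x * (\<integral>y. g y * exp (\<i> * complex_of_real (k * x * (y - t))) \<partial>lborel)" by simp
    qed
    also have "\<dots> = (\<integral>y. g y * (\<integral>x. \<phi> x * exp (\<i> * complex_of_real (k * x * (y - t))) \<partial>lborel) \<partial>lborel)"
      by (rule integral_swap_kernel[OF int_phi int_g, where c = 1]) (unfold borel_prod case_prod_beta, intro borel_measurable_continuous_onI continuous_intros, simp only: norm_exp_i_times order_refl)
    also have "\<dots> = (\<integral>y. g y * (complex_of_real (sqrt (2 * pi)) * \<phi> (k * (y - t))) \<partial>lborel)"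
    proof (rule Bochner_Integration.integral_cong[OF refl])
      fix y
      show "g y * (\<integral>x. \<phi> x * exp (\<i> * complex_of_real (k * x * (y - t))) \<partial>lborel) =
          g y * (complex_of_real (sqrt (2 * pi)) * \<phi> (k * (y - t)))"
        using integral_gauss_iexp[of "k * (y - t)"] by (simp add: \<phi>_def mult_ac)
    qed
    also have "\<dots> = complex_of_real (sqrt (2 * pi)) * (\<integral>y. \<phi> (k * (y - t)) * g y \<partial>lborel)"
      by (subst integral_mult_right_zero[symmetric]) (simp only: mult_ac)
    also have "(\<integral>y. \<phi> (k * (y - t)) * g y \<partial>lborel) = (1 / k) *\<^sub>R (\<integral>x. \<phi> x * g (t + x / k) \<partial>lborel)"
      using k by (subst lborel_integral_real_affine[of "1 / k" _ t]) (auto simp: field_simps)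
    finally show ?thesis using k by (simp add: scaleR_conv_of_real)
  qed
  have "(\<lambda>n. \<integral>x. \<phi> x * g (t + x / real (Suc n)) \<partial>lborel) \<longlonglongrightarrow> (\<integral>x. \<phi> x * g t \<partial>lborel)"
  proof (rule integral_dominated_convergence)
    show "integrable lborel (\<lambda>x. norm (\<phi> x))" using int_phi by (rule integrable_norm)
    show "AE x in lborel. (\<lambda>n. \<phi> x * g (t + x / real (Suc n))) \<longlonglongrightarrow> \<phi> x * g t"
    proof (rule AE_I2)
      fix x
      have "(\<lambda>n. x / real (Suc n)) \<longlonglongrightarrow> 0" by real_asymp
      then have "(\<lambda>n. g (t + x / real (Suc n))) \<longlonglongrightarrow> g (t + 0)"
        unfolding g_def by (intro tendsto_intros)
      then show "(\<lambda>n. \<phi> x * g (t + x / real (Suc n))) \<longlonglongrightarrow> \<phi> x * g t"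
        by (intro tendsto_intros) simp
    qed
    show "AE x in lborel. norm (\<phi> x * g (t + x / real (Suc n))) \<le> norm (\<phi> x)" for n
    proof (rule AE_I2)
      fix x
      have "norm (g (t + x / real (Suc n))) \<le> 1" using th by (simp add: g_def)
      then show "norm (\<phi> x * g (t + x / real (Suc n))) \<le> norm (\<phi> x)"
        unfolding norm_mult by (rule mult_left_le) simp
    qed
  qed measurable
  moreover have "(\<integral>x. \<phi> x * g t \<partial>lborel) = g t"
  proof -
    have "(\<integral>x. \<phi> x \<partial>lborel) = 1"
      using integral_gauss_iexp[of 0] by (simp add: \<phi>_def std_normal_density_def)
    then show ?thesis by simp
  qed
  ultimately have "(\<lambda>n. complex_of_real (sqrt (2 * pi)) * (\<integral>x. \<phi> x * g (t + x / real (Suc n)) \<partial>lborel)) \<longlonglongrightarrow>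
      complex_of_real (sqrt (2 * pi)) * g t" by (auto intro!: tendsto_intros)
  then have lim1: "(\<lambda>n. \<integral>x. \<phi> (x / real (Suc n)) * (h x * exp (- (\<i> * complex_of_real (t * x)))) \<partial>lborel) \<longlonglongrightarrow>
      complex_of_real (sqrt (2 * pi)) * g t"
    by (subst (asm) eq) auto
  have bound: "std_normal_density x \<le> 1 / sqrt (2 * pi)" for x
    by (simp add: std_normal_density_def divide_right_mono)
  have lim2: "(\<lambda>n. \<integral>x. \<phi> (x / real (Suc n)) * (h x * exp (- (\<i> * complex_of_real (t * x)))) \<partial>lborel) \<longlonglongrightarrow>
      (\<integral>x. \<phi> 0 * (h x * exp (- (\<i> * complex_of_real (t * x)))) \<partial>lborel)"
  proof (rule integral_dominated_convergence)
    show "integrable lborel (\<lambda>x. 1 / sqrt (2 * pi) * norm (h x))" using int_h by simp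
    show "AE x in lborel. (\<lambda>n. \<phi> (x / real (Suc n)) * (h x * exp (- (\<i> * complex_of_real (t * x))))) \<longlonglongrightarrow>
        \<phi> 0 * (h x * exp (- (\<i> * complex_of_real (t * x))))"
    proof (rule AE_I2)
      fix x
      have "(\<lambda>n. x / real (Suc n)) \<longlonglongrightarrow> 0" by real_asymp
      then have "(\<lambda>n. \<phi> (x / real (Suc n))) \<longlonglongrightarrow> \<phi> 0"
        unfolding \<phi>_def std_normal_density_def by (intro tendsto_intros) auto
      then show "(\<lambda>n. \<phi> (x / real (Suc n)) * (h x * exp (- (\<i> * complex_of_real (t * x))))) \<longlonglongrightarrow>
          \<phi> 0 * (h x * exp (- (\<i> * complex_of_real (t * x))))"
        by (intro tendsto_intros)
    qed
    show "AE x in lborel. norm (\<phi> (x / real (Suc n)) * (h x * exp (- (\<i> * complex_of_real (t * x))))) \<le>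
        1 / sqrt (2 * pi) * norm (h x)" for n
    proof (rule AE_I2)
      fix x
      have "norm (\<phi> (x / real (Suc n))) \<le> 1 / sqrt (2 * pi)"
        using bound[of "x / real (Suc n)"] by (simp add: \<phi>_def normal_density_nonneg)
      then show "norm (\<phi> (x / real (Suc n)) * (h x * exp (- (\<i> * complex_of_real (t * x))))) \<le>
          1 / sqrt (2 * pi) * norm (h x)"
        using mult_right_mono[of "norm (\<phi> (x / real (Suc n)))" "1 / sqrt (2 * pi)" "norm (h x)"]
        by (simp add: norm_mult del: of_nat_Suc)
    qed
  qed measurable
  have "(\<integral>x. \<phi> 0 * (h x * exp (- (\<i> * complex_of_real (t * x)))) \<partial>lborel) = complex_of_real (sqrt (2 * pi)) * g t"
    by (rule LIMSEQ_unique[OF lim2 lim1])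
  moreover have "(\<integral>x. \<phi> 0 * (h x * exp (- (\<i> * complex_of_real (t * x)))) \<partial>lborel) =
      \<phi> 0 * complex_of_real (2 * \<theta>) * (\<integral>x. complex_of_real (1 / (x\<^sup>2 + \<theta>\<^sup>2)) * exp (- (\<i> * complex_of_real (t * x))) \<partial>lborel)"
    by (subst integral_mult_right_zero[symmetric]) (simp add: h_def mult_ac)
  moreover have "\<phi> 0 = 1 / complex_of_real (sqrt (2 * pi))"
    by (simp add: \<phi>_def std_normal_density_def)
  ultimately have "complex_of_real (2 * \<theta>) * (\<integral>x. complex_of_real (1 / (x\<^sup>2 + \<theta>\<^sup>2)) * exp (- (\<i> * complex_of_real (t * x))) \<partial>lborel)
      = complex_of_real (sqrt (2 * pi)) * complex_of_real (sqrt (2 * pi)) * g t"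
    by (simp add: field_simps)
  also have "complex_of_real (sqrt (2 * pi)) * complex_of_real (sqrt (2 * pi)) = complex_of_real (2 * pi)"
    by (simp only: of_real_mult[symmetric] real_sqrt_mult_self) simp
  finally show ?thesis using th by (simp add: g_def field_simps)
qed

section \<open>The Fourier transform and the resolvent on the line\<close>

lemma fourier_measurable [measurable]:
  assumes "u \<in> borel_measurable borel"
  shows "fourier u \<in> borel_measurable borel"
proof -
  note assms [measurable]
  have "(\<lambda>\<xi>. \<integral>x. exp (- (\<i> * complex_of_real (\<xi> * x))) * u x \<partial>lborel) \<in> borel_measurable borel"
    by (rule lborel.borel_measurable_lebesgue_integral) measurable
  then show ?thesis by (simp add: fourier_def[abs_def])
qed

lemma integrable_fourier_kernel:
  assumes "integrable lborel u"
  shows "integrable lborel (\<lambda>x. exp (- (\<i> * complex_of_real (\<xi> * x))) * u x)"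
proof (rule Bochner_Integration.integrable_bound[OF assms])
  show "(\<lambda>x. exp (- (\<i> * complex_of_real (\<xi> * x))) * u x) \<in> borel_measurable lborel"
    using borel_measurable_integrable[OF assms] by measurable
  show "AE x in lborel. norm (exp (- (\<i> * complex_of_real (\<xi> * x))) * u x) \<le> norm (u x)"
    by (simp add: norm_mult)
qed

lemma cmod_fourier_le: "cmod (fourier u \<xi>) \<le> (\<integral>x. cmod (u x) \<partial>lborel)"
proof -
  have "cmod (fourier u \<xi>) \<le> (\<integral>x. cmod (exp (- (\<i> * complex_of_real (\<xi> * x))) * u x) \<partial>lborel)"
    unfolding fourier_def by (rule integral_norm_bound)
  then show ?thesis by (simp add: norm_mult)
qed

lemma fourier_add:
  assumes "integrable lborel u" "integrable lborel v"
  shows "fourier (\<lambda>x. u x + v x) \<xi> = fourier u \<xi> + fourier v \<xi>"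
  unfolding fourier_def distrib_left
  by (rule Bochner_Integration.integral_add) (intro integrable_fourier_kernel assms)+

lemma fourier_scale: "fourier (\<lambda>x. c * u x) \<xi> = c * fourier u \<xi>"
  unfolding fourier_def by (subst integral_mult_right_zero[symmetric]) (simp only: mult.left_commute)

lemma fourier_cong_AE:
  assumes "u \<in> borel_measurable borel" "v \<in> borel_measurable borel" "AE x in lborel. u x = v x"
  shows "fourier u = fourier v"
proof
  fix \<xi>
  note assms(1,2) [measurable]
  show "fourier u \<xi> = fourier v \<xi>"
    unfolding fourier_def by (intro integral_cong_AE) (use assms(3) in auto)
qed

text \<open>Convolution with the Green function of \<theta>^2 - \<Delta> on the whole line, so
  \<theta> is the square root of the parameter s of the kernel \<xi> / (\<xi> + s).\<close>

definition resolvent :: "real \<Rightarrow> (real \<Rightarrow> complex) \<Rightarrow> real \<Rightarrow> complex" where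
  "resolvent \<theta> u y = (\<integral>x. u x * complex_of_real (exp (- \<theta> * \<bar>x - y\<bar>) / (2 * \<theta>)) \<partial>lborel)"

lemma integrable_fourier_lorentz:
  assumes u: "integrable lborel u" and th: "\<theta> > 0"
  shows "integrable lborel (\<lambda>\<xi>. (cmod (fourier u \<xi>))\<^sup>2 / (\<xi>\<^sup>2 + \<theta>\<^sup>2))"
proof (rule Bochner_Integration.integrable_bound)
  let ?c = "(\<integral>x. cmod (u x) \<partial>lborel)\<^sup>2"
  have [measurable]: "u \<in> borel_measurable borel" using borel_measurable_integrable[OF u] by simp
  show "integrable lborel (\<lambda>\<xi>. ?c * (1 / (\<xi>\<^sup>2 + \<theta>\<^sup>2)))"
    by (rule integrable_mult_right[OF integrable_lorentz[OF th]])
  show "(\<lambda>\<xi>. (cmod (fourier u \<xi>))\<^sup>2 / (\<xi>\<^sup>2 + \<theta>\<^sup>2)) \<in> borel_measurable lborel" by measurable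
  show "AE \<xi> in lborel. norm ((cmod (fourier u \<xi>))\<^sup>2 / (\<xi>\<^sup>2 + \<theta>\<^sup>2)) \<le> norm (?c * (1 / (\<xi>\<^sup>2 + \<theta>\<^sup>2)))"
  proof (rule AE_I2)
    fix \<xi>
    have "(cmod (fourier u \<xi>))\<^sup>2 \<le> ?c" by (intro power_mono cmod_fourier_le) simp
    then show "norm ((cmod (fourier u \<xi>))\<^sup>2 / (\<xi>\<^sup>2 + \<theta>\<^sup>2)) \<le> norm (?c * (1 / (\<xi>\<^sup>2 + \<theta>\<^sup>2)))"
      by (simp add: divide_right_mono)
  qed
qed

text \<open>Formally this is Plancherel's identity for u and its resolvent, but it rests only on
  Fubini and the transform of the Lorentzian: both the Lorentzian and u are integrable, so the
  double integral converges absolutely, and integrating over \<xi> first leaves the kernel of the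
  resolvent. Plancherel's theorem can therefore be deduced from it later without
  circularity.\<close>

lemma integral_fourier_lorentz:
  assumes u: "integrable lborel u" and th: "\<theta> > 0"
  shows "complex_of_real (\<integral>\<xi>. (cmod (fourier u \<xi>))\<^sup>2 / (\<xi>\<^sup>2 + \<theta>\<^sup>2) \<partial>lborel) =
     complex_of_real (2 * pi) * hinner lborel u (resolvent \<theta> u)"
proof -
  define \<rho> where "\<rho> x = complex_of_real (1 / (x\<^sup>2 + \<theta>\<^sup>2))" for x
  let ?e = "\<lambda>x y. exp (- (\<i> * complex_of_real (x * y)))"
  have [measurable]: "u \<in> borel_measurable borel" using borel_measurable_integrable[OF u] by simp
  have [measurable]: "cnj \<in> borel_measurable borel" "\<rho> \<in> borel_measurable borel"
    by (intro borel_measurable_continuous_onI continuous_intros) (simp add: \<rho>_def[abs_def])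
  have int_rho: "integrable lborel \<rho>"
    using integrable_lorentz[OF th] by (simp add: \<rho>_def[abs_def] del: of_real_divide)
  have int_rho_e: "integrable lborel (\<lambda>\<xi>. \<rho> \<xi> * ?e \<xi> x)" for x
    by (rule Bochner_Integration.integrable_bound[OF int_rho]) (measurable, simp add: norm_mult)
  have int_rho_F: "integrable lborel (\<lambda>\<xi>. \<rho> \<xi> * cnj (fourier u \<xi>))"
  proof (rule Bochner_Integration.integrable_bound)
    show "integrable lborel (\<lambda>\<xi>. (\<integral>x. cmod (u x) \<partial>lborel) * norm (\<rho> \<xi>))" using int_rho by simp
    show "AE \<xi> in lborel. norm (\<rho> \<xi> * cnj (fourier u \<xi>)) \<le> norm ((\<integral>x. cmod (u x) \<partial>lborel) * norm (\<rho> \<xi>))"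
      using cmod_fourier_le[of u] by (auto simp: norm_mult mult.commute intro!: mult_left_mono)
  qed measurable
  have cnjF: "cnj (fourier u \<xi>) = (\<integral>y. cnj (u y) * exp (\<i> * complex_of_real (\<xi> * y)) \<partial>lborel)" for \<xi>
    unfolding fourier_def Bochner_Integration.integral_cnj[symmetric] by (simp add: mult.commute exp_cnj)
  have inner: "(\<integral>\<xi>. (\<rho> \<xi> * cnj (fourier u \<xi>)) * ?e \<xi> x \<partial>lborel) = complex_of_real (2 * pi) * cnj (resolvent \<theta> u x)" for x
  proof -
    have "(\<integral>\<xi>. (\<rho> \<xi> * cnj (fourier u \<xi>)) * ?e \<xi> x \<partial>lborel) =
        (\<integral>\<xi>. (\<rho> \<xi> * ?e \<xi> x) * (\<integral>y. cnj (u y) * exp (\<i> * complex_of_real (\<xi> * y)) \<partial>lborel) \<partial>lborel)"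
      by (simp only: cnjF mult_ac)
    also have "\<dots> = (\<integral>y. cnj (u y) * (\<integral>\<xi>. (\<rho> \<xi> * ?e \<xi> x) * exp (\<i> * complex_of_real (\<xi> * y)) \<partial>lborel) \<partial>lborel)"
    proof (rule integral_swap_kernel[OF int_rho_e, where c = 1])
      show "integrable lborel (\<lambda>y. cnj (u y))" using u by simp
    qed (unfold borel_prod case_prod_beta, intro borel_measurable_continuous_onI continuous_intros, simp only: norm_exp_i_times order_refl)
    also have "\<dots> = (\<integral>y. cnj (u y) * complex_of_real (pi / \<theta> * exp (- \<theta> * \<bar>y - x\<bar>)) \<partial>lborel)"
    proof (rule Bochner_Integration.integral_cong[OF refl])
      fix y
      have "(\<integral>\<xi>. (\<rho> \<xi> * ?e \<xi> x) * exp (\<i> * complex_of_real (\<xi> * y)) \<partial>lborel) =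
          (\<integral>\<xi>. complex_of_real (1 / (\<xi>\<^sup>2 + \<theta>\<^sup>2)) * exp (- (\<i> * complex_of_real ((x - y) * \<xi>))) \<partial>lborel)"
        unfolding \<rho>_def mult.assoc exp_add[symmetric] by (simp add: algebra_simps)
      also have "\<dots> = complex_of_real (pi / \<theta> * exp (- \<theta> * \<bar>y - x\<bar>))"
        by (simp only: integral_lorentz_iexp[OF th] abs_minus_commute)
      finally show "cnj (u y) * (\<integral>\<xi>. (\<rho> \<xi> * ?e \<xi> x) * exp (\<i> * complex_of_real (\<xi> * y)) \<partial>lborel) =
          cnj (u y) * complex_of_real (pi / \<theta> * exp (- \<theta> * \<bar>y - x\<bar>))" by simp
    qed
    also have "\<dots> = (\<integral>y. complex_of_real (2 * pi) * cnj (u y * complex_of_real (exp (- \<theta> * \<bar>y - x\<bar>) / (2 * \<theta>))) \<partial>lborel)"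
      by (rule Bochner_Integration.integral_cong[OF refl]) simp
    also have "\<dots> = complex_of_real (2 * pi) * cnj (resolvent \<theta> u x)"
      unfolding resolvent_def by (simp only: integral_mult_right_zero Bochner_Integration.integral_cnj)
    finally show ?thesis .
  qed
  have "complex_of_real (\<integral>\<xi>. (cmod (fourier u \<xi>))\<^sup>2 / (\<xi>\<^sup>2 + \<theta>\<^sup>2) \<partial>lborel) =
      (\<integral>\<xi>. complex_of_real ((cmod (fourier u \<xi>))\<^sup>2 / (\<xi>\<^sup>2 + \<theta>\<^sup>2)) \<partial>lborel)"
    by (simp only: integral_complex_of_real)
  also have "\<dots> = (\<integral>\<xi>. (\<rho> \<xi> * cnj (fourier u \<xi>)) * (\<integral>x. u x * ?e \<xi> x \<partial>lborel) \<partial>lborel)"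
  proof (rule Bochner_Integration.integral_cong[OF refl])
    fix \<xi>
    have "complex_of_real ((cmod (fourier u \<xi>))\<^sup>2 / (\<xi>\<^sup>2 + \<theta>\<^sup>2)) = \<rho> \<xi> * (fourier u \<xi> * cnj (fourier u \<xi>))"
      unfolding complex_norm_square[symmetric] by (simp add: \<rho>_def)
    moreover have "(\<integral>x. u x * ?e \<xi> x \<partial>lborel) = fourier u \<xi>"
      unfolding fourier_def by (simp only: mult.commute)
    ultimately show "complex_of_real ((cmod (fourier u \<xi>))\<^sup>2 / (\<xi>\<^sup>2 + \<theta>\<^sup>2)) =
        (\<rho> \<xi> * cnj (fourier u \<xi>)) * (\<integral>x. u x * ?e \<xi> x \<partial>lborel)"
      by (simp only: mult_ac)
  qed
  also have "\<dots> = (\<integral>x. u x * (\<integral>\<xi>. (\<rho> \<xi> * cnj (fourier u \<xi>)) * ?e \<xi> x \<partial>lborel) \<partial>lborel)"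
    by (rule integral_swap_kernel[OF int_rho_F u, where c = 1])
      (unfold borel_prod case_prod_beta, intro borel_measurable_continuous_onI continuous_intros, simp add: norm_exp)
  also have "\<dots> = complex_of_real (2 * pi) * hinner lborel u (resolvent \<theta> u)"
    unfolding inner hinner_def by (subst integral_mult_right_zero[symmetric]) (simp only: mult.left_commute)
  finally show ?thesis .
qed

section \<open>Cosine expansions on an interval\<close>

definition cosine_polynomial :: "(real \<Rightarrow> real) \<Rightarrow> bool" where
  "cosine_polynomial f \<longleftrightarrow> (\<exists>N c. \<forall>t. f t = (\<Sum>k\<le>N. c k * cos (real k * t)))"

lemma cosine_polynomial_add:
  assumes "cosine_polynomial f" "cosine_polynomial g"
  shows "cosine_polynomial (\<lambda>t. f t + g t)"
proof -
  obtain N c M d where f: "\<forall>t. f t = (\<Sum>k\<le>N. c k * cos (real k * t))"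
    and g: "\<forall>t. g t = (\<Sum>k\<le>M. d k * cos (real k * t))"
    using assms unfolding cosine_polynomial_def by blast
  let ?c = "\<lambda>k. (if k \<le> N then c k else 0) + (if k \<le> M then d k else (0::real))"
  have "f t + g t = (\<Sum>k\<le>max N M. ?c k * cos (real k * t))" for t
  proof -
    have "f t = (\<Sum>k\<le>max N M. (if k \<le> N then c k else 0) * cos (real k * t))"
      using f by (auto intro!: sum.mono_neutral_cong_left split: if_split_asm)
    moreover have "g t = (\<Sum>k\<le>max N M. (if k \<le> M then d k else 0) * cos (real k * t))"
      using g by (auto intro!: sum.mono_neutral_cong_left split: if_split_asm)
    ultimately show ?thesis by (simp only: distrib_right sum.distrib)
  qed
  then show ?thesis unfolding cosine_polynomial_def
    by (intro exI[of _ "max N M"] exI[of _ ?c]) simp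
qed

lemma cosine_polynomial_scale:
  assumes "cosine_polynomial f"
  shows "cosine_polynomial (\<lambda>t. r * f t)"
proof -
  obtain N c where "\<forall>t. f t = (\<Sum>k\<le>N. c k * cos (real k * t))"
    using assms unfolding cosine_polynomial_def by blast
  then have "\<forall>t. r * f t = (\<Sum>k\<le>N. (r * c k) * cos (real k * t))"
    by (simp add: sum_distrib_left mult.assoc)
  then show ?thesis unfolding cosine_polynomial_def
    by (intro exI[of _ N] exI[of _ "\<lambda>k. r * c k"])
qed

lemma cosine_polynomial_cos: "cosine_polynomial (\<lambda>t. cos (real n * t))"
  unfolding cosine_polynomial_def
proof (intro exI allI)
  fix t
  show "cos (real n * t) = (\<Sum>k\<le>n. (if k = n then 1 else 0) * cos (real k * t))"
    by (simp add: if_distrib[of "\<lambda>x. x * _"] cong: if_cong)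
qed

lemma cosine_polynomial_sum:
  "finite I \<Longrightarrow> (\<And>i. i \<in> I \<Longrightarrow> cosine_polynomial (f i)) \<Longrightarrow> cosine_polynomial (\<lambda>t. \<Sum>i\<in>I. f i t)"
proof (induction I rule: finite_induct)
  case empty
  then show ?case using cosine_polynomial_scale[OF cosine_polynomial_cos, of 0] by simp
next
  case (insert i I)
  then show ?case by (simp add: cosine_polynomial_add)
qed

text \<open>By the product formula, multiplication by cos t moves the frequency k to its two
  neighbours. Hence all powers of cos t, and all polynomials in cos t, are cosine
  polynomials.\<close>

lemma cosine_polynomial_cos_mult:
  assumes "cosine_polynomial f"
  shows "cosine_polynomial (\<lambda>t. cos t * f t)"
proof -
  obtain N c where f: "\<forall>t. f t = (\<Sum>k\<le>N. c k * cos (real k * t))"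
    using assms unfolding cosine_polynomial_def by blast
  have cc: "cosine_polynomial (\<lambda>t. cos t * cos (real k * t))" for k
  proof (cases k)
    case 0
    then show ?thesis using cosine_polynomial_cos[of 1] by simp
  next
    case (Suc j)
    have eq: "cos t * cos (real k * t) = 1/2 * cos (real (Suc k) * t) + 1/2 * cos (real j * t)" for t
    proof -
      have "cos (real (Suc k) * t) = cos (real k * t + t)" "cos (real j * t) = cos (real k * t - t)"
        by (simp_all add: Suc algebra_simps)
      then show ?thesis by (simp add: cos_add cos_diff field_simps)
    qed
    show ?thesis unfolding eq
      by (intro cosine_polynomial_add cosine_polynomial_scale cosine_polynomial_cos)
  qed
  have "cosine_polynomial (\<lambda>t. \<Sum>k\<le>N. c k * (cos t * cos (real k * t)))"
    by (intro cosine_polynomial_sum cosine_polynomial_scale cc) auto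
  then show ?thesis using f by (simp add: sum_distrib_left mult.left_commute)
qed

lemma cosine_polynomial_cos_power: "cosine_polynomial (\<lambda>t. cos t ^ n)"
proof (induction n)
  case 0
  then show ?case using cosine_polynomial_cos[of 0] by simp
next
  case (Suc n)
  then show ?case by (simp add: cosine_polynomial_cos_mult)
qed

text \<open>Weierstrass approximation after the substitution y = cos t, which maps [0, pi]
  homeomorphically onto [-1, 1]; arbitrary boundary values are thus reached uniformly.\<close>

lemma cosine_polynomial_approx:
  fixes h :: "real \<Rightarrow> real"
  assumes h: "continuous_on {0..pi} h" and e: "e > 0"
  shows "\<exists>f. cosine_polynomial f \<and> (\<forall>t\<in>{0..pi}. \<bar>h t - f t\<bar> < e)"
proof -
  have "continuous_on {-1..1} (\<lambda>y. h (arccos y))"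
    by (rule continuous_on_compose2[OF h continuous_on_arccos']) (auto simp: arccos_lbound arccos_ubound)
  then obtain p where p: "real_polynomial_function p" "\<And>y. y \<in> {-1..1} \<Longrightarrow> \<bar>h (arccos y) - p y\<bar> < e"
    using Stone_Weierstrass_real_polynomial_function[of "{-1..1::real}" "\<lambda>y. h (arccos y)" e] e by auto
  obtain d n where pd: "p = (\<lambda>x. \<Sum>i\<le>n. d i * x ^ i)"
    using p(1) unfolding real_polynomial_function_iff_sum by blast
  have "cosine_polynomial (\<lambda>t. p (cos t))"
    unfolding pd by (intro cosine_polynomial_sum cosine_polynomial_scale cosine_polynomial_cos_power) auto
  moreover have "\<bar>h t - p (cos t)\<bar> < e" if "t \<in> {0..pi}" for t
    using p(2)[of "cos t"] that by (simp add: arccos_cos)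
  ultimately show ?thesis by (intro exI[of _ "\<lambda>t. p (cos t)"]) auto
qed

lemma of_real_indicator_mult:
  "complex_of_real (p * indicator A x * s) * cnj (complex_of_real (q * indicator A x * t)) =
     complex_of_real ((p * q) * indicator A x * (s * t))"
  by (simp add: indicator_def)

lemma hinner_orthonormal_sum:
  assumes "finite I" and e: "\<And>i. i \<in> I \<Longrightarrow> square_integrable M (e i)"
    and on: "\<And>i j. i \<in> I \<Longrightarrow> j \<in> I \<Longrightarrow> hinner M (e i) (e j) = (if i = j then 1 else 0)"
  shows "hinner M (\<lambda>x. \<Sum>i\<in>I. c i * e i x) (\<lambda>x. \<Sum>i\<in>I. d i * e i x) = (\<Sum>i\<in>I. c i * cnj (d i))"
proof -
  have s: "square_integrable M (\<lambda>x. \<Sum>i\<in>I. d i * e i x)"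
    by (intro square_integrable_sum square_integrable_scale e)
  have "hinner M (e i) (\<lambda>x. \<Sum>j\<in>I. d j * e j x) = cnj (d i)" if i: "i \<in> I" for i
  proof -
    have "hinner M (e i) (\<lambda>x. \<Sum>j\<in>I. d j * e j x) = (\<Sum>j\<in>I. cnj (d j) * hinner M (e i) (e j))"
      by (rule hinner_sum_right) (use e i in auto)
    also have "\<dots> = (\<Sum>j\<in>I. if i = j then cnj (d j) else 0)"
      by (intro sum.cong) (auto simp: on i)
    finally show ?thesis using \<open>finite I\<close> i by simp
  qed
  then show ?thesis by (simp add: hinner_sum_left e s)
qed

lemma sqnorm_orthonormal_sum:
  assumes "finite I" and "\<And>i. i \<in> I \<Longrightarrow> square_integrable M (e i)"
    and "\<And>i j. i \<in> I \<Longrightarrow> j \<in> I \<Longrightarrow> hinner M (e i) (e j) = (if i = j then 1 else 0)"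
  shows "sqnorm M (\<lambda>x. \<Sum>i\<in>I. c i * e i x) = (\<Sum>i\<in>I. (cmod (c i))\<^sup>2)"
proof -
  have "hinner M (\<lambda>x. \<Sum>i\<in>I. c i * e i x) (\<lambda>x. \<Sum>i\<in>I. c i * e i x) = (\<Sum>i\<in>I. c i * cnj (c i))"
    by (rule hinner_orthonormal_sum[OF assms])
  then show ?thesis
    unfolding sqnorm_Re by (simp only: Re_sum complex_norm_square[symmetric] Re_complex_of_real)
qed

text \<open>Pythagoras, with the square completed in the coefficients. The last sum is the penalty
  for deviating from the Fourier coefficients, so one identity yields both the remainder formula and
  the best-approximation property.\<close>

lemma sqnorm_diff_orthonormal_sum:
  assumes I: "finite I" and u: "square_integrable M u" and e: "\<And>i. i \<in> I \<Longrightarrow> square_integrable M (e i)"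
    and on: "\<And>i j. i \<in> I \<Longrightarrow> j \<in> I \<Longrightarrow> hinner M (e i) (e j) = (if i = j then 1 else 0)"
  shows "sqnorm M (\<lambda>x. u x - (\<Sum>i\<in>I. c i * e i x)) =
    sqnorm M u - (\<Sum>i\<in>I. (cmod (hinner M u (e i)))\<^sup>2) + (\<Sum>i\<in>I. (cmod (c i - hinner M u (e i)))\<^sup>2)"
proof -
  have s: "square_integrable M (\<lambda>x. \<Sum>i\<in>I. c i * e i x)"
    by (intro square_integrable_sum square_integrable_scale e)
  have id: "(cmod (z - w))\<^sup>2 = (cmod z)\<^sup>2 - 2 * Re (cnj z * w) + (cmod w)\<^sup>2" for z w
    unfolding cmod_power2 by (simp add: power2_eq_square algebra_simps)
  have "sqnorm M (\<lambda>x. u x - (\<Sum>i\<in>I. c i * e i x)) =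
      sqnorm M u - 2 * Re (\<Sum>i\<in>I. cnj (c i) * hinner M u (e i)) + (\<Sum>i\<in>I. (cmod (c i))\<^sup>2)"
    by (simp only: sqnorm_diff[OF u s] sqnorm_orthonormal_sum[OF I e on] hinner_sum_right[OF e u])
  also have "\<dots> = sqnorm M u - (\<Sum>i\<in>I. (cmod (hinner M u (e i)))\<^sup>2) + (\<Sum>i\<in>I. (cmod (c i - hinner M u (e i)))\<^sup>2)"
    unfolding id by (simp add: sum.distrib sum_subtractf sum_distrib_left)
  finally show ?thesis .
qed

section \<open>The space L^2(D)\<close>

lemma L2_on_square_integrable: "u \<in> L2_on D \<Longrightarrow> square_integrable lborel u"
  by (simp add: L2_on_def square_integrable_def)

lemma L2_on_measurable [measurable_dest]: "u \<in> L2_on D \<Longrightarrow> u \<in> borel_measurable borel"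
  by (simp add: L2_on_def)

lemma L2_on_add: "u \<in> L2_on D \<Longrightarrow> v \<in> L2_on D \<Longrightarrow> (\<lambda>x. u x + v x) \<in> L2_on D"
  using square_integrable_add[of lborel u v]
  by (auto simp: L2_on_def square_integrable_def elim: eventually_elim2)

lemma L2_on_scale: "u \<in> L2_on D \<Longrightarrow> (\<lambda>x. c * u x) \<in> L2_on D"
  using square_integrable_scale[of lborel u c]
  by (auto simp: L2_on_def square_integrable_def elim: eventually_mono)

lemma L2_on_zero [simp]: "(\<lambda>x. 0) \<in> L2_on D"
  by (simp add: L2_on_def)

lemma L2_on_diff: "u \<in> L2_on D \<Longrightarrow> v \<in> L2_on D \<Longrightarrow> (\<lambda>x. u x - v x) \<in> L2_on D"
  using L2_on_add[of u D "\<lambda>x. (-1) * v x"] L2_on_scale[of v D "-1"] by simp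

lemma L2_on_sum: "(\<And>i. i \<in> I \<Longrightarrow> f i \<in> L2_on D) \<Longrightarrow> (\<lambda>x. \<Sum>i\<in>I. f i x) \<in> L2_on D"
  by (induction I rule: infinite_finite_induct) (auto intro: L2_on_add)

lemma sqnorm_add_le:
  assumes "square_integrable M u" "square_integrable M v"
  shows "sqnorm M (\<lambda>x. u x + v x) \<le> 2 * sqnorm M u + 2 * sqnorm M v"
proof -
  have "0 \<le> sqnorm M (\<lambda>x. u x - v x)" by simp
  then show ?thesis by (simp add: sqnorm_add sqnorm_diff assms)
qed

lemma sum_le_sums_nonneg:
  fixes f :: "nat \<Rightarrow> real"
  assumes "\<And>k. 0 \<le> f k" "f sums S"
  shows "(\<Sum>k<N. f k) \<le> S"
  using sum_le_suminf[OF sums_summable[OF assms(2)], of "{..<N}"] assms by (simp add: sums_iff)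

locale finite_interval =
  fixes a b :: real
  assumes a_less_b: "a < b"
begin

definition freq :: "nat \<Rightarrow> real" where
  "freq k = real k * pi / (b - a)"

text \<open>The normalised Neumann eigenfunctions of the interval, extended by zero; the constant k
  = 0 has its own normalising factor.\<close>

definition cosb :: "nat \<Rightarrow> real \<Rightarrow> complex" where
  "cosb k x = complex_of_real (cos (freq k * (x - a)) * indicator {a..b} x * sqrt ((if k = 0 then 1 else 2) / (b - a)))"

text \<open>The normalised Dirichlet eigenfunctions, extended by zero. The index k = 0 gives the
  zero function, so the orthonormal family starts at k = 1.\<close>

definition sinb :: "nat \<Rightarrow> real \<Rightarrow> complex" where
  "sinb k x = complex_of_real (sin (freq k * (x - a)) * indicator {a..b} x * sqrt (2 / (b - a)))"

text \<open>An integer frequency covers both the difference and the sum of frequencies that arise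
  from products of cosines and of sines.\<close>

lemma integral_cos_freq:
  "has_bochner_integral lborel (\<lambda>x. cos (of_int j * (pi / (b - a)) * (x - a)) * indicator {a..b} x) (if j = 0 then b - a else 0)"
proof (cases "j = 0")
  case True
  have "has_bochner_integral lborel (\<lambda>x. 1 * indicator {a..b} x) (b - a)"
    by (rule has_bochner_integral_FTC_Icc_real) (use a_less_b in \<open>auto intro!: derivative_eq_intros\<close>)
  then show ?thesis using True by simp
next
  case False
  define \<omega> where "\<omega> = of_int j * (pi / (b - a))"
  have w: "\<omega> \<noteq> 0" using False a_less_b by (simp add: \<omega>_def)
  have "has_bochner_integral lborel (\<lambda>x. cos (\<omega> * (x - a)) * indicator {a..b} x)
      (sin (\<omega> * (b - a)) / \<omega> - sin (\<omega> * (a - a)) / \<omega>)"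
  proof (rule has_bochner_integral_FTC_Icc_real)
    fix x
    show "((\<lambda>x. sin (\<omega> * (x - a)) / \<omega>) has_real_derivative cos (\<omega> * (x - a))) (at x)"
      by (rule derivative_eq_intros refl | (use w in \<open>simp\<close>))+
  qed (use a_less_b in \<open>auto intro!: continuous_intros\<close>)
  moreover have "\<omega> * (b - a) = of_int j * pi" using a_less_b by (simp add: \<omega>_def)
  then have "sin (\<omega> * (b - a)) = 0" by (simp only: sin_times_pi_eq_0 Ints_of_int)
  ultimately show ?thesis using False by (simp add: \<omega>_def)
qed

lemma cosb_measurable [measurable]: "cosb k \<in> borel_measurable borel"
  unfolding cosb_def[abs_def] by measurable

lemma sinb_measurable [measurable]: "sinb k \<in> borel_measurable borel"
  unfolding sinb_def[abs_def] by measurable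

lemma cmod_cosb_le: "cmod (cosb k x) \<le> sqrt (2 / (b - a)) * indicator {a..b} x"
proof -
  have "\<bar>cos (freq k * (x - a))\<bar> * sqrt ((if k = 0 then 1 else 2) / (b - a)) \<le> 1 * sqrt (2 / (b - a))"
    using a_less_b by (intro mult_mono) (auto intro!: divide_right_mono)
  then show ?thesis using a_less_b by (simp add: cosb_def norm_mult abs_mult indicator_def split: if_splits)
qed

lemma cmod_sinb_le: "cmod (sinb k x) \<le> sqrt (2 / (b - a)) * indicator {a..b} x"
proof -
  have "\<bar>sin (freq k * (x - a))\<bar> * sqrt (2 / (b - a)) \<le> 1 * sqrt (2 / (b - a))"
    using a_less_b by (intro mult_mono) auto
  then show ?thesis using a_less_b by (simp add: sinb_def norm_mult abs_mult indicator_def split: if_splits)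
qed

lemma square_integrable_bounded:
  assumes [measurable]: "u \<in> borel_measurable borel" and bound: "\<And>x. cmod (u x) \<le> M * indicator {a..b} x"
  shows "square_integrable lborel u"
  unfolding square_integrable_def
proof
  show "integrable lborel (\<lambda>x. (cmod (u x))\<^sup>2)"
  proof (rule Bochner_Integration.integrable_bound)
    show "integrable lborel (\<lambda>x. M\<^sup>2 * indicator {a..b} x)"
      by (intro integrable_mult_right integrable_real_indicator) (auto simp: emeasure_lborel_Icc_eq)
    have "(cmod (u x))\<^sup>2 \<le> (M * indicator {a..b} x)\<^sup>2" for x
      by (intro power_mono bound) simp
    note sq = this
    have "norm ((cmod (u x))\<^sup>2) \<le> norm (M\<^sup>2 * indicator {a..b} x)" for x
      using sq[of x] by (cases "x \<in> {a..b}") (simp_all add: power_mult_distrib)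
    then show "AE x in lborel. norm ((cmod (u x))\<^sup>2) \<le> norm (M\<^sup>2 * indicator {a..b} x)"
      by (rule AE_I2)
  qed measurable
qed measurable

lemma square_integrable_cosb [simp]: "square_integrable lborel (cosb k)"
  by (rule square_integrable_bounded[OF cosb_measurable cmod_cosb_le])

lemma square_integrable_sinb [simp]: "square_integrable lborel (sinb k)"
  by (rule square_integrable_bounded[OF sinb_measurable cmod_sinb_le])

lemma hinner_cosb: "hinner lborel (cosb j) (cosb k) = (if j = k then 1 else 0)"
proof -
  let ?N = "\<lambda>k. sqrt ((if k = 0 then 1 else 2) / (b - a))"
  define c where "c n x = cos (of_int n * (pi / (b - a)) * (x - a)) * indicator {a..b} x" for n x
  have c: "has_bochner_integral lborel (c n) (if n = 0 then b - a else 0)" for n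
    unfolding c_def[abs_def] by (rule integral_cos_freq)
  have pt: "cosb j x * cnj (cosb k x) = complex_of_real (?N j * ?N k / 2 * (c (int j - int k) x + c (int j + int k) x))" for x
  proof -
    have "cos (freq j * (x - a)) * cos (freq k * (x - a)) =
        1/2 * (cos (freq j * (x - a) - freq k * (x - a)) + cos (freq j * (x - a) + freq k * (x - a)))"
      by (simp add: cos_add cos_diff)
    also have "freq j * (x - a) - freq k * (x - a) = of_int (int j - int k) * (pi / (b - a)) * (x - a)"
      by (simp add: freq_def algebra_simps diff_divide_distrib)
    also have "freq j * (x - a) + freq k * (x - a) = of_int (int j + int k) * (pi / (b - a)) * (x - a)"
      by (simp add: freq_def algebra_simps add_divide_distrib)
    finally have cc: "cos (freq j * (x - a)) * cos (freq k * (x - a)) =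
      1/2 * (cos (of_int (int j - int k) * (pi / (b - a)) * (x - a)) + cos (of_int (int j + int k) * (pi / (b - a)) * (x - a)))" .
    have "cosb j x * cnj (cosb k x) = complex_of_real ((cos (freq j * (x - a)) * cos (freq k * (x - a))) *
        indicator {a..b} x * (?N j * ?N k))"
      unfolding cosb_def by (rule of_real_indicator_mult)
    also have "\<dots> = complex_of_real (?N j * ?N k / 2 * (c (int j - int k) x + c (int j + int k) x))"
      unfolding cc by (simp add: c_def indicator_def)
    finally show ?thesis .
  qed
  have "hinner lborel (cosb j) (cosb k) = complex_of_real (\<integral>x. ?N j * ?N k / 2 * (c (int j - int k) x + c (int j + int k) x) \<partial>lborel)"
    unfolding hinner_def pt by (rule integral_complex_of_real)
  also have "(\<integral>x. ?N j * ?N k / 2 * (c (int j - int k) x + c (int j + int k) x) \<partial>lborel) =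
      ?N j * ?N k / 2 * ((if int j - int k = 0 then b - a else 0) + (if int j + int k = 0 then b - a else 0))"
    by (intro has_bochner_integral_integral_eq has_bochner_integral_mult_right has_bochner_integral_add c)
  also have "\<dots> = (if j = k then 1 else 0)"
  proof (cases "j = k")
    case True
    have "?N j * ?N k = (if j = 0 then 1 else 2) / (b - a)"
      using a_less_b True by simp
    then show ?thesis using a_less_b True by simp
  qed auto
  finally show ?thesis by simp
qed

lemma hinner_sinb:
  assumes "j \<ge> 1" "k \<ge> 1"
  shows "hinner lborel (sinb j) (sinb k) = (if j = k then 1 else 0)"
proof -
  define c where "c n x = cos (of_int n * (pi / (b - a)) * (x - a)) * indicator {a..b} x" for n x
  have c: "has_bochner_integral lborel (c n) (if n = 0 then b - a else 0)" for n
    unfolding c_def[abs_def] by (rule integral_cos_freq)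
  have pt: "sinb j x * cnj (sinb k x) = complex_of_real (1 / (b - a) * (c (int j - int k) x - c (int j + int k) x))" for x
  proof -
    have "sin (freq j * (x - a)) * sin (freq k * (x - a)) =
        1/2 * (cos (freq j * (x - a) - freq k * (x - a)) - cos (freq j * (x - a) + freq k * (x - a)))"
      by (simp add: cos_add cos_diff)
    also have "freq j * (x - a) - freq k * (x - a) = of_int (int j - int k) * (pi / (b - a)) * (x - a)"
      by (simp add: freq_def algebra_simps diff_divide_distrib)
    also have "freq j * (x - a) + freq k * (x - a) = of_int (int j + int k) * (pi / (b - a)) * (x - a)"
      by (simp add: freq_def algebra_simps add_divide_distrib)
    finally have ss: "sin (freq j * (x - a)) * sin (freq k * (x - a)) =
      1/2 * (cos (of_int (int j - int k) * (pi / (b - a)) * (x - a)) - cos (of_int (int j + int k) * (pi / (b - a)) * (x - a)))" .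
    have sq: "sqrt (2 / (b - a)) * sqrt (2 / (b - a)) = 2 / (b - a)" using a_less_b by simp
    have "sinb j x * cnj (sinb k x) = complex_of_real ((sin (freq j * (x - a)) * sin (freq k * (x - a))) *
        indicator {a..b} x * (sqrt (2 / (b - a)) * sqrt (2 / (b - a))))"
      unfolding sinb_def by (rule of_real_indicator_mult)
    also have "\<dots> = complex_of_real (1 / (b - a) * (c (int j - int k) x - c (int j + int k) x))"
      unfolding ss sq by (simp add: c_def indicator_def)
    finally show ?thesis .
  qed
  have "hinner lborel (sinb j) (sinb k) = complex_of_real (\<integral>x. 1 / (b - a) * (c (int j - int k) x - c (int j + int k) x) \<partial>lborel)"
    unfolding hinner_def pt by (rule integral_complex_of_real)
  also have "(\<integral>x. 1 / (b - a) * (c (int j - int k) x - c (int j + int k) x) \<partial>lborel) =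
      1 / (b - a) * ((if int j - int k = 0 then b - a else 0) - (if int j + int k = 0 then b - a else 0))"
    by (intro has_bochner_integral_integral_eq has_bochner_integral_mult_right has_bochner_integral_diff c)
  also have "\<dots> = (if j = k then 1 else 0)"
    using a_less_b assms by auto
  finally show ?thesis by simp
qed

lemma L2_on_integrable:
  assumes u: "u \<in> L2_on {a<..<b}"
  shows "integrable lborel u"
proof (rule Bochner_Integration.integrable_bound)
  have [measurable]: "u \<in> borel_measurable borel" using u by (simp add: L2_on_def)
  show "integrable lborel (\<lambda>x. (cmod (u x))\<^sup>2 + indicator {a..b} x)"
    using u by (intro Bochner_Integration.integrable_add integrable_real_indicator)
      (auto simp: emeasure_lborel_Icc_eq L2_on_def)
  show "u \<in> borel_measurable lborel" by simp
  have "AE x in lborel. x \<notin> {a<..<b} \<longrightarrow> u x = 0" using u by (simp add: L2_on_def)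
  then show "AE x in lborel. norm (u x) \<le> norm ((cmod (u x))\<^sup>2 + indicator {a..b} x)"
  proof eventually_elim
    case (elim x)
    have "r \<le> r\<^sup>2 + 1" if "r \<ge> 0" for r :: real
    proof (cases "r \<le> 1")
      case False
      then have "r * 1 \<le> r * r" using that by (intro mult_left_mono) auto
      then show ?thesis by (simp add: power2_eq_square)
    qed (use zero_le_power2[of r] in linarith)
    from this[of "cmod (u x)"] elim show ?case by (auto simp: indicator_def)
  qed
qed

lemma bounded_in_L2_on:
  assumes "u \<in> borel_measurable borel" and bound: "\<And>x. cmod (u x) \<le> M * indicator {a..b} x"
  shows "u \<in> L2_on {a<..<b}"
proof -
  have "square_integrable lborel u" by (rule square_integrable_bounded[OF assms])
  moreover have "AE x in lborel. x \<notin> {a<..<b} \<longrightarrow> u x = 0"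
    using AE_lborel_singleton[of a] AE_lborel_singleton[of b]
  proof eventually_elim
    case (elim x)
    then show ?case using bound[of x] by (auto simp: indicator_def)
  qed
  ultimately show ?thesis by (simp add: L2_on_def square_integrable_def)
qed

lemma cosb_in_L2_on [simp]: "cosb k \<in> L2_on {a<..<b}"
  by (rule bounded_in_L2_on[OF cosb_measurable cmod_cosb_le])

lemma sinb_in_L2_on [simp]: "sinb k \<in> L2_on {a<..<b}"
  by (rule bounded_in_L2_on[OF sinb_measurable cmod_sinb_le])

section \<open>Density of cosine polynomials in L^2(D)\<close>

definition cos_approximable :: "(real \<Rightarrow> complex) \<Rightarrow> bool" where
  "cos_approximable u \<longleftrightarrow> (\<forall>e>0. \<exists>N c. sqnorm lborel (\<lambda>x. u x - (\<Sum>k\<le>N. c k * cosb k x)) < e)"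

lemma cos_approximable_closed:
  assumes u: "square_integrable lborel u"
    and appr: "\<And>e. e > 0 \<Longrightarrow> \<exists>v. square_integrable lborel v \<and> cos_approximable v \<and> sqnorm lborel (\<lambda>x. u x - v x) < e"
  shows "cos_approximable u"
  unfolding cos_approximable_def
proof (intro allI impI)
  fix e :: real assume "e > 0"
  then have e4: "e / 4 > 0" by simp
  obtain v where v: "square_integrable lborel v" "cos_approximable v" "sqnorm lborel (\<lambda>x. u x - v x) < e / 4"
    using appr[OF e4] by blast
  obtain N c where Nc: "sqnorm lborel (\<lambda>x. v x - (\<Sum>k\<le>N. c k * cosb k x)) < e / 4"
    using v(2) e4 unfolding cos_approximable_def by blast
  have s: "square_integrable lborel (\<lambda>x. \<Sum>k\<le>N. c k * cosb k x)"
    by (intro square_integrable_sum square_integrable_scale) simp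
  have "sqnorm lborel (\<lambda>x. (u x - v x) + (v x - (\<Sum>k\<le>N. c k * cosb k x))) \<le>
      2 * sqnorm lborel (\<lambda>x. u x - v x) + 2 * sqnorm lborel (\<lambda>x. v x - (\<Sum>k\<le>N. c k * cosb k x))"
    by (intro sqnorm_add_le square_integrable_diff u v s)
  also have "\<dots> < e" using v(3) Nc by (simp add: field_simps)
  finally show "\<exists>N c. sqnorm lborel (\<lambda>x. u x - (\<Sum>k\<le>N. c k * cosb k x)) < e"
    by (intro exI[of _ N] exI[of _ c]) simp
qed

lemma uniform_cos_approx_real:
  assumes f: "continuous_on {a..b} f" and e: "e > (0::real)"
  shows "\<exists>N c. \<forall>x\<in>{a..b}. \<bar>f x - (\<Sum>k\<le>N. c k * cos (freq k * (x - a)))\<bar> < e"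
proof -
  have "continuous_on {0..pi} (\<lambda>t. f (a + t * ((b - a) / pi)))"
  proof (rule continuous_on_compose2[OF f])
    show "(\<lambda>t. a + t * ((b - a) / pi)) ` {0..pi} \<subseteq> {a..b}"
    proof (intro image_subsetI)
      fix t assume t: "t \<in> {0..pi}"
      have p: "0 \<le> (b - a) / pi" using a_less_b by simp
      have "t * ((b - a) / pi) \<le> pi * ((b - a) / pi)"
        by (rule mult_right_mono[OF _ p]) (use t in simp)
      moreover have "0 \<le> t * ((b - a) / pi)"
        by (rule mult_nonneg_nonneg[OF _ p]) (use t in simp)
      ultimately show "a + t * ((b - a) / pi) \<in> {a..b}" by simp
    qed
  qed (intro continuous_intros)
  then obtain p where p: "cosine_polynomial p" "\<And>t. t \<in> {0..pi} \<Longrightarrow> \<bar>f (a + t * ((b - a) / pi)) - p t\<bar> < e"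
    using cosine_polynomial_approx[OF _ e] by blast
  obtain N c where c: "\<And>t. p t = (\<Sum>k\<le>N. c k * cos (real k * t))"
    using p(1) unfolding cosine_polynomial_def by blast
  have "\<bar>f x - (\<Sum>k\<le>N. c k * cos (freq k * (x - a)))\<bar> < e" if x: "x \<in> {a..b}" for x
  proof -
    let ?t = "pi * ((x - a) / (b - a))"
    have "(x - a) / (b - a) \<le> 1" "0 \<le> (x - a) / (b - a)" using x a_less_b by auto
    then have "?t \<le> pi * 1" "0 \<le> ?t" by (intro mult_left_mono mult_nonneg_nonneg; simp)+
    then have "\<bar>f (a + ?t * ((b - a) / pi)) - p ?t\<bar> < e" by (intro p(2)) simp
    moreover have "a + ?t * ((b - a) / pi) = x" using a_less_b by simp
    moreover have "p ?t = (\<Sum>k\<le>N. c k * cos (freq k * (x - a)))"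
      unfolding c by (simp add: freq_def mult_ac)
    ultimately show ?thesis by simp
  qed
  then show ?thesis by blast
qed

lemma cos_approximable_continuous:
  assumes f: "continuous_on UNIV f"
  shows "cos_approximable (\<lambda>x. indicator {a..b} x *\<^sub>R f x)"
  unfolding cos_approximable_def
proof (intro allI impI)
  fix e :: real assume "e > 0"
  \<comment> \<open>Errors below d in the real and in the imaginary part give a squared distance of
    at most 2 d^2 (b - a) = e / 4.\<close>
  define d where "d = sqrt (e / (8 * (b - a)))"
  have d: "d > 0" using \<open>e > 0\<close> a_less_b by (simp add: d_def)
  have "continuous_on {a..b} (\<lambda>x. Re (f x))" "continuous_on {a..b} (\<lambda>x. Im (f x))"
    using continuous_on_subset[OF f] by (auto intro!: continuous_intros)
  note cont = this
  obtain N1 c1 where 1: "\<forall>x\<in>{a..b}. \<bar>Re (f x) - (\<Sum>k\<le>N1. c1 k * cos (freq k * (x - a)))\<bar> < d"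
    using uniform_cos_approx_real[OF cont(1) d] by (elim exE)
  obtain N2 c2 where 2: "\<forall>x\<in>{a..b}. \<bar>Im (f x) - (\<Sum>k\<le>N2. c2 k * cos (freq k * (x - a)))\<bar> < d"
    using uniform_cos_approx_real[OF cont(2) d] by (elim exE)
  define N where "N = max N1 N2"
  define c1' where "c1' k = (if k \<le> N1 then c1 k else 0)" for k
  define c2' where "c2' k = (if k \<le> N2 then c2 k else 0)" for k
  define m where "m k = sqrt ((if k = 0 then 1 else 2) / (b - a))" for k :: nat
  have m: "m k \<noteq> 0" for k using a_less_b by (simp add: m_def)
  define c where "c k = Complex (c1' k) (c2' k) / complex_of_real (m k)" for k
  have c1': "(\<Sum>k\<le>N1. c1 k * cos (freq k * (x - a))) = (\<Sum>k\<le>N. c1' k * cos (freq k * (x - a)))" for x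
    by (auto simp: N_def c1'_def intro!: sum.mono_neutral_cong_left split: if_split_asm)
  have c2': "(\<Sum>k\<le>N2. c2 k * cos (freq k * (x - a))) = (\<Sum>k\<le>N. c2' k * cos (freq k * (x - a)))" for x
    by (auto simp: N_def c2'_def intro!: sum.mono_neutral_cong_left split: if_split_asm)
  have ccos: "c k * cosb k x = Complex (c1' k * cos (freq k * (x - a))) (c2' k * cos (freq k * (x - a)))"
    if "x \<in> {a..b}" for x k
    using that m[of k] by (simp add: c_def cosb_def m_def[symmetric] complex_eq_iff)
  let ?P = "\<lambda>x. \<Sum>k\<le>N. c k * cosb k x"
  have bound: "(cmod (indicator {a..b} x *\<^sub>R f x - ?P x))\<^sup>2 \<le> e / (4 * (b - a)) * indicator {a..b} x" for x
  proof (cases "x \<in> {a..b}")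
    case True
    have "?P x = Complex (\<Sum>k\<le>N. c1' k * cos (freq k * (x - a))) (\<Sum>k\<le>N. c2' k * cos (freq k * (x - a)))"
      using ccos[OF True] by (simp add: complex_eq_iff)
    then have "\<bar>Re (f x - ?P x)\<bar> < d" "\<bar>Im (f x - ?P x)\<bar> < d"
      using bspec[OF 1 True] bspec[OF 2 True] unfolding c1' c2' by simp_all
    then have "\<bar>Re (f x - ?P x)\<bar>\<^sup>2 \<le> d\<^sup>2" "\<bar>Im (f x - ?P x)\<bar>\<^sup>2 \<le> d\<^sup>2"
      by (intro power_mono; simp)+
    then have "(cmod (f x - ?P x))\<^sup>2 \<le> 2 * d\<^sup>2" unfolding cmod_power2 by simp
    also have "\<dots> = e / (4 * (b - a))" using \<open>e > 0\<close> a_less_b by (simp add: d_def field_simps)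
    finally show ?thesis using True by simp
  next
    case False
    then show ?thesis by (simp add: cosb_def)
  qed
  have "sqnorm lborel (\<lambda>x. indicator {a..b} x *\<^sub>R f x - ?P x) \<le> (\<integral>x. e / (4 * (b - a)) * indicator {a..b} x \<partial>lborel)"
    unfolding sqnorm_def
  proof (rule integral_mono')
    show "integrable lborel (\<lambda>x. e / (4 * (b - a)) * indicator {a..b} x)"
      by (intro integrable_mult_right integrable_real_indicator) (auto simp: emeasure_lborel_Icc_eq)
    have "0 \<le> e / (4 * (b - a))" using \<open>e > 0\<close> a_less_b by simp
    then show "0 \<le> e / (4 * (b - a)) * indicator {a..b} x" for x
      by (rule mult_nonneg_nonneg) simp
  qed (rule bound)
  also have "\<dots> = e / 4" using a_less_b by (simp add: field_simps)
  also have "\<dots> < e" using \<open>e > 0\<close> by simp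
  finally show "\<exists>N c. sqnorm lborel (\<lambda>x. indicator {a..b} x *\<^sub>R f x - (\<Sum>k\<le>N. c k * cosb k x)) < e"
    by blast
qed

text \<open>A measurable function is almost everywhere a limit of continuous ones, but these need
  not be dominated. Retracting them radially onto the disc of radius M keeps them continuous, leaves
  the limit unchanged and permits dominated convergence.\<close>

lemma cos_approximable_bounded:
  assumes u: "u \<in> L2_on {a<..<b}" and bound: "\<And>x. cmod (u x) \<le> M" and M: "M > 0"
  shows "cos_approximable u"
proof -
  have [measurable]: "u \<in> borel_measurable borel" using u by (simp add: L2_on_def)
  have "u \<in> borel_measurable lebesgue" by (simp add: measurable_completion)
  then have "u measurable_on UNIV" by (rule lebesgue_measurable_imp_measurable_on) simp
  then obtain N g where N: "negligible N" and g: "\<And>n. continuous_on UNIV (g n)"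
    and lim: "\<And>x. x \<notin> N \<Longrightarrow> (\<lambda>n. g n x) \<longlonglongrightarrow> u x"
    unfolding measurable_on_def by auto
  define clip where "clip z = (M / max M (cmod z)) *\<^sub>R z" for z
  have maxM: "max M (cmod z) \<noteq> 0" for z
    using M max.cobounded1[of M "cmod z"] by linarith
  have clip_le: "cmod (clip z) \<le> M" for z
  proof (cases "M \<le> cmod z")
    case True
    then have "cmod z \<noteq> 0" using M by linarith
    then show ?thesis using True M by (simp add: clip_def max_def)
  qed (use M in \<open>simp add: clip_def max_def\<close>)
  have clip_id: "clip z = z" if "cmod z \<le> M" for z
    using that M by (simp add: clip_def max_def)
  have cont: "continuous_on UNIV (\<lambda>x. clip (g n x))" for n
    unfolding clip_def by (intro continuous_intros g) (use maxM in auto)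
  then have [measurable]: "(\<lambda>x. clip (g n x)) \<in> borel_measurable borel" for n
    by (rule borel_measurable_continuous_onI)
  obtain N' where N': "N' \<in> null_sets lborel" "N \<subseteq> N'"
    using N unfolding negligible_iff_null_sets null_sets_completion_iff2 by auto
  have AE_N: "AE x in lborel. x \<notin> N"
    by (rule AE_I'[OF N'(1)]) (use N'(2) in auto)
  let ?v = "\<lambda>n x. indicator {a..b} x *\<^sub>R clip (g n x)"
  have "cmod (?v n x) \<le> M * indicator {a..b} x" for n x
    using clip_le by (simp add: indicator_def)
  then have v: "square_integrable lborel (?v n)" for n
    by (intro square_integrable_bounded) measurable
  have "(\<lambda>n. sqnorm lborel (\<lambda>x. u x - ?v n x)) \<longlonglongrightarrow> (\<integral>x. 0 \<partial>(lborel :: real measure))"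
    unfolding sqnorm_def
  proof (rule integral_dominated_convergence)
    show "integrable lborel (\<lambda>x. (2 * M)\<^sup>2 * indicator {a..b} x)"
      by (intro integrable_mult_right integrable_real_indicator) (auto simp: emeasure_lborel_Icc_eq)
    have out: "AE x in lborel. x \<notin> {a<..<b} \<longrightarrow> u x = 0" using u by (simp add: L2_on_def)
    show "AE x in lborel. (\<lambda>n. (cmod (u x - ?v n x))\<^sup>2) \<longlonglongrightarrow> 0"
      using out AE_N
    proof eventually_elim
      case (elim x)
      have "isCont clip (u x)" unfolding clip_def by (intro continuous_intros) (use maxM in auto)
      then have "(\<lambda>n. clip (g n x)) \<longlonglongrightarrow> clip (u x)"
        by (rule isCont_tendsto_compose[OF _ lim]) (use elim in simp)
      then have "(\<lambda>n. clip (g n x)) \<longlonglongrightarrow> u x" using clip_id[OF bound] by simp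
      then have "(\<lambda>n. (cmod (u x - ?v n x))\<^sup>2) \<longlonglongrightarrow> (cmod (u x - indicator {a..b} x *\<^sub>R u x))\<^sup>2"
        by (intro tendsto_intros)
      moreover have "u x - indicator {a..b} x *\<^sub>R u x = 0"
        using elim by (cases "x \<in> {a..b}") auto
      ultimately show ?case by simp
    qed
    show "AE x in lborel. norm ((cmod (u x - ?v n x))\<^sup>2) \<le> (2 * M)\<^sup>2 * indicator {a..b} x" for n
      using out
    proof eventually_elim
      case (elim x)
      have "cmod (u x - clip (g n x)) \<le> 2 * M"
        using norm_triangle_ineq4[of "u x" "clip (g n x)"] bound[of x] clip_le[of "g n x"] by linarith
      then have "(cmod (u x - clip (g n x)))\<^sup>2 \<le> (2 * M)\<^sup>2" by (intro power_mono) auto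
      then show ?case using elim by (cases "x \<in> {a..b}") auto
    qed
  qed measurable
  then have lim0: "(\<lambda>n. sqnorm lborel (\<lambda>x. u x - ?v n x)) \<longlonglongrightarrow> 0" by simp
  show ?thesis
  proof (rule cos_approximable_closed[OF L2_on_square_integrable[OF u]])
    fix e :: real assume "e > 0"
    then have "\<forall>\<^sub>F n in sequentially. sqnorm lborel (\<lambda>x. u x - ?v n x) < e"
      by (rule order_tendstoD(2)[OF lim0])
    then obtain n where "sqnorm lborel (\<lambda>x. u x - ?v n x) < e"
      by (auto simp: eventually_sequentially)
    then show "\<exists>v. square_integrable lborel v \<and> cos_approximable v \<and> sqnorm lborel (\<lambda>x. u x - v x) < e"
      using v cos_approximable_continuous[OF cont] by (intro exI[of _ "?v n"] conjI)
  qed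
qed

text \<open>Setting u to zero where it exceeds \<open>Suc n\<close> reduces the claim to bounded
  functions; the squared error is dominated by the squared modulus of u.\<close>

lemma cos_approximable_L2_on:
  assumes u: "u \<in> L2_on {a<..<b}"
  shows "cos_approximable u"
proof -
  have [measurable]: "u \<in> borel_measurable borel" using u by (simp add: L2_on_def)
  note su = L2_on_square_integrable[OF u]
  define v where "v n x = (if cmod (u x) \<le> real (Suc n) then u x else 0)" for n x
  have [measurable]: "v n \<in> borel_measurable borel" for n unfolding v_def[abs_def] by measurable
  have sv: "square_integrable lborel (v n)" for n
    unfolding square_integrable_def
  proof
    show "integrable lborel (\<lambda>x. (cmod (v n x))\<^sup>2)"
      by (rule Bochner_Integration.integrable_bound[OF square_integrableD[OF su]]) (auto simp: v_def)
  qed simp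
  have v: "v n \<in> L2_on {a<..<b}" for n
    using sv[of n] u by (auto simp: L2_on_def square_integrable_def v_def elim: eventually_mono)
  have appr: "cos_approximable (v n)" for n
    by (rule cos_approximable_bounded[OF v, of n "real (Suc n)"]) (auto simp: v_def)
  have "(\<lambda>n. sqnorm lborel (\<lambda>x. u x - v n x)) \<longlonglongrightarrow> (\<integral>x. 0 \<partial>(lborel :: real measure))"
    unfolding sqnorm_def
  proof (rule integral_dominated_convergence)
    show "integrable lborel (\<lambda>x. (cmod (u x))\<^sup>2)" by (rule square_integrableD[OF su])
    show "AE x in lborel. (\<lambda>n. (cmod (u x - v n x))\<^sup>2) \<longlonglongrightarrow> 0"
    proof (rule AE_I2)
      fix x
      have "\<forall>\<^sub>F n in sequentially. (cmod (u x - v n x))\<^sup>2 = 0"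
        using eventually_ge_at_top[of "nat \<lceil>cmod (u x)\<rceil>"]
      proof eventually_elim
        case (elim n)
        then have "cmod (u x) \<le> real (Suc n)" by linarith
        then show ?case by (simp add: v_def)
      qed
      then show "(\<lambda>n. (cmod (u x - v n x))\<^sup>2) \<longlonglongrightarrow> 0" by (rule tendsto_eventually)
    qed
    show "AE x in lborel. norm ((cmod (u x - v n x))\<^sup>2) \<le> (cmod (u x))\<^sup>2" for n
      by (rule AE_I2) (simp add: v_def)
  qed measurable
  then have lim0: "(\<lambda>n. sqnorm lborel (\<lambda>x. u x - v n x)) \<longlonglongrightarrow> 0" by simp
  show ?thesis
  proof (rule cos_approximable_closed[OF su])
    fix e :: real assume "e > 0"
    then have "\<forall>\<^sub>F n in sequentially. sqnorm lborel (\<lambda>x. u x - v n x) < e"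
      by (rule order_tendstoD(2)[OF lim0])
    then obtain n where "sqnorm lborel (\<lambda>x. u x - v n x) < e"
      by (auto simp: eventually_sequentially)
    then show "\<exists>v. square_integrable lborel v \<and> cos_approximable v \<and> sqnorm lborel (\<lambda>x. u x - v x) < e"
      using sv appr by (intro exI[of _ "v n"] conjI)
  qed
qed

text \<open>Some cosine polynomial is within e of u, and a Fourier partial sum of at least that
  degree is at least as close, by best approximation.\<close>

lemma cosb_expansion:
  assumes u: "u \<in> L2_on {a<..<b}"
  shows "(\<lambda>n. sqnorm lborel (\<lambda>x. u x - (\<Sum>k<n. hinner lborel u (cosb k) * cosb k x))) \<longlonglongrightarrow> 0"
proof (rule LIMSEQ_I)
  fix e :: real assume "e > 0"
  note su = L2_on_square_integrable[OF u]
  obtain N c where Nc: "sqnorm lborel (\<lambda>x. u x - (\<Sum>k\<le>N. c k * cosb k x)) < e"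
    using cos_approximable_L2_on[OF u] \<open>e > 0\<close> unfolding cos_approximable_def by blast
  have "norm (sqnorm lborel (\<lambda>x. u x - (\<Sum>k<n. hinner lborel u (cosb k) * cosb k x)) - 0) < e" if "n \<ge> Suc N" for n
  proof -
    let ?S = "\<lambda>I. \<Sum>k\<in>I. (cmod (hinner lborel u (cosb k)))\<^sup>2"
    have "sqnorm lborel (\<lambda>x. u x - (\<Sum>k<n. hinner lborel u (cosb k) * cosb k x)) = sqnorm lborel u - ?S {..<n}"
      by (subst sqnorm_diff_orthonormal_sum) (auto simp: su hinner_cosb)
    also have "\<dots> \<le> sqnorm lborel u - ?S {..N}"
      using that by (intro diff_left_mono sum_mono2) auto
    also have "\<dots> \<le> sqnorm lborel (\<lambda>x. u x - (\<Sum>k\<le>N. c k * cosb k x))"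
      by (subst sqnorm_diff_orthonormal_sum) (auto simp: su hinner_cosb intro!: sum_nonneg)
    finally show ?thesis using Nc by simp
  qed
  then show "\<exists>N. \<forall>n\<ge>N. norm (sqnorm lborel (\<lambda>x. u x - (\<Sum>k<n. hinner lborel u (cosb k) * cosb k x)) - 0) < e"
    by blast
qed

lemma cosb_parseval:
  assumes u: "u \<in> L2_on {a<..<b}"
  shows "(\<lambda>k. (cmod (hinner lborel u (cosb k)))\<^sup>2) sums sqnorm lborel u"
proof -
  note su = L2_on_square_integrable[OF u]
  have "sqnorm lborel (\<lambda>x. u x - (\<Sum>k<n. hinner lborel u (cosb k) * cosb k x)) =
      sqnorm lborel u - (\<Sum>k<n. (cmod (hinner lborel u (cosb k)))\<^sup>2)" for n
    by (subst sqnorm_diff_orthonormal_sum) (auto simp: su hinner_cosb)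
  then have "(\<lambda>n. sqnorm lborel u - (\<Sum>k<n. (cmod (hinner lborel u (cosb k)))\<^sup>2)) \<longlonglongrightarrow> 0"
    using cosb_expansion[OF u] by simp
  then have "(\<lambda>n. sqnorm lborel u - (sqnorm lborel u - (\<Sum>k<n. (cmod (hinner lborel u (cosb k)))\<^sup>2))) \<longlonglongrightarrow> sqnorm lborel u - 0"
    by (intro tendsto_intros)
  then show ?thesis by (simp add: sums_def)
qed

text \<open>The polarised identity is required because the Neumann bracket pairs u with another
  function, whose cosine coefficients are multiples of those of u.\<close>

lemma cosb_parseval_hinner:
  assumes u: "u \<in> L2_on {a<..<b}" and v: "v \<in> L2_on {a<..<b}"
  shows "(\<lambda>k. hinner lborel u (cosb k) * cnj (hinner lborel v (cosb k))) sums hinner lborel u v"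
proof -
  note su = L2_on_square_integrable[OF u] and sv = L2_on_square_integrable[OF v]
  let ?P = "\<lambda>n x. \<Sum>k<n. hinner lborel u (cosb k) * cosb k x"
  have sP: "square_integrable lborel (?P n)" for n
    by (intro square_integrable_sum square_integrable_scale) simp
  have diff: "hinner lborel (\<lambda>x. u x - ?P n x) v =
      hinner lborel u v - (\<Sum>k<n. hinner lborel u (cosb k) * cnj (hinner lborel v (cosb k)))" for n
    by (simp add: hinner_diff_left su sv sP hinner_sum_left hinner_cnj)
  have "(\<lambda>n. sqrt (sqnorm lborel (\<lambda>x. u x - ?P n x) * sqnorm lborel v)) \<longlonglongrightarrow> sqrt (0 * sqnorm lborel v)"
    by (intro tendsto_intros cosb_expansion u)
  then have "(\<lambda>n. sqrt (sqnorm lborel (\<lambda>x. u x - ?P n x) * sqnorm lborel v)) \<longlonglongrightarrow> 0" by simp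
  then have "(\<lambda>n. hinner lborel (\<lambda>x. u x - ?P n x) v) \<longlonglongrightarrow> 0"
  proof (rule Lim_null_comparison[rotated])
    show "\<forall>\<^sub>F n in sequentially. norm (hinner lborel (\<lambda>x. u x - ?P n x) v) \<le>
        sqrt (sqnorm lborel (\<lambda>x. u x - ?P n x) * sqnorm lborel v)"
      by (intro always_eventually allI real_le_rsqrt hinner_Cauchy_Schwarz square_integrable_diff su sv sP)
  qed
  then have "(\<lambda>n. hinner lborel u v - hinner lborel (\<lambda>x. u x - ?P n x) v) \<longlonglongrightarrow> hinner lborel u v - 0"
    by (intro tendsto_intros)
  then show ?thesis unfolding diff by (simp add: sums_def)
qed

section \<open>Dirichlet and Neumann bracketing\<close>

text \<open>For c = \<theta> and c = - \<theta> these span the solutions of f'' = \<theta>^2 f on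
  the interval; both rank-two corrections are built from them.\<close>

definition expb :: "real \<Rightarrow> real \<Rightarrow> complex" where
  "expb c x = complex_of_real (exp (c * (x - a)) * indicator {a..b} x)"

text \<open>The cutoff keeps the resolvent of u inside L^2(D), where cosine expansions are
  available; inner products with elements of L^2(D) do not notice it.\<close>

definition cresolvent :: "real \<Rightarrow> (real \<Rightarrow> complex) \<Rightarrow> real \<Rightarrow> complex" where
  "cresolvent \<theta> u y = indicator {a..b} y *\<^sub>R resolvent \<theta> u y"

lemma expb_measurable [measurable]: "expb c \<in> borel_measurable borel"
  unfolding expb_def[abs_def] by measurable

lemma expb_in_L2_on [simp]: "expb c \<in> L2_on {a<..<b}"
proof (rule bounded_in_L2_on)
  fix x
  show "cmod (expb c x) \<le> exp (\<bar>c\<bar> * (b - a)) * indicator {a..b} x"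
  proof (cases "x \<in> {a..b}")
    case True
    then have "c * (x - a) \<le> \<bar>c\<bar> * (b - a)" by (intro mult_mono) auto
    then show ?thesis using True by (simp add: expb_def)
  qed (simp add: expb_def)
qed simp

lemmas square_integrable_expb [simp] = L2_on_square_integrable[OF expb_in_L2_on]

lemma cmod_resolvent_kernel_le:
  assumes "\<theta> > 0"
  shows "cmod (complex_of_real (exp (- \<theta> * \<bar>x - y\<bar>) / (2 * \<theta>))) \<le> 1 / (2 * \<theta>)"
  using assms by (simp add: divide_right_mono norm_divide)

lemma resolvent_measurable:
  assumes "u \<in> borel_measurable borel"
  shows "resolvent \<theta> u \<in> borel_measurable borel"
proof -
  note assms [measurable]
  have "(\<lambda>y. \<integral>x. u x * complex_of_real (exp (- \<theta> * \<bar>x - y\<bar>) / (2 * \<theta>)) \<partial>lborel) \<in> borel_measurable borel"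
    by (rule lborel.borel_measurable_lebesgue_integral) measurable
  then show ?thesis by (simp add: resolvent_def[abs_def])
qed

lemma cmod_resolvent_le:
  assumes u: "integrable lborel u" and th: "\<theta> > 0"
  shows "cmod (resolvent \<theta> u y) \<le> (\<integral>x. cmod (u x) * (1 / (2 * \<theta>)) \<partial>lborel)"
  unfolding resolvent_def
proof (rule Bochner_Integration.integral_norm_bound_integral)
  have [measurable]: "u \<in> borel_measurable borel" using borel_measurable_integrable[OF u] by simp
  have le: "norm (u x * complex_of_real (exp (- \<theta> * \<bar>x - y\<bar>) / (2 * \<theta>))) \<le> cmod (u x) * (1 / (2 * \<theta>))" for x
    unfolding norm_mult by (intro mult_left_mono cmod_resolvent_kernel_le th) simp
  show int: "integrable lborel (\<lambda>x. cmod (u x) * (1 / (2 * \<theta>)))"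
    by (intro integrable_mult_left integrable_norm u)
  show "integrable lborel (\<lambda>x. u x * complex_of_real (exp (- \<theta> * \<bar>x - y\<bar>) / (2 * \<theta>)))"
  proof (rule Bochner_Integration.integrable_bound[OF int])
    show "AE x in lborel. norm (u x * complex_of_real (exp (- \<theta> * \<bar>x - y\<bar>) / (2 * \<theta>)))
        \<le> norm (cmod (u x) * (1 / (2 * \<theta>)))"
      using order_trans[OF le abs_ge_self] by (intro AE_I2) (simp only: real_norm_def)
  qed measurable
qed (unfold norm_mult, intro mult_left_mono cmod_resolvent_kernel_le th, simp)

lemma cresolvent_in_L2_on:
  assumes u: "u \<in> L2_on {a<..<b}" and th: "\<theta> > 0"
  shows "cresolvent \<theta> u \<in> L2_on {a<..<b}"
proof (rule bounded_in_L2_on)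
  have [measurable]: "resolvent \<theta> u \<in> borel_measurable borel"
    using u by (intro resolvent_measurable) (simp add: L2_on_def)
  show "cresolvent \<theta> u \<in> borel_measurable borel"
    unfolding cresolvent_def[abs_def] by measurable
  show "cmod (cresolvent \<theta> u y) \<le> (\<integral>x. cmod (u x) * (1 / (2 * \<theta>)) \<partial>lborel) * indicator {a..b} y" for y
    using cmod_resolvent_le[OF L2_on_integrable[OF u] th, of y] by (simp add: cresolvent_def indicator_def)
qed

lemma hinner_resolvent_eq:
  assumes u: "u \<in> L2_on {a<..<b}" and v: "v \<in> L2_on {a<..<b}" and th: "\<theta> > 0"
  shows "hinner lborel u (resolvent \<theta> v) = hinner lborel u (cresolvent \<theta> v)"
  unfolding hinner_def
proof (rule integral_cong_AE)
  have [measurable]: "u \<in> borel_measurable borel" "resolvent \<theta> v \<in> borel_measurable borel"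
    "cresolvent \<theta> v \<in> borel_measurable borel" "cnj \<in> borel_measurable borel"
    using u v cresolvent_in_L2_on[OF v th]
    by (auto intro: resolvent_measurable borel_measurable_continuous_onI continuous_intros dest: L2_on_measurable)
  show "(\<lambda>x. u x * cnj (resolvent \<theta> v x)) \<in> borel_measurable lborel"
    "(\<lambda>x. u x * cnj (cresolvent \<theta> v x)) \<in> borel_measurable lborel"
    by measurable
  have "AE x in lborel. x \<notin> {a<..<b} \<longrightarrow> u x = 0" using u by (simp add: L2_on_def)
  then show "AE x in lborel. u x * cnj (resolvent \<theta> v x) = u x * cnj (cresolvent \<theta> v x)"
  proof eventually_elim
    case (elim x)
    then show ?case by (cases "x \<in> {a..b}") (auto simp: cresolvent_def)
  qed
qed

lemma hinner_resolvent_sym: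
  assumes u: "integrable lborel u" and v: "integrable lborel v" and th: "\<theta> > 0"
  shows "hinner lborel (resolvent \<theta> u) v = hinner lborel u (resolvent \<theta> v)"
proof -
  let ?k = "\<lambda>x y. complex_of_real (exp (- \<theta> * \<bar>x - y\<bar>) / (2 * \<theta>))"
  have "hinner lborel (resolvent \<theta> u) v = (\<integral>y. cnj (v y) * (\<integral>x. u x * ?k x y \<partial>lborel) \<partial>lborel)"
    unfolding hinner_def resolvent_def by (simp only: mult.commute)
  also have "\<dots> = (\<integral>x. u x * (\<integral>y. cnj (v y) * ?k x y \<partial>lborel) \<partial>lborel)"
    by (rule integral_swap_kernel[symmetric, where c = "1 / (2 * \<theta>)"])
      (use u v cmod_resolvent_kernel_le[OF th] in \<open>auto simp del: of_real_divide\<close>)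
  also have "\<dots> = hinner lborel u (resolvent \<theta> v)"
    unfolding hinner_def
  proof (rule Bochner_Integration.integral_cong[OF refl])
    fix x
    have "cnj (resolvent \<theta> v x) = (\<integral>y. cnj (v y * ?k y x) \<partial>lborel)"
      unfolding resolvent_def by (rule Bochner_Integration.integral_cnj[symmetric])
    also have "\<dots> = (\<integral>y. cnj (v y) * ?k x y \<partial>lborel)"
      by (rule Bochner_Integration.integral_cong[OF refl])
        (simp only: complex_cnj_mult complex_cnj_complex_of_real abs_minus_commute)
    finally show "u x * (\<integral>y. cnj (v y) * ?k x y \<partial>lborel) = u x * cnj (resolvent \<theta> v x)" by simp
  qed
  finally show ?thesis .
qed

lemma hinner_cresolvent_sym:
  assumes u: "u \<in> L2_on {a<..<b}" and v: "v \<in> L2_on {a<..<b}" and th: "\<theta> > 0"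
  shows "hinner lborel (cresolvent \<theta> u) v = hinner lborel u (cresolvent \<theta> v)"
proof -
  have "hinner lborel (cresolvent \<theta> u) v = cnj (hinner lborel v (cresolvent \<theta> u))" by (simp only: hinner_cnj)
  also have "\<dots> = cnj (hinner lborel v (resolvent \<theta> u))" by (simp only: hinner_resolvent_eq[OF v u th])
  also have "\<dots> = hinner lborel u (resolvent \<theta> v)"
    by (simp only: hinner_cnj hinner_resolvent_sym[OF L2_on_integrable[OF u] L2_on_integrable[OF v] th])
  also have "\<dots> = hinner lborel u (cresolvent \<theta> v)" by (rule hinner_resolvent_eq[OF u v th])
  finally show ?thesis .
qed

section \<open>The compressed resolvent on sines and cosines\<close>

lemma has_bochner_integral_exp_sinusoid:
  fixes \<phi> \<phi>' :: "real \<Rightarrow> real"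
  assumes 1: "\<And>x. (\<phi> has_real_derivative \<phi>' x) (at x)"
    and 2: "\<And>x. (\<phi>' has_real_derivative - \<kappa>\<^sup>2 * \<phi> x) (at x)"
    and nz: "c\<^sup>2 + \<kappa>\<^sup>2 \<noteq> 0" and le: "\<alpha> \<le> \<beta>"
  shows "has_bochner_integral lborel (\<lambda>x. (exp (c * (x - y)) * \<phi> x) * indicator {\<alpha>..\<beta>} x)
    (exp (c * (\<beta> - y)) * (c * \<phi> \<beta> - \<phi>' \<beta>) / (c\<^sup>2 + \<kappa>\<^sup>2) - exp (c * (\<alpha> - y)) * (c * \<phi> \<alpha> - \<phi>' \<alpha>) / (c\<^sup>2 + \<kappa>\<^sup>2))"
proof (rule has_bochner_integral_FTC_Icc_real[OF le])
  fix x
  \<comment> \<open>One antiderivative for sine and cosine alike: on differentiation the terms with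
    c * \<phi>' cancel, and the second derivative of \<phi> supplies the summand \<kappa>^2.\<close>
  have "((\<lambda>x. exp (c * (x - y)) * (c * \<phi> x - \<phi>' x)) has_real_derivative (exp (c * (x - y)) * \<phi> x) * (c\<^sup>2 + \<kappa>\<^sup>2)) (at x)"
    by (rule derivative_eq_intros 1 2 refl)+ (simp add: power2_eq_square algebra_simps)
  from DERIV_cdivide[OF this, of "c\<^sup>2 + \<kappa>\<^sup>2"]
  show "((\<lambda>x. exp (c * (x - y)) * (c * \<phi> x - \<phi>' x) / (c\<^sup>2 + \<kappa>\<^sup>2)) has_real_derivative exp (c * (x - y)) * \<phi> x) (at x)"
    by (simp only: nonzero_mult_div_cancel_right[OF nz])
  show "isCont (\<lambda>x. exp (c * (x - y)) * \<phi> x) x"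
    by (intro continuous_intros DERIV_isCont[OF 1])
qed

lemma hinner_sinusoid_expb:
  fixes \<phi> \<phi>' :: "real \<Rightarrow> real"
  assumes 1: "\<And>x. (\<phi> has_real_derivative \<phi>' x) (at x)"
    and 2: "\<And>x. (\<phi>' has_real_derivative - \<kappa>\<^sup>2 * \<phi> x) (at x)"
    and nz: "c\<^sup>2 + \<kappa>\<^sup>2 \<noteq> 0"
  shows "hinner lborel (\<lambda>x. complex_of_real (\<phi> x * indicator {a..b} x)) (expb c) =
    complex_of_real ((exp (c * (b - a)) * (c * \<phi> b - \<phi>' b) - (c * \<phi> a - \<phi>' a)) / (c\<^sup>2 + \<kappa>\<^sup>2))"
proof -
  have "hinner lborel (\<lambda>x. complex_of_real (\<phi> x * indicator {a..b} x)) (expb c) =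
      (\<integral>x. complex_of_real ((exp (c * (x - a)) * \<phi> x) * indicator {a..b} x) \<partial>lborel)"
    unfolding hinner_def expb_def by (rule Bochner_Integration.integral_cong) (auto simp: indicator_def)
  also have "\<dots> = complex_of_real (\<integral>x. (exp (c * (x - a)) * \<phi> x) * indicator {a..b} x \<partial>lborel)"
    by (rule integral_complex_of_real)
  also have "(\<integral>x. (exp (c * (x - a)) * \<phi> x) * indicator {a..b} x \<partial>lborel) =
      exp (c * (b - a)) * (c * \<phi> b - \<phi>' b) / (c\<^sup>2 + \<kappa>\<^sup>2) - exp (c * (a - a)) * (c * \<phi> a - \<phi>' a) / (c\<^sup>2 + \<kappa>\<^sup>2)"
    by (rule has_bochner_integral_integral_eq[OF has_bochner_integral_exp_sinusoid[OF 1 2 nz]])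
      (use a_less_b in simp)
  finally show ?thesis by (simp add: diff_divide_distrib)
qed

text \<open>The first term is a particular solution of the resolvent equation. The exponentials
  repair its mismatch with the solutions decaying outside the interval, which satisfy f' = \<theta>
  f at a and f' = - \<theta> f at b; hence the coefficients \<phi>' a - \<theta> * \<phi> a and
  \<phi>' b + \<theta> * \<phi> b.\<close>

lemma cresolvent_sinusoid:
  fixes \<phi> \<phi>' :: "real \<Rightarrow> real"
  assumes 1: "\<And>x. (\<phi> has_real_derivative \<phi>' x) (at x)"
    and 2: "\<And>x. (\<phi>' has_real_derivative - \<kappa>\<^sup>2 * \<phi> x) (at x)"
    and th: "\<theta> > 0"
  shows "cresolvent \<theta> (\<lambda>x. complex_of_real (\<phi> x * indicator {a..b} x)) y =
    complex_of_real (1 / (\<theta>\<^sup>2 + \<kappa>\<^sup>2)) * complex_of_real (\<phi> y * indicator {a..b} y) +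
    (complex_of_real ((\<phi>' a - \<theta> * \<phi> a) / (2 * \<theta> * (\<theta>\<^sup>2 + \<kappa>\<^sup>2))) * expb (- \<theta>) y +
     complex_of_real (- exp (- \<theta> * (b - a)) * (\<phi>' b + \<theta> * \<phi> b) / (2 * \<theta> * (\<theta>\<^sup>2 + \<kappa>\<^sup>2))) * expb \<theta> y)"
proof (cases "y \<in> {a..b}")
  case False
  then show ?thesis by (simp add: cresolvent_def expb_def)
next
  case True
  define \<Delta> where "\<Delta> = \<theta>\<^sup>2 + \<kappa>\<^sup>2"
  have pos: "\<Delta> > 0" using th by (auto simp: \<Delta>_def intro: add_pos_nonneg)
  then have nz1: "\<theta>\<^sup>2 + \<kappa>\<^sup>2 \<noteq> 0" and nz2: "(- \<theta>)\<^sup>2 + \<kappa>\<^sup>2 \<noteq> 0" by (auto simp: \<Delta>_def)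
  \<comment> \<open>Splitting the integral at y removes the absolute value from the kernel; the
    contributions of \<phi>' y cancel between the two halves.\<close>
  have left: "has_bochner_integral lborel (\<lambda>x. (exp (\<theta> * (x - y)) * \<phi> x) * indicator {a..y} x)
    (exp (\<theta> * (y - y)) * (\<theta> * \<phi> y - \<phi>' y) / (\<theta>\<^sup>2 + \<kappa>\<^sup>2) - exp (\<theta> * (a - y)) * (\<theta> * \<phi> a - \<phi>' a) / (\<theta>\<^sup>2 + \<kappa>\<^sup>2))"
    by (rule has_bochner_integral_exp_sinusoid[OF 1 2 nz1]) (use True in simp)
  have right: "has_bochner_integral lborel (\<lambda>x. (exp (- \<theta> * (x - y)) * \<phi> x) * indicator {y..b} x)
    (exp (- \<theta> * (b - y)) * (- \<theta> * \<phi> b - \<phi>' b) / ((- \<theta>)\<^sup>2 + \<kappa>\<^sup>2) - exp (- \<theta> * (y - y)) * (- \<theta> * \<phi> y - \<phi>' y) / ((- \<theta>)\<^sup>2 + \<kappa>\<^sup>2))"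
    by (rule has_bochner_integral_exp_sinusoid[OF 1 2 nz2]) (use True in simp)
  let ?V = "(2 * \<theta> * \<phi> y - exp (- \<theta> * (y - a)) * (\<theta> * \<phi> a - \<phi>' a) - exp (- \<theta> * (b - y)) * (\<theta> * \<phi> b + \<phi>' b)) / \<Delta>"
  have V: "(exp (\<theta> * (y - y)) * (\<theta> * \<phi> y - \<phi>' y) / (\<theta>\<^sup>2 + \<kappa>\<^sup>2) - exp (\<theta> * (a - y)) * (\<theta> * \<phi> a - \<phi>' a) / (\<theta>\<^sup>2 + \<kappa>\<^sup>2)) +
      (exp (- \<theta> * (b - y)) * (- \<theta> * \<phi> b - \<phi>' b) / ((- \<theta>)\<^sup>2 + \<kappa>\<^sup>2) - exp (- \<theta> * (y - y)) * (- \<theta> * \<phi> y - \<phi>' y) / ((- \<theta>)\<^sup>2 + \<kappa>\<^sup>2)) = ?V"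
  proof -
    have "exp (\<theta> * (a - y)) = exp (- \<theta> * (y - a))" by (simp add: algebra_simps)
    then show ?thesis
      unfolding power2_minus \<Delta>_def[symmetric] using pos by (simp add: field_simps)
  qed
  have "has_bochner_integral lborel (\<lambda>x. (\<phi> x * indicator {a..b} x) * exp (- \<theta> * \<bar>x - y\<bar>)) ?V"
  proof (rule has_bochner_integral_cong_AE[THEN iffD1, OF _ _ _ has_bochner_integral_add[OF left right, unfolded V]])
    show "AE x in lborel. (exp (\<theta> * (x - y)) * \<phi> x) * indicator {a..y} x + (exp (- \<theta> * (x - y)) * \<phi> x) * indicator {y..b} x =
        (\<phi> x * indicator {a..b} x) * exp (- \<theta> * \<bar>x - y\<bar>)"
      using AE_lborel_singleton[of y]
    proof eventually_elim
      case (elim x)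
      then show ?case using True by (cases "x < y") (auto simp: indicator_def algebra_simps)
    qed
    have [measurable]: "\<phi> \<in> borel_measurable borel"
      by (intro borel_measurable_continuous_onI continuous_at_imp_continuous_on ballI DERIV_isCont[OF 1])
    show "(\<lambda>x. (exp (\<theta> * (x - y)) * \<phi> x) * indicator {a..y} x + (exp (- \<theta> * (x - y)) * \<phi> x) * indicator {y..b} x) \<in> borel_measurable lborel"
      "(\<lambda>x. (\<phi> x * indicator {a..b} x) * exp (- \<theta> * \<bar>x - y\<bar>)) \<in> borel_measurable lborel" by measurable
  qed
  then have int: "(\<integral>x. (\<phi> x * indicator {a..b} x) * exp (- \<theta> * \<bar>x - y\<bar>) \<partial>lborel) = ?V"
    by (rule has_bochner_integral_integral_eq)
  have "cresolvent \<theta> (\<lambda>x. complex_of_real (\<phi> x * indicator {a..b} x)) y =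
      (\<integral>x. complex_of_real ((\<phi> x * indicator {a..b} x) * exp (- \<theta> * \<bar>x - y\<bar>) / (2 * \<theta>)) \<partial>lborel)"
    using True unfolding cresolvent_def resolvent_def by (simp add: mult.assoc)
  also have "\<dots> = complex_of_real (\<integral>x. (\<phi> x * indicator {a..b} x) * exp (- \<theta> * \<bar>x - y\<bar>) / (2 * \<theta>) \<partial>lborel)"
    by (rule integral_complex_of_real)
  also have "(\<integral>x. (\<phi> x * indicator {a..b} x) * exp (- \<theta> * \<bar>x - y\<bar>) / (2 * \<theta>) \<partial>lborel) = ?V / (2 * \<theta>)"
    by (simp only: integral_divide_zero int)
  also have "?V / (2 * \<theta>) = 1 / \<Delta> * \<phi> y + ((\<phi>' a - \<theta> * \<phi> a) / (2 * \<theta> * \<Delta>) * exp (- \<theta> * (y - a)) +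
      - exp (- \<theta> * (b - a)) * (\<phi>' b + \<theta> * \<phi> b) / (2 * \<theta> * \<Delta>) * exp (\<theta> * (y - a)))"
  proof -
    have "exp (- \<theta> * (b - y)) = exp (- \<theta> * (b - a)) * exp (\<theta> * (y - a))"
      by (simp add: exp_add[symmetric] algebra_simps)
    moreover have "(2 * \<theta> * p - q * (\<theta> * pa - pa') - r * q' * (\<theta> * pb + pb')) / \<Delta> / (2 * \<theta>) =
        1 / \<Delta> * p + ((pa' - \<theta> * pa) / (2 * \<theta> * \<Delta>) * q + - r * (pb' + \<theta> * pb) / (2 * \<theta> * \<Delta>) * q')"
      for p q pa pa' pb pb' r q' :: real
      using pos th by (simp add: field_simps)
    ultimately show ?thesis by simp
  qed
  finally show ?thesis using True by (simp add: expb_def \<Delta>_def)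
qed

lemma freq_mult_length: "freq k * (b - a) = real k * pi"
  using a_less_b by (simp add: freq_def)

definition cosb_norm :: "nat \<Rightarrow> real" where
  "cosb_norm k = sqrt ((if k = 0 then 1 else 2) / (b - a))"

lemma cosb_norm_pos: "cosb_norm k > 0"
  using a_less_b by (simp add: cosb_norm_def)

text \<open>The Neumann boundary data: derivatives vanish at both ends, so only boundary values
  enter the correction terms.\<close>

lemma cosb_sinusoid:
  fixes k :: nat
  defines "\<phi> \<equiv> \<lambda>x. cos (freq k * (x - a)) * cosb_norm k"
    and "\<phi>' \<equiv> \<lambda>x. - freq k * sin (freq k * (x - a)) * cosb_norm k"
  shows "cosb k = (\<lambda>x. complex_of_real (\<phi> x * indicator {a..b} x))"
    "(\<phi> has_real_derivative \<phi>' x) (at x)"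
    "(\<phi>' has_real_derivative - (freq k)\<^sup>2 * \<phi> x) (at x)"
    "\<phi> a = cosb_norm k" "\<phi>' a = 0" "\<phi> b = (-1)^k * cosb_norm k" "\<phi>' b = 0"
proof -
  show "cosb k = (\<lambda>x. complex_of_real (\<phi> x * indicator {a..b} x))"
    by (simp add: fun_eq_iff cosb_def \<phi>_def cosb_norm_def)
  show "(\<phi> has_real_derivative \<phi>' x) (at x)"
    unfolding \<phi>_def \<phi>'_def by (rule derivative_eq_intros refl)+ simp
  show "(\<phi>' has_real_derivative - (freq k)\<^sup>2 * \<phi> x) (at x)"
    unfolding \<phi>_def \<phi>'_def by (rule derivative_eq_intros refl)+ (simp add: power2_eq_square)
qed (simp_all add: \<phi>_def \<phi>'_def freq_mult_length cos_npi sin_npi)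

text \<open>The Dirichlet boundary data: values vanish at both ends, so only boundary derivatives
  enter the correction terms.\<close>

lemma sinb_sinusoid:
  fixes k :: nat
  defines "\<phi> \<equiv> \<lambda>x. sin (freq k * (x - a)) * sqrt (2 / (b - a))"
    and "\<phi>' \<equiv> \<lambda>x. freq k * cos (freq k * (x - a)) * sqrt (2 / (b - a))"
  shows "sinb k = (\<lambda>x. complex_of_real (\<phi> x * indicator {a..b} x))"
    "(\<phi> has_real_derivative \<phi>' x) (at x)"
    "(\<phi>' has_real_derivative - (freq k)\<^sup>2 * \<phi> x) (at x)"
    "\<phi> a = 0" "\<phi>' a = freq k * sqrt (2 / (b - a))" "\<phi> b = 0" "\<phi>' b = (-1)^k * (freq k * sqrt (2 / (b - a)))"
proof -
  show "sinb k = (\<lambda>x. complex_of_real (\<phi> x * indicator {a..b} x))"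
    by (simp add: fun_eq_iff sinb_def \<phi>_def)
  show "(\<phi> has_real_derivative \<phi>' x) (at x)"
    unfolding \<phi>_def \<phi>'_def by (rule derivative_eq_intros refl)+ simp
  show "(\<phi>' has_real_derivative - (freq k)\<^sup>2 * \<phi> x) (at x)"
    unfolding \<phi>_def \<phi>'_def by (rule derivative_eq_intros refl)+ (simp add: power2_eq_square)
qed (simp_all add: \<phi>_def \<phi>'_def freq_mult_length cos_npi sin_npi)

lemma resolvent_denominator_pos: "\<theta> > 0 \<Longrightarrow> \<theta>\<^sup>2 + (freq k)\<^sup>2 > 0"
  by (intro add_pos_nonneg) auto

lemma exp_neg_length:
  assumes "\<theta> > 0"
  shows "0 < exp (- \<theta> * (b - a))" "exp (- \<theta> * (b - a)) < 1" "(exp (- \<theta> * (b - a)))\<^sup>2 < 1"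
proof -
  show 1: "0 < exp (- \<theta> * (b - a))" by simp
  show 2: "exp (- \<theta> * (b - a)) < 1" using assms a_less_b by (simp add: mult_pos_pos)
  show "(exp (- \<theta> * (b - a)))\<^sup>2 < 1"
    using power_strict_mono[OF 2, of 2] 1 by simp
qed

text \<open>The point is the form of the correction. Its coefficients come from boundary values of
  the cosine, but they are rewritten as combinations of A and B, the inner products with the two
  exponentials, in which the index k no longer appears. The correction is thereby recognised as one
  fixed operator of rank two, valid for all k at once. The denominator 1 - r^2 is 2 r sinh (\<theta>
  (b - a)), the usual Wronskian factor of the interval.\<close>

lemma cosb_coefficients:
  fixes k :: nat
  assumes th: "\<theta> > 0"
  defines "r \<equiv> exp (- \<theta> * (b - a))" and "\<Delta> \<equiv> \<theta>\<^sup>2 + (freq k)\<^sup>2"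
    and "A \<equiv> \<theta> * cosb_norm k * ((-1)^k / exp (- \<theta> * (b - a)) - 1) / (\<theta>\<^sup>2 + (freq k)\<^sup>2)"
    and "B \<equiv> \<theta> * cosb_norm k * (1 - (-1)^k * exp (- \<theta> * (b - a))) / (\<theta>\<^sup>2 + (freq k)\<^sup>2)"
  shows "hinner lborel (cosb k) (expb \<theta>) = complex_of_real A"
    and "hinner lborel (cosb k) (expb (- \<theta>)) = complex_of_real B"
    and "cresolvent \<theta> (cosb k) = (\<lambda>y. complex_of_real (1 / \<Delta>) * cosb k y +
      (complex_of_real (- (r\<^sup>2 * (A + B)) / (2 * \<theta> * (1 - r\<^sup>2))) * expb \<theta> y +
       complex_of_real (- (r\<^sup>2 * A + B) / (2 * \<theta> * (1 - r\<^sup>2))) * expb (- \<theta>) y))"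
proof -
  note S = cosb_sinusoid[of k]
  have D: "\<Delta> > 0" using resolvent_denominator_pos[OF th] by (simp add: \<Delta>_def)
  have r: "0 < r" "r\<^sup>2 < 1" using exp_neg_length[OF th] by (auto simp: r_def)
  have E: "exp (\<theta> * (b - a)) = 1 / r" by (simp add: r_def exp_minus divide_inverse)
  have nz: "\<theta>\<^sup>2 + (freq k)\<^sup>2 \<noteq> 0" "(- \<theta>)\<^sup>2 + (freq k)\<^sup>2 \<noteq> 0" using D by (auto simp: \<Delta>_def)
  show "hinner lborel (cosb k) (expb \<theta>) = complex_of_real A"
    unfolding S(1) hinner_sinusoid_expb[OF S(2,3) nz(1)] unfolding S(4-7) E A_def r_def[symmetric]
    by (rule arg_cong[of _ _ complex_of_real]) (simp add: algebra_simps)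
  show "hinner lborel (cosb k) (expb (- \<theta>)) = complex_of_real B"
    unfolding S(1) hinner_sinusoid_expb[OF S(2,3) nz(2)] unfolding S(4-7) B_def r_def[symmetric] power2_minus
    by (rule arg_cong[of _ _ complex_of_real]) (simp add: algebra_simps)
  have 1: "(0 - \<theta> * cosb_norm k) / (2 * \<theta> * \<Delta>) = - (r\<^sup>2 * A + B) / (2 * \<theta> * (1 - r\<^sup>2))"
    unfolding A_def B_def r_def[symmetric] \<Delta>_def[symmetric]
    using th D r by (simp add: field_simps power2_eq_square)
  have 2: "- r * (0 + \<theta> * ((-1)^k * cosb_norm k)) / (2 * \<theta> * \<Delta>) = - (r\<^sup>2 * (A + B)) / (2 * \<theta> * (1 - r\<^sup>2))"
    unfolding A_def B_def r_def[symmetric] \<Delta>_def[symmetric]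
    using th D r by (simp add: field_simps power2_eq_square)
  show "cresolvent \<theta> (cosb k) = (\<lambda>y. complex_of_real (1 / \<Delta>) * cosb k y +
      (complex_of_real (- (r\<^sup>2 * (A + B)) / (2 * \<theta> * (1 - r\<^sup>2))) * expb \<theta> y +
       complex_of_real (- (r\<^sup>2 * A + B) / (2 * \<theta> * (1 - r\<^sup>2))) * expb (- \<theta>) y))"
  proof
    fix y
    show "cresolvent \<theta> (cosb k) y = complex_of_real (1 / \<Delta>) * cosb k y +
      (complex_of_real (- (r\<^sup>2 * (A + B)) / (2 * \<theta> * (1 - r\<^sup>2))) * expb \<theta> y +
       complex_of_real (- (r\<^sup>2 * A + B) / (2 * \<theta> * (1 - r\<^sup>2))) * expb (- \<theta>) y)"
      unfolding 1[symmetric] 2[symmetric]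
      using cresolvent_sinusoid[OF S(2,3) th, of y, unfolded S(4-7) S(1)[symmetric]]
      by (simp only: fun_cong[OF S(1), of y] \<Delta>_def r_def add.commute)
  qed
qed

text \<open>The Dirichlet counterpart, again with coefficients independent of k. Compared with the
  cosines, the diagonal terms change sign and the off-diagonal ones do not, which reverses the sign
  of the correction.\<close>

lemma sinb_coefficients:
  fixes k :: nat
  assumes th: "\<theta> > 0"
  defines "r \<equiv> exp (- \<theta> * (b - a))" and "\<Delta> \<equiv> \<theta>\<^sup>2 + (freq k)\<^sup>2"
    and "A \<equiv> freq k * sqrt (2 / (b - a)) * (1 - (-1)^k / exp (- \<theta> * (b - a))) / (\<theta>\<^sup>2 + (freq k)\<^sup>2)"
    and "B \<equiv> freq k * sqrt (2 / (b - a)) * (1 - (-1)^k * exp (- \<theta> * (b - a))) / (\<theta>\<^sup>2 + (freq k)\<^sup>2)"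
  shows "hinner lborel (sinb k) (expb \<theta>) = complex_of_real A"
    and "hinner lborel (sinb k) (expb (- \<theta>)) = complex_of_real B"
    and "cresolvent \<theta> (sinb k) = (\<lambda>y. complex_of_real (1 / \<Delta>) * sinb k y +
      (complex_of_real (r\<^sup>2 * (A - B) / (2 * \<theta> * (1 - r\<^sup>2))) * expb \<theta> y +
       complex_of_real ((B - r\<^sup>2 * A) / (2 * \<theta> * (1 - r\<^sup>2))) * expb (- \<theta>) y))"
proof -
  note S = sinb_sinusoid[of k]
  have D: "\<Delta> > 0" using resolvent_denominator_pos[OF th] by (simp add: \<Delta>_def)
  have r: "0 < r" "r\<^sup>2 < 1" using exp_neg_length[OF th] by (auto simp: r_def)
  have E: "exp (\<theta> * (b - a)) = 1 / r" by (simp add: r_def exp_minus divide_inverse)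
  have nz: "\<theta>\<^sup>2 + (freq k)\<^sup>2 \<noteq> 0" "(- \<theta>)\<^sup>2 + (freq k)\<^sup>2 \<noteq> 0" using D by (auto simp: \<Delta>_def)
  show "hinner lborel (sinb k) (expb \<theta>) = complex_of_real A"
    unfolding S(1) hinner_sinusoid_expb[OF S(2,3) nz(1)] unfolding S(4-7) E A_def r_def[symmetric]
    by (rule arg_cong[of _ _ complex_of_real]) (simp add: algebra_simps)
  show "hinner lborel (sinb k) (expb (- \<theta>)) = complex_of_real B"
    unfolding S(1) hinner_sinusoid_expb[OF S(2,3) nz(2)] unfolding S(4-7) B_def r_def[symmetric] power2_minus
    by (rule arg_cong[of _ _ complex_of_real]) (simp add: algebra_simps)
  have 1: "(freq k * sqrt (2 / (b - a)) - \<theta> * 0) / (2 * \<theta> * \<Delta>) = (B - r\<^sup>2 * A) / (2 * \<theta> * (1 - r\<^sup>2))"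
    unfolding A_def B_def r_def[symmetric] \<Delta>_def[symmetric]
    using th D r by (simp add: field_simps power2_eq_square)
  have 2: "- r * ((-1)^k * (freq k * sqrt (2 / (b - a))) + \<theta> * 0) / (2 * \<theta> * \<Delta>) = r\<^sup>2 * (A - B) / (2 * \<theta> * (1 - r\<^sup>2))"
    unfolding A_def B_def r_def[symmetric] \<Delta>_def[symmetric]
    using th D r by (simp add: field_simps power2_eq_square)
  show "cresolvent \<theta> (sinb k) = (\<lambda>y. complex_of_real (1 / \<Delta>) * sinb k y +
      (complex_of_real (r\<^sup>2 * (A - B) / (2 * \<theta> * (1 - r\<^sup>2))) * expb \<theta> y +
       complex_of_real ((B - r\<^sup>2 * A) / (2 * \<theta> * (1 - r\<^sup>2))) * expb (- \<theta>) y))"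
  proof
    fix y
    show "cresolvent \<theta> (sinb k) y = complex_of_real (1 / \<Delta>) * sinb k y +
      (complex_of_real (r\<^sup>2 * (A - B) / (2 * \<theta> * (1 - r\<^sup>2))) * expb \<theta> y +
       complex_of_real ((B - r\<^sup>2 * A) / (2 * \<theta> * (1 - r\<^sup>2))) * expb (- \<theta>) y)"
      unfolding 1[symmetric] 2[symmetric]
      using cresolvent_sinusoid[OF S(2,3) th, of y, unfolded S(4-7) S(1)[symmetric]]
      by (simp only: fun_cong[OF S(1), of y] \<Delta>_def r_def add.commute)
  qed
qed

section \<open>Comparison of the line with the Neumann and the Dirichlet resolvent\<close>

abbreviation coef :: "(real \<Rightarrow> complex) \<Rightarrow> nat \<Rightarrow> complex" where
  "coef u k \<equiv> hinner lborel u (cosb k)"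

definition resolvent_form :: "real \<Rightarrow> (real \<Rightarrow> complex) \<Rightarrow> real" where
  "resolvent_form \<theta> u = Re (hinner lborel u (cresolvent \<theta> u))"

text \<open>To the left of \<open>a\<close> the resolvent of \<open>u\<close> equals \<open>z * exp (\<theta> * (x - a)) / (2 * \<theta>)\<close> with \<open>\<bar>z\<bar>\<^sup>2 = tail \<theta> u\<close>.\<close>

definition tail :: "real \<Rightarrow> (real \<Rightarrow> complex) \<Rightarrow> real" where
  "tail \<theta> u = (cmod (hinner lborel u (expb (- \<theta>))))\<^sup>2"

text \<open>With r = exp (- \<theta> * (b - a)) and with A, B the inner products with the growing
  and the decaying exponential, the numerator is r^2 |A|^2 + 2 r^2 Re (A cnj B) + |B|^2. Writing it
  as two nonnegative terms makes the bound by \<open>tail\<close> immediate.\<close>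

definition neumann_gap :: "real \<Rightarrow> (real \<Rightarrow> complex) \<Rightarrow> real" where
  "neumann_gap \<theta> u =
     ((exp (- \<theta> * (b - a)))\<^sup>2 * (cmod (hinner lborel u (expb \<theta>) + hinner lborel u (expb (- \<theta>))))\<^sup>2 +
      (1 - (exp (- \<theta> * (b - a)))\<^sup>2) * tail \<theta> u) / (2 * \<theta> * (1 - (exp (- \<theta> * (b - a)))\<^sup>2))"

lemma tail_nonneg [simp]: "0 \<le> tail \<theta> u"
  by (simp add: tail_def)

lemma neumann_gap_ge_tail:
  assumes th: "\<theta> > 0"
  shows "tail \<theta> u / (2 * \<theta>) \<le> neumann_gap \<theta> u"
proof -
  have r: "1 - (exp (- \<theta> * (b - a)))\<^sup>2 > 0" using exp_neg_length[OF th] by simp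
  have "tail \<theta> u / (2 * \<theta>) = (1 - (exp (- \<theta> * (b - a)))\<^sup>2) * tail \<theta> u / (2 * \<theta> * (1 - (exp (- \<theta> * (b - a)))\<^sup>2))"
    using r th by (simp add: divide_simps)
  also have "\<dots> \<le> neumann_gap \<theta> u"
    unfolding neumann_gap_def using r th by (intro divide_right_mono) auto
  finally show ?thesis .
qed

text \<open>In the proof, \<open>g\<close> is the resolvent of the Neumann Laplacian on the interval applied to \<open>u\<close>. Its Green function
  exceeds the kernel of the resolvent on the line by a kernel of rank two, whose form is \<open>neumann_gap\<close>.\<close>

lemma neumann_bracket:
  assumes u: "u \<in> L2_on {a<..<b}" and th: "\<theta> > 0"
  shows "(\<lambda>k. (cmod (coef u k))\<^sup>2 / (\<theta>\<^sup>2 + (freq k)\<^sup>2)) sums (resolvent_form \<theta> u + neumann_gap \<theta> u)"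
proof -
  note su = L2_on_square_integrable[OF u]
  define r where "r = exp (- \<theta> * (b - a))"
  define d where "d = 2 * \<theta> * (1 - r\<^sup>2)"
  have d: "d > 0" using exp_neg_length[OF th] th by (simp add: d_def r_def)
  define A where "A = hinner lborel u (expb \<theta>)"
  define B where "B = hinner lborel u (expb (- \<theta>))"
  \<comment> \<open>These amplitudes are dictated by \<open>cosb_coefficients\<close>: the added
    exponentials cancel the correction in every cosine coefficient simultaneously, because its
    matrix does not depend on k.\<close>
  define \<alpha> where "\<alpha> = complex_of_real (r\<^sup>2 / d) * (A + B)"
  define \<beta> where "\<beta> = complex_of_real (r\<^sup>2 / d) * A + complex_of_real (1 / d) * B"
  define g where "g y = cresolvent \<theta> u y + (\<alpha> * expb \<theta> y + \<beta> * expb (- \<theta>) y)" for y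
  have cu: "cresolvent \<theta> u \<in> L2_on {a<..<b}" by (rule cresolvent_in_L2_on[OF u th])
  have eL2: "(\<lambda>y. \<alpha> * expb \<theta> y + \<beta> * expb (- \<theta>) y) \<in> L2_on {a<..<b}"
    by (intro L2_on_add L2_on_scale) simp_all
  have gL2: "g \<in> L2_on {a<..<b}"
    unfolding g_def[abs_def] by (rule L2_on_add[OF cu eL2])
  note scu = L2_on_square_integrable[OF cu] and seL2 = L2_on_square_integrable[OF eL2]
  have coef_g: "coef g k = complex_of_real (1 / (\<theta>\<^sup>2 + (freq k)\<^sup>2)) * coef u k" for k
  proof -
    define Ak where "Ak = \<theta> * cosb_norm k * ((-1)^k / exp (- \<theta> * (b - a)) - 1) / (\<theta>\<^sup>2 + (freq k)\<^sup>2)"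
    define Bk where "Bk = \<theta> * cosb_norm k * (1 - (-1)^k * exp (- \<theta> * (b - a))) / (\<theta>\<^sup>2 + (freq k)\<^sup>2)"
    note C = cosb_coefficients[OF th, of k, folded Ak_def Bk_def r_def, folded d_def]
    have hA: "hinner lborel (expb \<theta>) (cosb k) = complex_of_real Ak"
      by (metis C(1) complex_cnj_complex_of_real hinner_cnj)
    have hB: "hinner lborel (expb (- \<theta>)) (cosb k) = complex_of_real Bk"
      by (metis C(2) complex_cnj_complex_of_real hinner_cnj)
    have "hinner lborel (cresolvent \<theta> u) (cosb k) = hinner lborel u (cresolvent \<theta> (cosb k))"
      by (rule hinner_cresolvent_sym[OF u _ th]) simp
    also have "\<dots> = complex_of_real (1 / (\<theta>\<^sup>2 + (freq k)\<^sup>2)) * coef u k +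
       (complex_of_real (- (r\<^sup>2 * (Ak + Bk)) / d) * A + complex_of_real (- (r\<^sup>2 * Ak + Bk) / d) * B)"
      unfolding C(3) A_def B_def
      by (simp only: hinner_add_right hinner_scale_right su square_integrable_add square_integrable_scale
          square_integrable_cosb square_integrable_expb complex_cnj_complex_of_real)
    finally have 1: "hinner lborel (cresolvent \<theta> u) (cosb k) = complex_of_real (1 / (\<theta>\<^sup>2 + (freq k)\<^sup>2)) * coef u k +
       (complex_of_real (- (r\<^sup>2 * (Ak + Bk)) / d) * A + complex_of_real (- (r\<^sup>2 * Ak + Bk) / d) * B)" .
    have "coef g k = hinner lborel (cresolvent \<theta> u) (cosb k) + (\<alpha> * complex_of_real Ak + \<beta> * complex_of_real Bk)"
      unfolding g_def[abs_def]
      by (simp only: hinner_add_left[OF scu seL2 square_integrable_cosb] hinner_add_left hinner_scale_left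
          square_integrable_scale square_integrable_cosb square_integrable_expb hA hB)
    also have "\<dots> = complex_of_real (1 / (\<theta>\<^sup>2 + (freq k)\<^sup>2)) * coef u k"
    proof -
      have "complex_of_real (- (r\<^sup>2 * (Ak + Bk)) / d) * A + complex_of_real (- (r\<^sup>2 * Ak + Bk) / d) * B +
          (\<alpha> * complex_of_real Ak + \<beta> * complex_of_real Bk) = 0"
        unfolding \<alpha>_def \<beta>_def using d by (simp add: field_simps)
      then show ?thesis unfolding 1 by (simp only: add.assoc add_0_right)
    qed
    finally show ?thesis .
  qed
  have "(\<lambda>k. coef u k * cnj (coef g k)) sums hinner lborel u g"
    by (rule cosb_parseval_hinner[OF u gL2])
  then have "(\<lambda>k. Re (coef u k * cnj (coef g k))) sums Re (hinner lborel u g)"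
    by (rule sums_Re)
  moreover have "Re (coef u k * cnj (coef g k)) = (cmod (coef u k))\<^sup>2 / (\<theta>\<^sup>2 + (freq k)\<^sup>2)" for k
  proof -
    have "coef u k * cnj (coef g k) = complex_of_real (1 / (\<theta>\<^sup>2 + (freq k)\<^sup>2)) * (coef u k * cnj (coef u k))"
      unfolding coef_g by (simp only: complex_cnj_mult complex_cnj_complex_of_real mult_ac)
    then show ?thesis
      by (simp only: complex_norm_square[symmetric] of_real_mult[symmetric] Re_complex_of_real) simp
  qed
  moreover have "Re (hinner lborel u g) = resolvent_form \<theta> u + neumann_gap \<theta> u"
  proof -
    have sq: "complex_of_real ((cmod z)\<^sup>2) = z * cnj z" for z by (rule complex_norm_square)
    have "hinner lborel u g = hinner lborel u (cresolvent \<theta> u) + (cnj \<alpha> * A + cnj \<beta> * B)"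
      unfolding g_def[abs_def] A_def B_def
      by (simp only: hinner_add_right[OF scu seL2 su] hinner_add_right hinner_scale_right
          square_integrable_scale square_integrable_expb su)
    \<comment> \<open>Pairing the added exponentials with u produces the quadratic form in A and B
      that defines the gap.\<close>
    moreover have "cnj \<alpha> * A + cnj \<beta> * B = complex_of_real ((r\<^sup>2 * (cmod (A + B))\<^sup>2 + (1 - r\<^sup>2) * (cmod B)\<^sup>2) / d)"
    proof -
      have "complex_of_real ((r\<^sup>2 * (cmod (A + B))\<^sup>2 + (1 - r\<^sup>2) * (cmod B)\<^sup>2) / d) =
          (complex_of_real (r\<^sup>2) * complex_of_real ((cmod (A + B))\<^sup>2) +
           (1 - complex_of_real (r\<^sup>2)) * complex_of_real ((cmod B)\<^sup>2)) / complex_of_real d"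
        by simp
      also have "\<dots> = cnj \<alpha> * A + cnj \<beta> * B"
        unfolding sq \<alpha>_def \<beta>_def using d by (simp add: field_simps)
      finally show ?thesis by (rule sym)
    qed
    ultimately show ?thesis
      by (simp add: resolvent_form_def neumann_gap_def tail_def A_def B_def r_def d_def)
  qed
  ultimately show ?thesis by simp
qed

text \<open>On a finite sine sum the resolvent form equals the diagonal sum plus (r^2 |A - B|^2 + (1
  - r^2) |B|^2) / d, with d = 2 \<theta> (1 - r^2). The correction now enters with the opposite sign
  because the Dirichlet Green function lies below the kernel on the line. Discarding the first
  square leaves exactly the tail term.\<close>

lemma dirichlet_bracket:
  assumes I: "finite I" "\<And>k. k \<in> I \<Longrightarrow> k \<ge> 1" and th: "\<theta> > 0"
    and u_def: "u = (\<lambda>x. \<Sum>k\<in>I. c k * sinb k x)"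
  shows "(\<Sum>k\<in>I. (cmod (c k))\<^sup>2 / (\<theta>\<^sup>2 + (freq k)\<^sup>2)) + tail \<theta> u / (2 * \<theta>) \<le> resolvent_form \<theta> u"
proof -
  define r where "r = exp (- \<theta> * (b - a))"
  define d where "d = 2 * \<theta> * (1 - r\<^sup>2)"
  have r: "1 - r\<^sup>2 > 0" using exp_neg_length[OF th] by (simp add: r_def)
  have d: "d > 0" using r th by (simp add: d_def)
  have u: "u \<in> L2_on {a<..<b}"
    unfolding u_def by (intro L2_on_sum L2_on_scale) simp
  note su = L2_on_square_integrable[OF u]
  define Ak where "Ak k = freq k * sqrt (2 / (b - a)) * (1 - (-1)^k / exp (- \<theta> * (b - a))) / (\<theta>\<^sup>2 + (freq k)\<^sup>2)" for k
  define Bk where "Bk k = freq k * sqrt (2 / (b - a)) * (1 - (-1)^k * exp (- \<theta> * (b - a))) / (\<theta>\<^sup>2 + (freq k)\<^sup>2)" for k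
  note C = sinb_coefficients[OF th, folded Ak_def Bk_def r_def, folded d_def]
  define A where "A = hinner lborel u (expb \<theta>)"
  define B where "B = hinner lborel u (expb (- \<theta>))"
  have A: "A = (\<Sum>k\<in>I. c k * complex_of_real (Ak k))"
    unfolding A_def u_def by (simp only: hinner_sum_left square_integrable_sinb square_integrable_expb C(1))
  have B: "B = (\<Sum>k\<in>I. c k * complex_of_real (Bk k))"
    unfolding B_def u_def by (simp only: hinner_sum_left square_integrable_sinb square_integrable_expb C(2))
  have uS: "hinner lborel u (sinb k) = c k" if "k \<in> I" for k
  proof -
    have "hinner lborel u (sinb k) = (\<Sum>j\<in>I. c j * hinner lborel (sinb j) (sinb k))"
      unfolding u_def by (simp only: hinner_sum_left square_integrable_sinb)
    also have "\<dots> = (\<Sum>j\<in>I. if j = k then c j else 0)"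
      by (intro sum.cong refl) (subst hinner_sinb[OF I(2) I(2)], use that in auto)
    finally show ?thesis using I(1) that by simp
  qed
  have sc: "square_integrable lborel (cresolvent \<theta> u)" by (rule L2_on_square_integrable[OF cresolvent_in_L2_on[OF u th]])
  have uTS: "hinner lborel u (cresolvent \<theta> (sinb k)) = complex_of_real (1 / (\<theta>\<^sup>2 + (freq k)\<^sup>2)) * c k +
      (complex_of_real (r\<^sup>2 * (Ak k - Bk k) / d) * A + complex_of_real ((Bk k - r\<^sup>2 * Ak k) / d) * B)"
    if k: "k \<in> I" for k
    unfolding C(3) A_def B_def uS[OF k, symmetric]
    by (simp only: hinner_add_right hinner_scale_right su square_integrable_add square_integrable_scale
        square_integrable_sinb square_integrable_expb complex_cnj_complex_of_real)
  have "hinner lborel u (cresolvent \<theta> u) = hinner lborel (cresolvent \<theta> u) u"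
    by (rule hinner_cresolvent_sym[OF u u th, symmetric])
  also have "\<dots> = (\<Sum>k\<in>I. cnj (c k) * hinner lborel (cresolvent \<theta> u) (sinb k))"
    by (subst (2) u_def) (simp only: hinner_sum_right square_integrable_sinb sc)
  also have "\<dots> = (\<Sum>k\<in>I. cnj (c k) * hinner lborel u (cresolvent \<theta> (sinb k)))"
    by (simp only: hinner_cresolvent_sym[OF u sinb_in_L2_on th])
  also have "\<dots> = (\<Sum>k\<in>I. cnj (c k) * (complex_of_real (1 / (\<theta>\<^sup>2 + (freq k)\<^sup>2)) * c k +
      (complex_of_real (r\<^sup>2 * (Ak k - Bk k) / d) * A + complex_of_real ((Bk k - r\<^sup>2 * Ak k) / d) * B)))"
    by (intro sum.cong refl) (simp only: uTS)
  also have "\<dots> = (\<Sum>k\<in>I. complex_of_real ((cmod (c k))\<^sup>2 / (\<theta>\<^sup>2 + (freq k)\<^sup>2)) +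
      (complex_of_real (r\<^sup>2 / d) * A * (cnj (c k) * complex_of_real (Ak k) - cnj (c k) * complex_of_real (Bk k)) +
       B * (complex_of_real (1 / d) * (cnj (c k) * complex_of_real (Bk k)) - complex_of_real (r\<^sup>2 / d) * (cnj (c k) * complex_of_real (Ak k)))))"
  proof (intro sum.cong refl)
    fix k
    have "complex_of_real ((cmod (c k))\<^sup>2 / (\<theta>\<^sup>2 + (freq k)\<^sup>2)) = complex_of_real (1 / (\<theta>\<^sup>2 + (freq k)\<^sup>2)) * (c k * cnj (c k))"
      unfolding complex_norm_square[symmetric] of_real_mult[symmetric] by simp
    then show "cnj (c k) * (complex_of_real (1 / (\<theta>\<^sup>2 + (freq k)\<^sup>2)) * c k +
      (complex_of_real (r\<^sup>2 * (Ak k - Bk k) / d) * A + complex_of_real ((Bk k - r\<^sup>2 * Ak k) / d) * B)) =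
      complex_of_real ((cmod (c k))\<^sup>2 / (\<theta>\<^sup>2 + (freq k)\<^sup>2)) +
      (complex_of_real (r\<^sup>2 / d) * A * (cnj (c k) * complex_of_real (Ak k) - cnj (c k) * complex_of_real (Bk k)) +
       B * (complex_of_real (1 / d) * (cnj (c k) * complex_of_real (Bk k)) - complex_of_real (r\<^sup>2 / d) * (cnj (c k) * complex_of_real (Ak k))))"
      using d by (simp only:) (simp add: field_simps)
  qed
  also have "\<dots> = (\<Sum>k\<in>I. complex_of_real ((cmod (c k))\<^sup>2 / (\<theta>\<^sup>2 + (freq k)\<^sup>2))) +
      (complex_of_real (r\<^sup>2 / d) * A * (cnj A - cnj B) + B * (complex_of_real (1 / d) * cnj B - complex_of_real (r\<^sup>2 / d) * cnj A))"
    unfolding A B by (simp only: sum.distrib sum_subtractf sum_distrib_left[symmetric] cnj_sum complex_cnj_mult complex_cnj_complex_of_real)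
  also have "complex_of_real (r\<^sup>2 / d) * A * (cnj A - cnj B) + B * (complex_of_real (1 / d) * cnj B - complex_of_real (r\<^sup>2 / d) * cnj A) =
      complex_of_real ((r\<^sup>2 * (cmod (A - B))\<^sup>2 + (1 - r\<^sup>2) * (cmod B)\<^sup>2) / d)"
  proof -
    have "complex_of_real ((r\<^sup>2 * (cmod (A - B))\<^sup>2 + (1 - r\<^sup>2) * (cmod B)\<^sup>2) / d) =
        (complex_of_real (r\<^sup>2) * complex_of_real ((cmod (A - B))\<^sup>2) +
         (1 - complex_of_real (r\<^sup>2)) * complex_of_real ((cmod B)\<^sup>2)) / complex_of_real d"
      by simp
    also have "\<dots> = complex_of_real (r\<^sup>2 / d) * A * (cnj A - cnj B) + B * (complex_of_real (1 / d) * cnj B - complex_of_real (r\<^sup>2 / d) * cnj A)"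
      unfolding complex_norm_square using d by (simp add: field_simps)
    finally show ?thesis by (rule sym)
  qed
  finally have "resolvent_form \<theta> u = (\<Sum>k\<in>I. (cmod (c k))\<^sup>2 / (\<theta>\<^sup>2 + (freq k)\<^sup>2)) +
      (r\<^sup>2 * (cmod (A - B))\<^sup>2 + (1 - r\<^sup>2) * (cmod B)\<^sup>2) / d"
    unfolding resolvent_form_def by (simp only: plus_complex.simps Re_sum Re_complex_of_real)
  moreover have "tail \<theta> u / (2 * \<theta>) = (1 - r\<^sup>2) * (cmod B)\<^sup>2 / d"
    using r th by (simp add: tail_def B_def d_def)
  moreover have "(1 - r\<^sup>2) * (cmod B)\<^sup>2 / d \<le> (r\<^sup>2 * (cmod (A - B))\<^sup>2 + (1 - r\<^sup>2) * (cmod B)\<^sup>2) / d"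
    using d by (intro divide_right_mono) auto
  ultimately show ?thesis by linarith
qed

text \<open>The inner product is explicit, and its factor 1 - (-1)^k exp (- \<theta> (b - a)) is
  positive because the exponential is less than 1.\<close>

lemma tail_cosb_pos:
  assumes th: "\<theta> > 0"
  shows "tail \<theta> (cosb k) > 0"
proof -
  have "(-1)^k * exp (- \<theta> * (b - a)) < (1::real)"
    using exp_neg_length[OF th] by (cases "even k") (auto intro: less_trans[of "- 1" 0])
  then have "\<theta> * cosb_norm k * (1 - (-1)^k * exp (- \<theta> * (b - a))) / (\<theta>\<^sup>2 + (freq k)\<^sup>2) > 0"
    using th cosb_norm_pos[of k] resolvent_denominator_pos[OF th, of k] by (intro divide_pos_pos mult_pos_pos) auto
  then show ?thesis unfolding tail_def cosb_coefficients(2)[OF th] norm_of_real by (simp only: abs_of_pos zero_less_power)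
qed

lemma tail_sinb_pos:
  assumes th: "\<theta> > 0" and k: "k \<ge> 1"
  shows "tail \<theta> (sinb k) > 0"
proof -
  have "(-1)^k * exp (- \<theta> * (b - a)) < (1::real)"
    using exp_neg_length[OF th] by (cases "even k") (auto intro: less_trans[of "- 1" 0])
  moreover have "freq k > 0" using k a_less_b by (simp add: freq_def)
  ultimately have "freq k * sqrt (2 / (b - a)) * (1 - (-1)^k * exp (- \<theta> * (b - a))) / (\<theta>\<^sup>2 + (freq k)\<^sup>2) > 0"
    using a_less_b resolvent_denominator_pos[OF th, of k] by (intro divide_pos_pos mult_pos_pos) auto
  then show ?thesis unfolding tail_def sinb_coefficients(2)[OF th] norm_of_real by (simp only: abs_of_pos zero_less_power)
qed

lemma resolvent_form_fourier:
  assumes u: "u \<in> L2_on {a<..<b}" and th: "\<theta> > 0"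
  shows "(\<integral>\<xi>. (cmod (fourier u \<xi>))\<^sup>2 / (\<xi>\<^sup>2 + \<theta>\<^sup>2) \<partial>lborel) = 2 * pi * resolvent_form \<theta> u"
proof -
  have "complex_of_real (\<integral>\<xi>. (cmod (fourier u \<xi>))\<^sup>2 / (\<xi>\<^sup>2 + \<theta>\<^sup>2) \<partial>lborel) =
      complex_of_real (2 * pi) * hinner lborel u (cresolvent \<theta> u)"
    by (simp only: integral_fourier_lorentz[OF L2_on_integrable[OF u] th] hinner_resolvent_eq[OF u u th])
  from arg_cong[OF this, of Re] show ?thesis by (simp add: resolvent_form_def)
qed

section \<open>Large parameters and Plancherel's theorem\<close>

lemma sqnorm_expb_half:
  assumes th: "\<theta> > 0"
  shows "sqnorm lborel (expb (- \<theta> / 2)) \<le> 1 / \<theta>"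
    and "exp (- \<theta> * (b - a)) * sqnorm lborel (expb (\<theta> / 2)) \<le> 1 / \<theta>"
proof -
  have sq: "sqnorm lborel (expb (c / 2)) = (exp (c * (b - a)) - 1) / c" if c: "c \<noteq> 0" for c
  proof -
    have "sqnorm lborel (expb (c / 2)) = (\<integral>x. exp (c * (x - a)) * indicator {a..b} x \<partial>lborel)"
      unfolding sqnorm_def expb_def
      by (rule Bochner_Integration.integral_cong)
        (auto simp: indicator_def power2_eq_square mult_exp_exp field_simps)
    also have "\<dots> = exp (c * (b - a)) / c - exp (c * (a - a)) / c"
    proof (rule has_bochner_integral_integral_eq[OF has_bochner_integral_FTC_Icc_real])
      show "((\<lambda>x. exp (c * (x - a)) / c) has_real_derivative exp (c * (x - a))) (at x)" for x
        using c by (auto intro!: derivative_eq_intros)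
    qed (use a_less_b in \<open>auto intro!: continuous_intros\<close>)
    finally show ?thesis by (simp add: diff_divide_distrib)
  qed
  have "sqnorm lborel (expb (- \<theta> / 2)) = (1 - exp (- \<theta> * (b - a))) / \<theta>"
    using th by (subst sq) (auto simp: field_simps)
  also have "\<dots> \<le> 1 / \<theta>" using th by (intro divide_right_mono) auto
  finally show "sqnorm lborel (expb (- \<theta> / 2)) \<le> 1 / \<theta>" .
  \<comment> \<open>The prefactor anchors the growing exponential at b, so this is the mirror image
    of the first bound.\<close>
  have "exp (- \<theta> * (b - a)) * sqnorm lborel (expb (\<theta> / 2)) = (1 - exp (- \<theta> * (b - a))) / \<theta>"
    using th by (subst sq) (auto simp: mult_exp_exp right_diff_distrib)
  also have "\<dots> \<le> 1 / \<theta>" using th by (intro divide_right_mono) auto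
  finally show "exp (- \<theta> * (b - a)) * sqnorm lborel (expb (\<theta> / 2)) \<le> 1 / \<theta>" .
qed

lemma square_integrable_mult_expb:
  assumes u: "u \<in> L2_on {a<..<b}"
  shows "square_integrable lborel (\<lambda>x. u x * expb c x)"
  unfolding square_integrable_def
proof
  have [measurable]: "u \<in> borel_measurable borel" by (rule L2_on_measurable[OF u])
  show "(\<lambda>x. u x * expb c x) \<in> borel_measurable lborel" by measurable
  show "integrable lborel (\<lambda>x. (cmod (u x * expb c x))\<^sup>2)"
  proof (rule Bochner_Integration.integrable_bound)
    show "integrable lborel (\<lambda>x. (exp (\<bar>c\<bar> * (b - a)))\<^sup>2 * (cmod (u x))\<^sup>2)"
      by (intro integrable_mult_right square_integrableD L2_on_square_integrable[OF u])
    have "cmod (expb c x) \<le> exp (\<bar>c\<bar> * (b - a))" for x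
    proof (cases "x \<in> {a..b}")
      case True
      then have "c * (x - a) \<le> \<bar>c\<bar> * (b - a)" by (intro mult_mono) auto
      then show ?thesis using True by (simp add: expb_def)
    qed (simp add: expb_def)
    then have "(cmod (expb c x))\<^sup>2 * (cmod (u x))\<^sup>2 \<le> (exp (\<bar>c\<bar> * (b - a)))\<^sup>2 * (cmod (u x))\<^sup>2" for x
      by (intro mult_right_mono power_mono) auto
    then show "AE x in lborel. norm ((cmod (u x * expb c x))\<^sup>2) \<le> norm ((exp (\<bar>c\<bar> * (b - a)))\<^sup>2 * (cmod (u x))\<^sup>2)"
      by (intro AE_I2) (simp add: norm_mult power_mult_distrib mult.commute)
  qed measurable
qed

text \<open>The exponential is shared evenly between the two factors of Cauchy-Schwarz: one half
  localises u near an endpoint, the other has squared norm of order 1 / \<theta>. Without the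
  localisation the product with \<theta> would only be bounded instead of tending to 0.\<close>

lemma hinner_expb_bound:
  assumes u: "u \<in> L2_on {a<..<b}"
  shows "(cmod (hinner lborel u (expb c)))\<^sup>2 \<le> sqnorm lborel (\<lambda>x. u x * expb (c / 2) x) * sqnorm lborel (expb (c / 2))"
proof -
  have "hinner lborel u (expb c) = hinner lborel (\<lambda>x. u x * expb (c / 2) x) (expb (c / 2))"
    unfolding hinner_def
    by (rule Bochner_Integration.integral_cong)
      (auto simp: expb_def indicator_def mult_exp_exp of_real_mult[symmetric] simp del: of_real_mult)
  then show ?thesis
    using hinner_Cauchy_Schwarz[OF square_integrable_mult_expb[OF u] square_integrable_expb] by simp
qed

text \<open>The gap sees only boundary layers of width about 1 / \<theta> at the two ends, and a
  square-integrable function has vanishing mass there.\<close>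

lemma neumann_gap_tendsto_0:
  assumes u: "u \<in> L2_on {a<..<b}"
  shows "(\<lambda>n. (real (Suc n))\<^sup>2 * neumann_gap (real (Suc n)) u) \<longlonglongrightarrow> 0"
proof -
  have [measurable]: "u \<in> borel_measurable borel" by (rule L2_on_measurable[OF u])
  note su = square_integrableD[OF L2_on_square_integrable[OF u]]
  have AEx: "AE x in lborel. a < x \<and> x < b \<or> u x = 0" using u by (auto simp: L2_on_def elim: eventually_mono)
  define r where "r n = exp (- real (Suc n) * (b - a))" for n
  have exp0: "(\<lambda>n. exp (- (real (Suc n) * t))) \<longlonglongrightarrow> 0" if "t > 0" for t
    using that by real_asymp
  have r0: "r \<longlonglongrightarrow> 0" unfolding r_def mult_minus_left by (rule exp0) (use a_less_b in simp)
  have 1: "(\<lambda>n. sqnorm lborel (\<lambda>x. u x * expb (- real (Suc n) / 2) x)) \<longlonglongrightarrow> 0"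
  proof -
    have "(\<lambda>n. sqnorm lborel (\<lambda>x. u x * expb (- real (Suc n) / 2) x)) \<longlonglongrightarrow> (\<integral>x. 0 \<partial>(lborel :: real measure))"
      unfolding sqnorm_def
    proof (rule integral_dominated_convergence[OF _ _ su])
      have eq: "(cmod (u x * expb (- real (Suc n) / 2) x))\<^sup>2 = (cmod (u x))\<^sup>2 * (exp (- (real (Suc n) * (x - a))) * indicator {a..b} x)" for n x
      proof -
        have "(exp (- real (Suc n) / 2 * (x - a)))\<^sup>2 = exp (- (real (Suc n) * (x - a)))"
          by (subst exp_double[symmetric]) (simp add: field_simps)
        then show ?thesis
          by (simp add: expb_def norm_mult power_mult_distrib indicator_def)
      qed
      show "AE x in lborel. (\<lambda>n. (cmod (u x * expb (- real (Suc n) / 2) x))\<^sup>2) \<longlonglongrightarrow> 0"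
        using AEx
      proof eventually_elim
        case (elim x)
        then show ?case
        proof
          assume "a < x \<and> x < b"
          then have "(\<lambda>n. (cmod (u x))\<^sup>2 * (exp (- (real (Suc n) * (x - a))) * indicator {a..b} x)) \<longlonglongrightarrow> (cmod (u x))\<^sup>2 * (0 * indicator {a..b} x)"
            by (intro tendsto_intros exp0) simp
          then show ?thesis unfolding eq by simp
        qed simp
      qed
      show "AE x in lborel. norm ((cmod (u x * expb (- real (Suc n) / 2) x))\<^sup>2) \<le> (cmod (u x))\<^sup>2" for n
      proof (rule AE_I2)
        fix x
        have "exp (- (real (Suc n) * (x - a))) * indicator {a..b} x \<le> 1"
          by (auto simp: indicator_def)
        then show "norm ((cmod (u x * expb (- real (Suc n) / 2) x))\<^sup>2) \<le> (cmod (u x))\<^sup>2"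
          unfolding eq by (simp add: mult_left_le)
      qed
    qed measurable
    then show ?thesis by simp
  qed
  have 2: "(\<lambda>n. r n * sqnorm lborel (\<lambda>x. u x * expb (real (Suc n) / 2) x)) \<longlonglongrightarrow> 0"
  proof -
    have "(\<lambda>n. \<integral>x. r n * (cmod (u x * expb (real (Suc n) / 2) x))\<^sup>2 \<partial>lborel) \<longlonglongrightarrow> (\<integral>x. 0 \<partial>(lborel :: real measure))"
    proof (rule integral_dominated_convergence[OF _ _ su])
      have eq: "r n * (cmod (u x * expb (real (Suc n) / 2) x))\<^sup>2 = (cmod (u x))\<^sup>2 * (exp (- (real (Suc n) * (b - x))) * indicator {a..b} x)" for n x
      proof -
        have "r n * (exp (real (Suc n) / 2 * (x - a)))\<^sup>2 = exp (- (real (Suc n) * (b - x)))"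
          by (subst exp_double[symmetric]) (simp add: r_def mult_exp_exp field_simps)
        then show ?thesis
          by (simp add: expb_def norm_mult power_mult_distrib indicator_def mult.left_commute)
      qed
      show "AE x in lborel. (\<lambda>n. r n * (cmod (u x * expb (real (Suc n) / 2) x))\<^sup>2) \<longlonglongrightarrow> 0"
        using AEx
      proof eventually_elim
        case (elim x)
        then show ?case
        proof
          assume "a < x \<and> x < b"
          then have "(\<lambda>n. (cmod (u x))\<^sup>2 * (exp (- (real (Suc n) * (b - x))) * indicator {a..b} x)) \<longlonglongrightarrow> (cmod (u x))\<^sup>2 * (0 * indicator {a..b} x)"
            by (intro tendsto_intros exp0) simp
          then show ?thesis unfolding eq by simp
        qed simp
      qed
      show "AE x in lborel. norm (r n * (cmod (u x * expb (real (Suc n) / 2) x))\<^sup>2) \<le> (cmod (u x))\<^sup>2" for n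
      proof (rule AE_I2)
        fix x
        have "exp (- (real (Suc n) * (b - x))) * indicator {a..b} x \<le> 1"
          by (auto simp: indicator_def)
        then show "norm (r n * (cmod (u x * expb (real (Suc n) / 2) x))\<^sup>2) \<le> (cmod (u x))\<^sup>2"
          unfolding eq by (simp add: mult_left_le)
      qed
    qed measurable
    then show ?thesis by (simp add: sqnorm_def)
  qed
  let ?X = "\<lambda>n. sqnorm lborel (\<lambda>x. u x * expb (- real (Suc n) / 2) x)"
  let ?Y = "\<lambda>n. r n * sqnorm lborel (\<lambda>x. u x * expb (real (Suc n) / 2) x)"
  \<comment> \<open>The factor 2 comes from |A + B|^2 \<le> 2 |A|^2 + 2 |B|^2, and the 3 from adding
    the |B|^2 of the second term of the gap.\<close>
  have bound: "(real (Suc n))\<^sup>2 * neumann_gap (real (Suc n)) u \<le> (2 * ?Y n + 3 * ?X n) / (2 * (1 - (r n)\<^sup>2))" for n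
  proof -
    define \<theta> where "\<theta> = real (Suc n)"
    have th: "\<theta> > 0" by (simp add: \<theta>_def)
    have r: "0 < r n" "(r n)\<^sup>2 < 1" "r n < 1" using exp_neg_length[OF th] by (auto simp: r_def \<theta>_def)
    define A where "A = hinner lborel u (expb \<theta>)"
    define B where "B = hinner lborel u (expb (- \<theta>))"
    have B: "\<theta> * (cmod B)\<^sup>2 \<le> ?X n"
    proof -
      have "(cmod B)\<^sup>2 \<le> ?X n * sqnorm lborel (expb (- \<theta> / 2))"
        using hinner_expb_bound[OF u, of "- \<theta>"] by (simp add: B_def \<theta>_def)
      also have "\<dots> \<le> ?X n * (1 / \<theta>)" by (intro mult_left_mono sqnorm_expb_half th) simp
      finally show ?thesis using th by (simp add: field_simps)
    qed
    have A: "\<theta> * ((r n)\<^sup>2 * (cmod A)\<^sup>2) \<le> ?Y n"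
    proof -
      have "(r n)\<^sup>2 * (cmod A)\<^sup>2 \<le> (r n)\<^sup>2 * (sqnorm lborel (\<lambda>x. u x * expb (\<theta> / 2) x) * sqnorm lborel (expb (\<theta> / 2)))"
        unfolding A_def by (intro mult_left_mono hinner_expb_bound u) simp
      also have "\<dots> = ?Y n * (exp (- \<theta> * (b - a)) * sqnorm lborel (expb (\<theta> / 2)))"
        by (simp add: r_def \<theta>_def power2_eq_square mult_ac)
      also have "\<dots> \<le> ?Y n * (1 / \<theta>)" using r by (intro mult_left_mono sqnorm_expb_half th) simp
      finally show ?thesis using th by (simp add: field_simps)
    qed
    have AB: "(cmod (A + B))\<^sup>2 \<le> 2 * (cmod A)\<^sup>2 + 2 * (cmod B)\<^sup>2"
    proof -
      have "(cmod (A + B))\<^sup>2 \<le> (cmod A + cmod B)\<^sup>2" by (intro power_mono norm_triangle_ineq) simp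
      also have "\<dots> \<le> 2 * (cmod A)\<^sup>2 + 2 * (cmod B)\<^sup>2"
        using sum_squares_bound[of "cmod A" "cmod B"] by (simp add: power2_sum)
      finally show ?thesis .
    qed
    have "\<theta>\<^sup>2 * neumann_gap \<theta> u = \<theta> * ((r n)\<^sup>2 * (cmod (A + B))\<^sup>2 + (1 - (r n)\<^sup>2) * (cmod B)\<^sup>2) / (2 * (1 - (r n)\<^sup>2))"
    proof -
      have rn: "exp (- \<theta> * (b - a)) = r n" by (simp add: r_def \<theta>_def)
      have "\<theta>\<^sup>2 * (N / (2 * \<theta> * d)) = \<theta> * N / (2 * d)" for N d
        using th by (simp add: power2_eq_square)
      then show ?thesis
        unfolding neumann_gap_def tail_def A_def[symmetric] B_def[symmetric] rn .
    qed
    also have "\<dots> \<le> (2 * ?Y n + 3 * ?X n) / (2 * (1 - (r n)\<^sup>2))"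
    proof (intro divide_right_mono)
      have "(r n)\<^sup>2 * (cmod (A + B))\<^sup>2 \<le> (r n)\<^sup>2 * (2 * (cmod A)\<^sup>2 + 2 * (cmod B)\<^sup>2)"
        by (intro mult_left_mono AB) simp
      also have "\<dots> = 2 * ((r n)\<^sup>2 * (cmod A)\<^sup>2) + 2 * ((r n)\<^sup>2 * (cmod B)\<^sup>2)" by (simp add: algebra_simps)
      also have "(r n)\<^sup>2 * (cmod B)\<^sup>2 \<le> (cmod B)\<^sup>2" using r by (intro mult_left_le_one_le) auto
      finally have "(r n)\<^sup>2 * (cmod (A + B))\<^sup>2 \<le> 2 * ((r n)\<^sup>2 * (cmod A)\<^sup>2) + 2 * (cmod B)\<^sup>2" by simp
      moreover have "(1 - (r n)\<^sup>2) * (cmod B)\<^sup>2 \<le> (cmod B)\<^sup>2" using r by (intro mult_left_le_one_le) auto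
      ultimately have "(r n)\<^sup>2 * (cmod (A + B))\<^sup>2 + (1 - (r n)\<^sup>2) * (cmod B)\<^sup>2 \<le> 2 * ((r n)\<^sup>2 * (cmod A)\<^sup>2) + 3 * (cmod B)\<^sup>2"
        by linarith
      then have "\<theta> * ((r n)\<^sup>2 * (cmod (A + B))\<^sup>2 + (1 - (r n)\<^sup>2) * (cmod B)\<^sup>2) \<le> \<theta> * (2 * ((r n)\<^sup>2 * (cmod A)\<^sup>2) + 3 * (cmod B)\<^sup>2)"
        using th by (intro mult_left_mono) auto
      also have "\<dots> = 2 * (\<theta> * ((r n)\<^sup>2 * (cmod A)\<^sup>2)) + 3 * (\<theta> * (cmod B)\<^sup>2)" by (simp add: algebra_simps)
      also have "\<dots> \<le> 2 * ?Y n + 3 * ?X n" using A B by linarith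
      finally show "\<theta> * ((r n)\<^sup>2 * (cmod (A + B))\<^sup>2 + (1 - (r n)\<^sup>2) * (cmod B)\<^sup>2) \<le> 2 * ?Y n + 3 * ?X n" .
      show "0 \<le> 2 * (1 - (r n)\<^sup>2)" using r by simp
    qed
    finally show ?thesis by (simp add: \<theta>_def)
  qed
  have lim: "(\<lambda>n. (2 * ?Y n + 3 * ?X n) / (2 * (1 - (r n)\<^sup>2))) \<longlonglongrightarrow> (2 * 0 + 3 * 0) / (2 * (1 - 0\<^sup>2))"
    by (intro tendsto_intros 1 2 r0) simp
  show ?thesis
  proof (rule tendsto_sandwich[OF _ _ tendsto_const])
    show "(\<lambda>n. (2 * ?Y n + 3 * ?X n) / (2 * (1 - (r n)\<^sup>2))) \<longlonglongrightarrow> 0" using lim by simp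
    show "\<forall>\<^sub>F n in sequentially. 0 \<le> (real (Suc n))\<^sup>2 * neumann_gap (real (Suc n)) u"
    proof (intro always_eventually allI mult_nonneg_nonneg)
      fix n
      have "0 \<le> tail (real (Suc n)) u / (2 * real (Suc n))" by simp
      also have "\<dots> \<le> neumann_gap (real (Suc n)) u" by (rule neumann_gap_ge_tail) simp
      finally show "0 \<le> neumann_gap (real (Suc n)) u" .
    qed simp
  qed (use bound in \<open>auto intro!: always_eventually\<close>)
qed

text \<open>Obtained from the Neumann bracket and Parseval for cosines rather than from the Fourier
  side, hence available for the proof of Plancherel's theorem.\<close>

lemma resolvent_form_le:
  assumes u: "u \<in> L2_on {a<..<b}" and th: "\<theta> > 0"
  shows "\<theta>\<^sup>2 * resolvent_form \<theta> u \<le> sqnorm lborel u"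
proof -
  have "resolvent_form \<theta> u + neumann_gap \<theta> u \<le> sqnorm lborel u / \<theta>\<^sup>2"
  proof (rule sums_le[OF _ neumann_bracket[OF u th] sums_divide[OF cosb_parseval[OF u]]])
    show "(cmod (coef u k))\<^sup>2 / (\<theta>\<^sup>2 + (freq k)\<^sup>2) \<le> (cmod (coef u k))\<^sup>2 / \<theta>\<^sup>2" for k
      using th resolvent_denominator_pos[OF th, of k] by (intro divide_left_mono mult_pos_pos) auto
  qed
  moreover have "0 \<le> neumann_gap \<theta> u"
    using neumann_gap_ge_tail[OF th, of u] th by (intro order_trans[OF _ neumann_gap_ge_tail[OF th]]) simp
  ultimately have "resolvent_form \<theta> u \<le> sqnorm lborel u / \<theta>\<^sup>2" by linarith
  then show ?thesis using th by (simp add: pos_le_divide_eq mult.commute)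
qed

lemma lorentz_weight_tendsto: "(\<lambda>n. (real (Suc n))\<^sup>2 / (x\<^sup>2 + (real (Suc n))\<^sup>2)) \<longlonglongrightarrow> 1"
  by real_asymp

text \<open>As \<open>\<theta> \<rightarrow> \<infinity>\<close>, the weight \<open>\<theta>\<^sup>2 / (\<xi>\<^sup>2 + \<theta>\<^sup>2)\<close> tends to 1, while the Neumann bracket evaluates the weighted
  integral in terms of cosine coefficients.\<close>

lemma plancherel:
  assumes u: "u \<in> L2_on {a<..<b}"
  shows "square_integrable lborel (fourier u)" and "sqnorm lborel (fourier u) = 2 * pi * sqnorm lborel u"
proof -
  have [measurable]: "u \<in> borel_measurable borel" by (rule L2_on_measurable[OF u])
  let ?w = "\<lambda>n x. (real (Suc n))\<^sup>2 / (x\<^sup>2 + (real (Suc n))\<^sup>2)"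
  let ?F = "\<lambda>x. (cmod (fourier u x))\<^sup>2"
  have int: "integrable lborel (\<lambda>x. ?w n x * ?F x)" for n
    using integrable_mult_right[OF integrable_fourier_lorentz[OF L2_on_integrable[OF u], of "real (Suc n)"], of "(real (Suc n))\<^sup>2"]
    by simp
  have val: "(\<integral>x. ?w n x * ?F x \<partial>lborel) = 2 * pi * ((real (Suc n))\<^sup>2 * resolvent_form (real (Suc n)) u)" for n
  proof -
    have "(\<integral>x. ?w n x * ?F x \<partial>lborel) = (real (Suc n))\<^sup>2 * (\<integral>x. ?F x / (x\<^sup>2 + (real (Suc n))\<^sup>2) \<partial>lborel)"
      by (subst integral_mult_right_zero[symmetric]) simp
    also have "\<dots> = (real (Suc n))\<^sup>2 * (2 * pi * resolvent_form (real (Suc n)) u)"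
      by (subst resolvent_form_fourier[OF u]) auto
    finally show ?thesis by (simp only: mult_ac)
  qed
  \<comment> \<open>Fatou's lemma first yields integrability; only then can the limit function serve
    as the dominating function for the exact limit.\<close>
  have "(\<integral>\<^sup>+x. ennreal (?F x) \<partial>lborel) = (\<integral>\<^sup>+x. liminf (\<lambda>n. ennreal (?w n x * ?F x)) \<partial>lborel)"
  proof (rule nn_integral_cong)
    fix x
    have "(\<lambda>n. ennreal (?w n x * ?F x)) \<longlonglongrightarrow> ennreal (1 * ?F x)"
      by (intro tendsto_ennrealI tendsto_mult lorentz_weight_tendsto tendsto_const)
    then show "ennreal (?F x) = liminf (\<lambda>n. ennreal (?w n x * ?F x))"
      using lim_imp_Liminf[OF trivial_limit_sequentially] by fastforce
  qed
  also have "\<dots> \<le> liminf (\<lambda>n. \<integral>\<^sup>+x. ennreal (?w n x * ?F x) \<partial>lborel)"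
    by (rule nn_integral_liminf) measurable
  also have "\<dots> \<le> ennreal (2 * pi * sqnorm lborel u)"
  proof (rule Liminf_le)
    show "\<forall>\<^sub>F n in sequentially. (\<integral>\<^sup>+x. ennreal (?w n x * ?F x) \<partial>lborel) \<le> ennreal (2 * pi * sqnorm lborel u)"
    proof (intro always_eventually allI)
      fix n
      have "(\<integral>\<^sup>+x. ennreal (?w n x * ?F x) \<partial>lborel) = ennreal (\<integral>x. ?w n x * ?F x \<partial>lborel)"
        by (rule nn_integral_eq_integral[OF int]) simp
      also have "\<dots> \<le> ennreal (2 * pi * sqnorm lborel u)"
        unfolding val by (intro ennreal_leI mult_left_mono resolvent_form_le[OF u]) auto
      finally show "(\<integral>\<^sup>+x. ennreal (?w n x * ?F x) \<partial>lborel) \<le> ennreal (2 * pi * sqnorm lborel u)" .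
    qed
  qed simp
  finally have "(\<integral>\<^sup>+x. ennreal (?F x) \<partial>lborel) < \<infinity>" by (rule le_less_trans) simp
  then show sF: "square_integrable lborel (fourier u)"
    by (intro square_integrable_if_nn_integral) auto
  note intF = square_integrableD[OF sF]
  have "(\<lambda>n. \<integral>x. ?w n x * ?F x \<partial>lborel) \<longlonglongrightarrow> (\<integral>x. ?F x \<partial>lborel)"
  proof (rule integral_dominated_convergence[OF _ _ intF])
    show "AE x in lborel. (\<lambda>n. ?w n x * ?F x) \<longlonglongrightarrow> ?F x"
    proof (rule AE_I2)
      fix x
      have "(\<lambda>n. ?w n x * ?F x) \<longlonglongrightarrow> 1 * ?F x"
        by (intro tendsto_mult lorentz_weight_tendsto tendsto_const)
      then show "(\<lambda>n. ?w n x * ?F x) \<longlonglongrightarrow> ?F x" by simp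
    qed
    show "AE x in lborel. norm (?w n x * ?F x) \<le> ?F x" for n
    proof (rule AE_I2)
      fix x
      have "x\<^sup>2 + (real (Suc n))\<^sup>2 > 0" by (intro add_nonneg_pos) auto
      then have w: "0 \<le> ?w n x" "?w n x \<le> 1" by (auto simp: divide_le_eq)
      have "norm (v * ?F x) \<le> ?F x" if "0 \<le> v" "v \<le> 1" for v
        using that by (simp add: abs_mult mult_left_le_one_le)
      from this[OF w] show "norm (?w n x * ?F x) \<le> ?F x" .
    qed
  qed measurable
  then have "(\<lambda>n. 1 / (2 * pi) * (2 * pi * ((real (Suc n))\<^sup>2 * resolvent_form (real (Suc n)) u))) \<longlonglongrightarrow> 1 / (2 * pi) * sqnorm lborel (fourier u)"
    unfolding val sqnorm_def[symmetric] by (intro tendsto_mult tendsto_const)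
  then have lim: "(\<lambda>n. (real (Suc n))\<^sup>2 * resolvent_form (real (Suc n)) u) \<longlonglongrightarrow> 1 / (2 * pi) * sqnorm lborel (fourier u)"
    by simp
  have lim2: "(\<lambda>n. (real (Suc n))\<^sup>2 * resolvent_form (real (Suc n)) u + (real (Suc n))\<^sup>2 * neumann_gap (real (Suc n)) u)
      \<longlonglongrightarrow> 1 / (2 * pi) * sqnorm lborel (fourier u) + 0"
    by (intro tendsto_add lim neumann_gap_tendsto_0 u)
  have "1 / (2 * pi) * sqnorm lborel (fourier u) \<le> sqnorm lborel u"
    by (rule LIMSEQ_le_const2[OF lim]) (use resolvent_form_le[OF u] in auto)
  \<comment> \<open>For the reverse inequality the cosine series is truncated, so that the limit in
    \<theta> acts on a finite sum; the gap disappears in this limit.\<close>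
  moreover have "sqnorm lborel u \<le> 1 / (2 * pi) * sqnorm lborel (fourier u)"
  proof (rule LIMSEQ_le_const2[OF cosb_parseval[OF u, unfolded sums_def]], intro exI allI impI)
    fix N :: nat
    have "(\<Sum>k<N. (cmod (coef u k))\<^sup>2 * 1) \<le> 1 / (2 * pi) * sqnorm lborel (fourier u) + 0"
    proof (rule LIMSEQ_le[OF _ lim2])
      show "(\<lambda>n. \<Sum>k<N. (cmod (coef u k))\<^sup>2 * ((real (Suc n))\<^sup>2 / ((freq k)\<^sup>2 + (real (Suc n))\<^sup>2))) \<longlonglongrightarrow> (\<Sum>k<N. (cmod (coef u k))\<^sup>2 * 1)"
        by (intro tendsto_sum tendsto_mult tendsto_const lorentz_weight_tendsto)
      have "(\<Sum>k<N. (cmod (coef u k))\<^sup>2 * ((real (Suc n))\<^sup>2 / ((freq k)\<^sup>2 + (real (Suc n))\<^sup>2))) \<le>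
          (real (Suc n))\<^sup>2 * resolvent_form (real (Suc n)) u + (real (Suc n))\<^sup>2 * neumann_gap (real (Suc n)) u" for n
      proof -
        have "(\<Sum>k<N. (cmod (coef u k))\<^sup>2 / ((real (Suc n))\<^sup>2 + (freq k)\<^sup>2)) \<le>
            resolvent_form (real (Suc n)) u + neumann_gap (real (Suc n)) u"
          by (rule sum_le_sums_nonneg[OF _ neumann_bracket[OF u]]) auto
        from mult_left_mono[OF this, of "(real (Suc n))\<^sup>2"]
        show ?thesis by (simp add: sum_distrib_left distrib_left mult.commute add.commute)
      qed
      then show "\<exists>N'. \<forall>n\<ge>N'. (\<Sum>k<N. (cmod (coef u k))\<^sup>2 * ((real (Suc n))\<^sup>2 / ((freq k)\<^sup>2 + (real (Suc n))\<^sup>2))) \<le>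
          (real (Suc n))\<^sup>2 * resolvent_form (real (Suc n)) u + (real (Suc n))\<^sup>2 * neumann_gap (real (Suc n)) u"
        by blast
    qed
    then show "(\<Sum>k<N. (cmod (coef u k))\<^sup>2) \<le> 1 / (2 * pi) * sqnorm lborel (fourier u)" by simp
  qed
  ultimately show "sqnorm lborel (fourier u) = 2 * pi * sqnorm lborel u"
    by (simp add: field_simps)
qed

text \<open>The form of \<open>\<psi>(-\<Delta>)\<close> for the extreme complete Bernstein function \<open>\<psi>(\<xi>) = \<xi> / (\<xi> + s) = 1 - s / (\<xi> + s)\<close>.\<close>

definition atom_form :: "real \<Rightarrow> (real \<Rightarrow> complex) \<Rightarrow> real" where
  "atom_form s u = sqnorm lborel u - s * resolvent_form (sqrt s) u"

lemma nn_integral_atom_form: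
  assumes u: "u \<in> L2_on {a<..<b}" and s: "s > 0"
  shows "(\<integral>\<^sup>+\<xi>. ennreal (\<xi>\<^sup>2 / (\<xi>\<^sup>2 + s) * (cmod (fourier u \<xi>))\<^sup>2) \<partial>lborel) = ennreal (2 * pi * atom_form s u)"
    and "atom_form s u \<ge> 0"
proof -
  let ?F = "\<lambda>x. (cmod (fourier u x))\<^sup>2"
  have th: "sqrt s > 0" "(sqrt s)\<^sup>2 = s" using s by auto
  have eq: "x\<^sup>2 / (x\<^sup>2 + s) * ?F x = ?F x - s * (?F x / (x\<^sup>2 + (sqrt s)\<^sup>2))" for x
  proof -
    have "x\<^sup>2 + s > 0" using s by (intro add_nonneg_pos) auto
    then show ?thesis unfolding th(2) by (simp add: field_simps)
  qed
  note int1 = square_integrableD[OF plancherel(1)[OF u]]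
  note int2 = integrable_fourier_lorentz[OF L2_on_integrable[OF u] th(1)]
  have int: "integrable lborel (\<lambda>x. x\<^sup>2 / (x\<^sup>2 + s) * ?F x)"
    unfolding eq by (intro Bochner_Integration.integrable_diff integrable_mult_right int1 int2)
  have "(\<integral>x. x\<^sup>2 / (x\<^sup>2 + s) * ?F x \<partial>lborel) = (\<integral>x. ?F x \<partial>lborel) - s * (\<integral>x. ?F x / (x\<^sup>2 + (sqrt s)\<^sup>2) \<partial>lborel)"
    unfolding eq using Bochner_Integration.integral_diff[OF int1 integrable_mult_right[OF int2], of s]
    by (simp only: integral_mult_right_zero)
  also have "\<dots> = 2 * pi * atom_form s u"
    unfolding resolvent_form_fourier[OF u th(1)] sqnorm_def[symmetric] plancherel(2)[OF u] atom_form_def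
    by (simp add: algebra_simps)
  finally have val: "(\<integral>x. x\<^sup>2 / (x\<^sup>2 + s) * ?F x \<partial>lborel) = 2 * pi * atom_form s u" .
  have nn: "0 \<le> x\<^sup>2 / (x\<^sup>2 + s) * ?F x" for x using s by simp
  show "(\<integral>\<^sup>+\<xi>. ennreal (\<xi>\<^sup>2 / (\<xi>\<^sup>2 + s) * ?F \<xi>) \<partial>lborel) = ennreal (2 * pi * atom_form s u)"
    unfolding val[symmetric] by (rule nn_integral_eq_integral[OF int]) (use nn in simp)
  have "0 \<le> (\<integral>x. x\<^sup>2 / (x\<^sup>2 + s) * ?F x \<partial>lborel)" by (rule Bochner_Integration.integral_nonneg[OF nn])
  then show "atom_form s u \<ge> 0" unfolding val using pi_gt_zero by (auto simp: zero_le_mult_iff)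
qed

text \<open>Subtracting s times the Neumann bracket from Parseval's identity turns each weight into
  1 - s / (s + freq^2), and the gap appears with a positive sign. Partial sums are enough and keep
  the later integration against \<mu> elementary.\<close>

lemma atom_form_ge:
  assumes u: "u \<in> L2_on {a<..<b}" and s: "s > 0"
  shows "(\<Sum>k<N. (freq k)\<^sup>2 / ((freq k)\<^sup>2 + s) * (cmod (coef u k))\<^sup>2) + sqrt s / 2 * tail (sqrt s) u \<le> atom_form s u"
proof -
  have th: "sqrt s > 0" "(sqrt s)\<^sup>2 = s" using s by auto
  have "(\<lambda>k. (cmod (coef u k))\<^sup>2 - s * ((cmod (coef u k))\<^sup>2 / ((sqrt s)\<^sup>2 + (freq k)\<^sup>2))) sums
      (sqnorm lborel u - s * (resolvent_form (sqrt s) u + neumann_gap (sqrt s) u))"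
    by (intro sums_diff sums_mult cosb_parseval neumann_bracket u th)
  moreover have "(cmod (coef u k))\<^sup>2 - s * ((cmod (coef u k))\<^sup>2 / ((sqrt s)\<^sup>2 + (freq k)\<^sup>2)) =
      (freq k)\<^sup>2 / ((freq k)\<^sup>2 + s) * (cmod (coef u k))\<^sup>2" for k
  proof -
    have "(freq k)\<^sup>2 + s > 0" using s by (intro add_nonneg_pos) auto
    then show ?thesis unfolding th(2) by (simp add: field_simps)
  qed
  ultimately have "(\<lambda>k. (freq k)\<^sup>2 / ((freq k)\<^sup>2 + s) * (cmod (coef u k))\<^sup>2) sums
      (sqnorm lborel u - s * (resolvent_form (sqrt s) u + neumann_gap (sqrt s) u))" by simp
  then have "(\<Sum>k<N. (freq k)\<^sup>2 / ((freq k)\<^sup>2 + s) * (cmod (coef u k))\<^sup>2) \<le>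
      sqnorm lborel u - s * (resolvent_form (sqrt s) u + neumann_gap (sqrt s) u)"
    by (rule sum_le_sums_nonneg[rotated]) (use s in auto)
  moreover have "sqrt s / 2 * tail (sqrt s) u \<le> s * neumann_gap (sqrt s) u"
  proof -
    have "sqrt s / 2 * tail (sqrt s) u = s * (tail (sqrt s) u / (2 * sqrt s))"
      using s by (simp add: real_div_sqrt field_simps)
    also have "\<dots> \<le> s * neumann_gap (sqrt s) u"
      using s by (intro mult_left_mono neumann_gap_ge_tail th) auto
    finally show ?thesis .
  qed
  ultimately show ?thesis by (simp add: atom_form_def algebra_simps)
qed

lemma sqnorm_sinb_sum:
  assumes "finite I" "\<And>k. k \<in> I \<Longrightarrow> k \<ge> 1"
  shows "sqnorm lborel (\<lambda>x. \<Sum>k\<in>I. c k * sinb k x) = (\<Sum>k\<in>I. (cmod (c k))\<^sup>2)"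
  by (rule sqnorm_orthonormal_sum[OF assms(1)]) (use assms(2) hinner_sinb in auto)

text \<open>The Dirichlet bracket after the same subtraction; the loss is bounded below by the same
  multiple of the tail as in the lower bound.\<close>

lemma atom_form_le:
  assumes I: "finite I" "\<And>k. k \<in> I \<Longrightarrow> k \<ge> 1" and s: "s > 0"
    and u_def: "u = (\<lambda>x. \<Sum>k\<in>I. c k * sinb k x)"
  shows "atom_form s u + sqrt s / 2 * tail (sqrt s) u \<le> (\<Sum>k\<in>I. (freq k)\<^sup>2 / ((freq k)\<^sup>2 + s) * (cmod (c k))\<^sup>2)"
proof -
  have th: "sqrt s > 0" "(sqrt s)\<^sup>2 = s" using s by auto
  have "s * ((\<Sum>k\<in>I. (cmod (c k))\<^sup>2 / ((sqrt s)\<^sup>2 + (freq k)\<^sup>2)) + tail (sqrt s) u / (2 * sqrt s)) \<le> s * resolvent_form (sqrt s) u"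
    using s by (intro mult_left_mono dirichlet_bracket[OF I th(1) u_def]) auto
  moreover have "s * (tail (sqrt s) u / (2 * sqrt s)) = sqrt s / 2 * tail (sqrt s) u"
    using s by (simp add: real_div_sqrt field_simps)
  moreover have "sqnorm lborel u - s * (\<Sum>k\<in>I. (cmod (c k))\<^sup>2 / ((sqrt s)\<^sup>2 + (freq k)\<^sup>2)) =
      (\<Sum>k\<in>I. (freq k)\<^sup>2 / ((freq k)\<^sup>2 + s) * (cmod (c k))\<^sup>2)"
  proof -
    have "sqnorm lborel u = (\<Sum>k\<in>I. (cmod (c k))\<^sup>2)"
      unfolding u_def by (rule sqnorm_sinb_sum[OF I])
    then have "sqnorm lborel u - s * (\<Sum>k\<in>I. (cmod (c k))\<^sup>2 / ((sqrt s)\<^sup>2 + (freq k)\<^sup>2)) =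
        (\<Sum>k\<in>I. (cmod (c k))\<^sup>2 - s * ((cmod (c k))\<^sup>2 / (s + (freq k)\<^sup>2)))"
      by (simp only: sum_distrib_left sum_subtractf th(2))
    also have "\<dots> = (\<Sum>k\<in>I. (freq k)\<^sup>2 / ((freq k)\<^sup>2 + s) * (cmod (c k))\<^sup>2)"
    proof (intro sum.cong refl)
      fix k
      have "(freq k)\<^sup>2 + s > 0" using s by (intro add_nonneg_pos) auto
      then show "(cmod (c k))\<^sup>2 - s * ((cmod (c k))\<^sup>2 / (s + (freq k)\<^sup>2)) = (freq k)\<^sup>2 / ((freq k)\<^sup>2 + s) * (cmod (c k))\<^sup>2"
        by (simp add: field_simps)
    qed
    finally show ?thesis .
  qed
  ultimately show ?thesis unfolding atom_form_def distrib_left by linarith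
qed

section \<open>The form of the Laplacian as a limit of atom forms\<close>

definition energy :: "(real \<Rightarrow> complex) \<Rightarrow> ennreal" where
  "energy u = ennreal (1 / (2 * pi)) * (\<integral>\<^sup>+\<xi>. ennreal (\<xi>\<^sup>2 * (cmod (fourier u \<xi>))\<^sup>2) \<partial>lborel)"

text \<open>With s = n + 1, s times the atom kernel at x^2 approaches x^2 from below. Both bounds
  for atoms can therefore be transferred to the linear term of \<psi>.\<close>

lemma scaled_weight_le: "real (Suc n) * (x\<^sup>2 / (x\<^sup>2 + real (Suc n))) \<le> x\<^sup>2"
proof -
  have "x\<^sup>2 + real (Suc n) > 0" by (intro add_nonneg_pos) auto
  then show ?thesis by (simp add: field_simps)
qed

lemma scaled_weight_tendsto: "(\<lambda>n. real (Suc n) * (x\<^sup>2 / (x\<^sup>2 + real (Suc n)))) \<longlonglongrightarrow> x\<^sup>2"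
  by real_asymp

lemma scaled_atom_form:
  assumes u: "u \<in> L2_on {a<..<b}"
  shows "ennreal (1 / (2 * pi)) * (\<integral>\<^sup>+\<xi>. ennreal (real (Suc n) * (\<xi>\<^sup>2 / (\<xi>\<^sup>2 + real (Suc n))) * (cmod (fourier u \<xi>))\<^sup>2) \<partial>lborel) =
    ennreal (real (Suc n) * atom_form (real (Suc n)) u)"
proof -
  have [measurable]: "u \<in> borel_measurable borel" by (rule L2_on_measurable[OF u])
  have "(\<integral>\<^sup>+\<xi>. ennreal (real (Suc n) * (\<xi>\<^sup>2 / (\<xi>\<^sup>2 + real (Suc n))) * (cmod (fourier u \<xi>))\<^sup>2) \<partial>lborel) =
      (\<integral>\<^sup>+\<xi>. ennreal (real (Suc n)) * ennreal (\<xi>\<^sup>2 / (\<xi>\<^sup>2 + real (Suc n)) * (cmod (fourier u \<xi>))\<^sup>2) \<partial>lborel)"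
    by (intro nn_integral_cong) (simp only: mult.assoc, rule ennreal_mult, auto)
  also have "\<dots> = ennreal (real (Suc n)) * ennreal (2 * pi * atom_form (real (Suc n)) u)"
    by (subst nn_integral_cmult) (measurable, simp only: nn_integral_atom_form(1)[OF u] of_nat_0_less_iff zero_less_Suc)
  finally have eq: "(\<integral>\<^sup>+\<xi>. ennreal (real (Suc n) * (\<xi>\<^sup>2 / (\<xi>\<^sup>2 + real (Suc n))) * (cmod (fourier u \<xi>))\<^sup>2) \<partial>lborel) =
      ennreal (real (Suc n)) * ennreal (2 * pi * atom_form (real (Suc n)) u)" .
  have scale: "ennreal (1 / (2 * pi)) * (ennreal N * ennreal (2 * pi * A)) = ennreal (N * A)" if "N \<ge> 0" "A \<ge> 0" for N A
    using that by (simp add: ennreal_mult[symmetric])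
  show ?thesis unfolding eq by (intro scale nn_integral_atom_form(2)[OF u]) simp_all
qed

lemma energy_ge:
  assumes u: "u \<in> L2_on {a<..<b}"
  shows "ennreal (\<Sum>k<N. (freq k)\<^sup>2 * (cmod (coef u k))\<^sup>2) \<le> energy u"
proof (rule LIMSEQ_le_const2)
  show "(\<lambda>n. ennreal (\<Sum>k<N. real (Suc n) * ((freq k)\<^sup>2 / ((freq k)\<^sup>2 + real (Suc n))) * (cmod (coef u k))\<^sup>2)) \<longlonglongrightarrow>
      ennreal (\<Sum>k<N. (freq k)\<^sup>2 * (cmod (coef u k))\<^sup>2)"
    by (intro tendsto_ennrealI tendsto_sum tendsto_mult scaled_weight_tendsto tendsto_const)
  have "ennreal (\<Sum>k<N. real (Suc n) * ((freq k)\<^sup>2 / ((freq k)\<^sup>2 + real (Suc n))) * (cmod (coef u k))\<^sup>2) \<le> energy u" for n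
  proof -
    have "(\<Sum>k<N. (freq k)\<^sup>2 / ((freq k)\<^sup>2 + real (Suc n)) * (cmod (coef u k))\<^sup>2) \<le> atom_form (real (Suc n)) u"
      by (rule order_trans[OF _ atom_form_ge[OF u, of _ N]]) simp_all
    then have "(\<Sum>k<N. real (Suc n) * ((freq k)\<^sup>2 / ((freq k)\<^sup>2 + real (Suc n))) * (cmod (coef u k))\<^sup>2) \<le> real (Suc n) * atom_form (real (Suc n)) u"
      unfolding mult.assoc sum_distrib_left[symmetric] by (intro mult_left_mono) auto
    then have "ennreal (\<Sum>k<N. real (Suc n) * ((freq k)\<^sup>2 / ((freq k)\<^sup>2 + real (Suc n))) * (cmod (coef u k))\<^sup>2) \<le>
        ennreal (real (Suc n) * atom_form (real (Suc n)) u)" by (rule ennreal_leI)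
    also have "\<dots> \<le> energy u"
      unfolding scaled_atom_form[OF u, symmetric] energy_def
      by (intro mult_left_mono nn_integral_mono ennreal_leI mult_right_mono scaled_weight_le) auto
    finally show ?thesis .
  qed
  then show "\<exists>N'. \<forall>n\<ge>N'. ennreal (\<Sum>k<N. real (Suc n) * ((freq k)\<^sup>2 / ((freq k)\<^sup>2 + real (Suc n))) * (cmod (coef u k))\<^sup>2) \<le> energy u"
    by blast
qed

text \<open>Fatou's lemma carries the uniform upper bounds for the scaled atoms over to the limit;
  in particular sine sums have finite energy.\<close>

lemma energy_le:
  assumes I: "finite I" "\<And>k. k \<in> I \<Longrightarrow> k \<ge> 1"
    and u_def: "u = (\<lambda>x. \<Sum>k\<in>I. c k * sinb k x)"
  shows "energy u \<le> ennreal (\<Sum>k\<in>I. (freq k)\<^sup>2 * (cmod (c k))\<^sup>2)"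
proof -
  have u: "u \<in> L2_on {a<..<b}"
    unfolding u_def by (intro L2_on_sum L2_on_scale) simp
  have [measurable]: "u \<in> borel_measurable borel" by (rule L2_on_measurable[OF u])
  let ?F = "\<lambda>x. (cmod (fourier u x))\<^sup>2"
  have "energy u = ennreal (1 / (2 * pi)) * (\<integral>\<^sup>+x. liminf (\<lambda>n. ennreal (real (Suc n) * (x\<^sup>2 / (x\<^sup>2 + real (Suc n))) * ?F x)) \<partial>lborel)"
    unfolding energy_def
  proof (intro arg_cong2[where f = "(*)"] refl nn_integral_cong)
    fix x
    have "(\<lambda>n. ennreal (real (Suc n) * (x\<^sup>2 / (x\<^sup>2 + real (Suc n))) * ?F x)) \<longlonglongrightarrow> ennreal (x\<^sup>2 * ?F x)"
      by (intro tendsto_ennrealI tendsto_mult scaled_weight_tendsto tendsto_const)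
    then show "ennreal (x\<^sup>2 * ?F x) = liminf (\<lambda>n. ennreal (real (Suc n) * (x\<^sup>2 / (x\<^sup>2 + real (Suc n))) * ?F x))"
      by (rule lim_imp_Liminf[OF trivial_limit_sequentially, symmetric])
  qed
  also have "\<dots> \<le> ennreal (1 / (2 * pi)) * liminf (\<lambda>n. \<integral>\<^sup>+x. ennreal (real (Suc n) * (x\<^sup>2 / (x\<^sup>2 + real (Suc n))) * ?F x) \<partial>lborel)"
    by (intro mult_left_mono nn_integral_liminf) measurable
  also have "\<dots> \<le> ennreal (1 / (2 * pi)) * ennreal (2 * pi * (\<Sum>k\<in>I. (freq k)\<^sup>2 * (cmod (c k))\<^sup>2))"
  proof (intro mult_left_mono Liminf_le always_eventually allI)
    fix n
    have "atom_form (real (Suc n)) u \<le> (\<Sum>k\<in>I. (freq k)\<^sup>2 / ((freq k)\<^sup>2 + real (Suc n)) * (cmod (c k))\<^sup>2)"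
      by (rule order_trans[OF _ atom_form_le[OF I _ u_def]]) simp_all
    then have "real (Suc n) * atom_form (real (Suc n)) u \<le> (\<Sum>k\<in>I. real (Suc n) * ((freq k)\<^sup>2 / ((freq k)\<^sup>2 + real (Suc n))) * (cmod (c k))\<^sup>2)"
      unfolding mult.assoc sum_distrib_left[symmetric] by (intro mult_left_mono) auto
    also have "\<dots> \<le> (\<Sum>k\<in>I. (freq k)\<^sup>2 * (cmod (c k))\<^sup>2)"
      by (intro sum_mono mult_right_mono scaled_weight_le) auto
    finally have le: "real (Suc n) * atom_form (real (Suc n)) u \<le> (\<Sum>k\<in>I. (freq k)\<^sup>2 * (cmod (c k))\<^sup>2)" .
    have "(\<integral>\<^sup>+x. ennreal (real (Suc n) * (x\<^sup>2 / (x\<^sup>2 + real (Suc n))) * ?F x) \<partial>lborel) =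
        ennreal (2 * pi) * (ennreal (1 / (2 * pi)) * (\<integral>\<^sup>+x. ennreal (real (Suc n) * (x\<^sup>2 / (x\<^sup>2 + real (Suc n))) * ?F x) \<partial>lborel))"
      unfolding mult.assoc[symmetric] by (subst ennreal_mult[symmetric]) simp_all
    also have "\<dots> = ennreal (2 * pi * (real (Suc n) * atom_form (real (Suc n)) u))"
      unfolding scaled_atom_form[OF u] using nn_integral_atom_form(2)[OF u, of "real (Suc n)"]
      by (subst ennreal_mult[symmetric]) auto
    also have "\<dots> \<le> ennreal (2 * pi * (\<Sum>k\<in>I. (freq k)\<^sup>2 * (cmod (c k))\<^sup>2))"
      by (intro ennreal_leI mult_left_mono le) auto
    finally show "(\<integral>\<^sup>+x. ennreal (real (Suc n) * (x\<^sup>2 / (x\<^sup>2 + real (Suc n))) * ?F x) \<partial>lborel) \<le>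
        ennreal (2 * pi * (\<Sum>k\<in>I. (freq k)\<^sup>2 * (cmod (c k))\<^sup>2))" .
  qed simp_all
  also have "\<dots> = ennreal (\<Sum>k\<in>I. (freq k)\<^sup>2 * (cmod (c k))\<^sup>2)"
    by (subst ennreal_mult[symmetric]) (auto intro!: mult_nonneg_nonneg sum_nonneg)
  finally show ?thesis .
qed

end

section \<open>Complete Bernstein functions\<close>

lemma bernstein_kernel_mono:
  assumes "0 \<le> x" "x \<le> y" "0 < s"
  shows "x / (x + s) \<le> y / (y + (s::real))"
  using assms by (simp add: divide_simps) (simp add: algebra_simps mult_right_mono)

lemma bernstein_kernel_strict_mono:
  assumes "0 \<le> x" "x < y" "0 < s"
  shows "x / (x + s) < y / (y + (s::real))"
  using assms by (simp add: divide_simps) (simp add: algebra_simps)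

locale bernstein_interval = finite_interval +
  fixes \<psi> :: "real \<Rightarrow> real" and c0 c1 :: real and \<mu> :: "real measure"
  assumes c0: "0 \<le> c0" and c1: "0 \<le> c1"
    and sets_\<mu>: "sets \<mu> = sets (restrict_space borel {0::real<..})"
    and ex_integrable: "\<exists>\<xi>>0. integrable \<mu> (\<lambda>s. \<xi> / (\<xi> + s))"
    and \<psi>_eq: "\<And>\<xi>. 0 \<le> \<xi> \<Longrightarrow> \<psi> \<xi> = c1 * \<xi> + c0 + 1 / pi * (\<integral>s. \<xi> / (\<xi> + s) \<partial>\<mu>)"
begin

lemma space_\<mu>: "space \<mu> = {0<..}"
  using sets_eq_imp_space_eq[OF sets_\<mu>] by (simp add: space_restrict_space)

lemma borel_measurable_\<mu>: "f \<in> borel_measurable borel \<Longrightarrow> f \<in> borel_measurable \<mu>"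
  unfolding measurable_cong_sets[OF sets_\<mu> refl] by (rule measurable_restrict_space1)

lemma id_measurable_\<mu>: "(\<lambda>s. s) \<in> measurable \<mu> borel"
  by (rule borel_measurable_\<mu>) simp

lemma space_\<mu>_pos: "s \<in> space \<mu> \<Longrightarrow> s > 0"
  by (simp add: space_\<mu>)

text \<open>Integrability at one positive argument spreads to all: the ratio of the kernels at x and
  at y is at most max 1 (x / y), uniformly in s.\<close>

lemma integrable_kernel:
  assumes x: "0 \<le> x"
  shows "integrable \<mu> (\<lambda>s. x / (x + s))"
proof -
  obtain y where y: "y > 0" "integrable \<mu> (\<lambda>s. y / (y + s))" using ex_integrable by blast
  show ?thesis
  proof (rule Bochner_Integration.integrable_bound)
    show "integrable \<mu> (\<lambda>s. max 1 (x / y) * (y / (y + s)))" by (rule integrable_mult_right[OF y(2)])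
    show "(\<lambda>s. x / (x + s)) \<in> borel_measurable \<mu>" by (rule borel_measurable_\<mu>) measurable
    show "AE s in \<mu>. norm (x / (x + s)) \<le> norm (max 1 (x / y) * (y / (y + s)))"
    proof (rule AE_I2)
      fix s assume "s \<in> space \<mu>"
      then have s: "s > 0" by (rule space_\<mu>_pos)
      have nn: "0 \<le> x / (x + s)" "0 \<le> y / (y + s)" using x y(1) s by auto
      have "x / (x + s) \<le> max 1 (x / y) * (y / (y + s))"
      proof (cases "x \<le> y")
        case True
        have "x / (x + s) \<le> 1 * (y / (y + s))" using bernstein_kernel_mono[OF x True s] by simp
        also have "\<dots> \<le> max 1 (x / y) * (y / (y + s))" by (intro mult_right_mono nn) simp
        finally show ?thesis .
      next
        case False
        have "x / (x + s) \<le> x / (y + s)" using False x y(1) s by (intro divide_left_mono) auto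
        also have "\<dots> = x / y * (y / (y + s))" using y(1) by simp
        also have "\<dots> \<le> max 1 (x / y) * (y / (y + s))" by (intro mult_right_mono nn) simp
        finally show ?thesis .
      qed
      moreover have "0 \<le> max 1 (x / y) * (y / (y + s))" using nn by (intro mult_nonneg_nonneg) auto
      ultimately show "norm (x / (x + s)) \<le> norm (max 1 (x / y) * (y / (y + s)))"
        using nn by (simp only: real_norm_def abs_of_nonneg)
    qed
  qed
qed

lemma \<psi>_nonneg: "0 \<le> x \<Longrightarrow> 0 \<le> \<psi> x"
  unfolding \<psi>_eq using c0 c1
  by (intro add_nonneg_nonneg mult_nonneg_nonneg integral_nonneg_AE AE_I2) (auto dest: space_\<mu>_pos)

lemma \<psi>_mono:
  assumes "0 \<le> x" "x \<le> y"
  shows "\<psi> x \<le> \<psi> y"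
proof -
  have "(\<integral>s. x / (x + s) \<partial>\<mu>) \<le> (\<integral>s. y / (y + s) \<partial>\<mu>)"
    using assms by (intro integral_mono integrable_kernel bernstein_kernel_mono) (auto dest: space_\<mu>_pos)
  then show ?thesis
    using assms c1 by (simp add: \<psi>_eq add_mono mult_left_mono divide_right_mono)
qed

lemma \<psi>_strict_mono:
  assumes "0 \<le> x" "x < y" and \<mu>: "emeasure \<mu> (space \<mu>) \<noteq> 0"
  shows "\<psi> x < \<psi> y"
proof -
  have "(\<integral>s. x / (x + s) \<partial>\<mu>) < (\<integral>s. y / (y + s) \<partial>\<mu>)"
  proof -
    have lt: "x / (x + s) < y / (y + s)" if "s \<in> space \<mu>" for s
      by (rule bernstein_kernel_strict_mono[OF assms(1,2) space_\<mu>_pos[OF that]])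
    have ix: "integrable \<mu> (\<lambda>s. x / (x + s))" and iy: "integrable \<mu> (\<lambda>s. y / (y + s))"
      using assms by (auto intro: integrable_kernel)
    have nn: "AE s in \<mu>. 0 \<le> y / (y + s) - x / (x + s)"
      using lt by (intro AE_I2) (simp add: less_imp_le)
    have "(\<integral>s. y / (y + s) - x / (x + s) \<partial>\<mu>) \<noteq> 0"
    proof
      assume "(\<integral>s. y / (y + s) - x / (x + s) \<partial>\<mu>) = 0"
      then have "AE s in \<mu>. y / (y + s) - x / (x + s) = 0"
        using integral_nonneg_eq_0_iff_AE[OF Bochner_Integration.integrable_diff[OF iy ix] nn] by simp
      moreover have "AE s in \<mu>. x / (x + s) < y / (y + s)" using lt by (rule AE_I2)
      ultimately have "AE s in \<mu>. False" by eventually_elim simp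
      then show False using \<mu> by (simp add: eventually_False ae_filter_eq_bot_iff)
    qed
    moreover have "0 \<le> (\<integral>s. y / (y + s) - x / (x + s) \<partial>\<mu>)" by (rule integral_nonneg_AE[OF nn])
    ultimately show ?thesis using Bochner_Integration.integral_diff[OF iy ix] by linarith
  qed
  moreover have "c1 * x \<le> c1 * y" using assms c1 by (intro mult_left_mono) auto
  ultimately have "c1 * x + c0 + 1 / pi * (\<integral>s. x / (x + s) \<partial>\<mu>) < c1 * y + c0 + 1 / pi * (\<integral>s. y / (y + s) \<partial>\<mu>)"
    by (intro add_le_less_mono add_mono mult_strict_left_mono) auto
  then show ?thesis using assms by (simp only: \<psi>_eq order.strict_implies_order order.trans)
qed

lemma ennreal_\<psi>:
  assumes x: "0 \<le> x"
  shows "ennreal (\<psi> x) = ennreal (c1 * x) + ennreal c0 + ennreal (1 / pi) * (\<integral>\<^sup>+s. ennreal (x / (x + s)) \<partial>\<mu>)"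
proof -
  have nn: "AE s in \<mu>. 0 \<le> x / (x + s)" using x by (intro AE_I2) (auto dest: space_\<mu>_pos)
  have "(\<integral>\<^sup>+s. ennreal (x / (x + s)) \<partial>\<mu>) = ennreal (\<integral>s. x / (x + s) \<partial>\<mu>)"
    by (rule nn_integral_eq_integral[OF integrable_kernel[OF x] nn])
  moreover have "0 \<le> (\<integral>s. x / (x + s) \<partial>\<mu>)" by (rule integral_nonneg_AE[OF nn])
  ultimately show ?thesis
    unfolding \<psi>_eq[OF x] using x c0 c1 by (simp add: ennreal_plus ennreal_mult[symmetric])
qed

text \<open>Tonelli's theorem for \<mu> and Lebesgue measure asks for this. On (0, n] the kernel at
  argument 1 is at least 1 / (1 + n), so these sets have finite measure.\<close>

lemma sigma_finite_\<mu>: "sigma_finite_measure \<mu>"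
proof
  let ?A = "\<lambda>n. {0<..real n}"
  have meas: "?A n \<in> sets \<mu>" for n
    unfolding sets_\<mu> by (subst sets_restrict_space_iff) auto
  have fin: "emeasure \<mu> (?A n) \<noteq> \<infinity>" for n
  proof -
    have "ennreal (1 / (1 + real n)) * emeasure \<mu> (?A n) = (\<integral>\<^sup>+s. ennreal (1 / (1 + real n)) * indicator (?A n) s \<partial>\<mu>)"
      by (simp add: nn_integral_cmult_indicator meas)
    also have "\<dots> \<le> (\<integral>\<^sup>+s. ennreal (1 / (1 + s)) \<partial>\<mu>)"
      by (intro nn_integral_mono) (auto simp: indicator_def intro!: ennreal_leI divide_left_mono dest: space_\<mu>_pos)
    also have "\<dots> < \<infinity>"
      using integrableD(2)[OF integrable_kernel[of 1]] by (simp add: less_top)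
    finally show ?thesis by (auto simp: ennreal_mult_less_top less_top)
  qed
  have "(\<Union>n. ?A n) = space \<mu>"
    by (auto simp: space_\<mu> intro: real_arch_simple)
  then show "\<exists>A. countable A \<and> A \<subseteq> sets \<mu> \<and> \<Union> A = space \<mu> \<and> (\<forall>a\<in>A. emeasure \<mu> a \<noteq> \<infinity>)"
    using meas fin by (intro exI[of _ "range ?A"]) auto
qed

text \<open>What both brackets lose at least, integrated over \<mu>. The weight sqrt s / 2 is the
  factor s of the atom form times the 1 / (2 * sqrt s) of the bracketing inequalities.\<close>

definition gap_form :: "(real \<Rightarrow> complex) \<Rightarrow> ennreal" where
  "gap_form u = ennreal (1 / pi) * (\<integral>\<^sup>+s. ennreal (sqrt s / 2 * tail (sqrt s) u) \<partial>\<mu>)"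

lemma tail_measurable:
  assumes "u \<in> borel_measurable borel"
  shows "(\<lambda>s. tail (sqrt s) u) \<in> borel_measurable borel"
proof -
  note assms [measurable]
  have [measurable]: "cnj \<in> borel_measurable borel"
    by (intro borel_measurable_continuous_onI continuous_intros)
  have "(\<lambda>s. \<integral>x. u x * cnj (complex_of_real (exp (- sqrt s * (x - a)) * indicator {a..b} x)) \<partial>lborel) \<in> borel_measurable borel"
    by (rule lborel.borel_measurable_lebesgue_integral) measurable
  then show "(\<lambda>s. tail (sqrt s) u) \<in> borel_measurable borel"
    unfolding tail_def hinner_def expb_def by measurable
qed

text \<open>The form is linear in \<psi>, and Tonelli's theorem moves the \<mu>-integral outside. In
  extended nonnegative reals the identity also holds for functions outside the form domain.\<close>

lemma dirichlet_form_decompose: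
  assumes u: "u \<in> L2_on {a<..<b}"
  shows "dirichlet_form \<psi> u = ennreal c1 * energy u + ennreal c0 * ennreal (sqnorm lborel u) +
    ennreal (1 / pi) * (\<integral>\<^sup>+s. ennreal (atom_form s u) \<partial>\<mu>)"
proof -
  interpret \<mu>: sigma_finite_measure \<mu> by (rule sigma_finite_\<mu>)
  interpret pair_sigma_finite \<mu> "lborel :: real measure" ..
  have [measurable]: "u \<in> borel_measurable borel" by (rule L2_on_measurable[OF u])
  let ?F = "\<lambda>x. (cmod (fourier u x))\<^sup>2"
  let ?K = "\<lambda>s x. ennreal (x\<^sup>2 / (x\<^sup>2 + s) * ?F x)"
  have pt: "ennreal (\<psi> (x\<^sup>2) * ?F x) = ennreal c1 * ennreal (x\<^sup>2 * ?F x) + ennreal c0 * ennreal (?F x) +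
      ennreal (1 / pi) * (\<integral>\<^sup>+s. ?K s x \<partial>\<mu>)" for x
  proof -
    have "(\<integral>\<^sup>+s. ?K s x \<partial>\<mu>) = (\<integral>\<^sup>+s. ennreal (x\<^sup>2 / (x\<^sup>2 + s)) * ennreal (?F x) \<partial>\<mu>)"
      by (intro nn_integral_cong ennreal_mult) (auto dest: space_\<mu>_pos)
    also have "\<dots> = (\<integral>\<^sup>+s. ennreal (x\<^sup>2 / (x\<^sup>2 + s)) \<partial>\<mu>) * ennreal (?F x)"
      by (rule nn_integral_multc) (rule borel_measurable_\<mu>, measurable)
    finally have K: "(\<integral>\<^sup>+s. ?K s x \<partial>\<mu>) = (\<integral>\<^sup>+s. ennreal (x\<^sup>2 / (x\<^sup>2 + s)) \<partial>\<mu>) * ennreal (?F x)" .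
    have "ennreal (\<psi> (x\<^sup>2) * ?F x) = ennreal (\<psi> (x\<^sup>2)) * ennreal (?F x)"
      by (intro ennreal_mult \<psi>_nonneg) auto
    also have "\<dots> = ennreal c1 * ennreal (x\<^sup>2 * ?F x) + ennreal c0 * ennreal (?F x) + ennreal (1 / pi) * (\<integral>\<^sup>+s. ?K s x \<partial>\<mu>)"
      unfolding K ennreal_\<psi>[OF zero_le_power2] using c0 c1
      by (simp add: ennreal_mult distrib_right mult.assoc)
    finally show ?thesis .
  qed
  let ?i = "ennreal (1 / (2 * pi))"
  have [measurable]: "(\<lambda>p. fst p) \<in> borel_measurable (\<mu> \<Otimes>\<^sub>M (lborel :: real measure))"
    "(\<lambda>p. snd p) \<in> borel_measurable ((lborel :: real measure) \<Otimes>\<^sub>M \<mu>)"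
    by (rule measurable_compose[OF measurable_fst id_measurable_\<mu>] measurable_compose[OF measurable_snd id_measurable_\<mu>])+
  have K1: "(\<lambda>(s, x). ?K s x) \<in> borel_measurable (\<mu> \<Otimes>\<^sub>M lborel)"
    and K2: "(\<lambda>(x, s). ?K s x) \<in> borel_measurable (lborel \<Otimes>\<^sub>M \<mu>)"
    unfolding case_prod_beta by measurable
  have m1: "(\<lambda>x. ennreal (x\<^sup>2 * ?F x)) \<in> borel_measurable lborel"
    and m2: "(\<lambda>x. ennreal (?F x)) \<in> borel_measurable lborel"
    by measurable
  have m3: "(\<lambda>x. \<integral>\<^sup>+s. ?K s x \<partial>\<mu>) \<in> borel_measurable lborel"
    by (rule \<mu>.borel_measurable_nn_integral[OF K2])
  have m4: "(\<lambda>s. \<integral>\<^sup>+x. ?K s x \<partial>lborel) \<in> borel_measurable \<mu>"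
    by (rule lborel.borel_measurable_nn_integral[OF K1])
  have "(\<integral>\<^sup>+x. ennreal (\<psi> (x\<^sup>2) * ?F x) \<partial>lborel) =
      ennreal c1 * (\<integral>\<^sup>+x. ennreal (x\<^sup>2 * ?F x) \<partial>lborel) + ennreal c0 * (\<integral>\<^sup>+x. ennreal (?F x) \<partial>lborel) +
      ennreal (1 / pi) * (\<integral>\<^sup>+x. \<integral>\<^sup>+s. ?K s x \<partial>\<mu> \<partial>lborel)"
    unfolding pt using m1 m2 m3 by (simp add: nn_integral_add nn_integral_cmult)
  also have "(\<integral>\<^sup>+x. \<integral>\<^sup>+s. ?K s x \<partial>\<mu> \<partial>lborel) = (\<integral>\<^sup>+s. \<integral>\<^sup>+x. ?K s x \<partial>lborel \<partial>\<mu>)"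
    by (rule Fubini'[OF K1])
  finally have "dirichlet_form \<psi> u = ennreal c1 * energy u + ennreal c0 * (?i * (\<integral>\<^sup>+x. ennreal (?F x) \<partial>lborel)) +
      ennreal (1 / pi) * (?i * (\<integral>\<^sup>+s. \<integral>\<^sup>+x. ?K s x \<partial>lborel \<partial>\<mu>))"
    unfolding dirichlet_form_def energy_def by (simp only: distrib_left mult.left_commute)
  also have "?i * (\<integral>\<^sup>+x. ennreal (?F x) \<partial>lborel) = ennreal (sqnorm lborel u)"
    unfolding nn_integral_cmod_square[OF plancherel(1)[OF u]] plancherel(2)[OF u]
    by (subst ennreal_mult[symmetric]) auto
  also have "?i * (\<integral>\<^sup>+s. \<integral>\<^sup>+x. ?K s x \<partial>lborel \<partial>\<mu>) = (\<integral>\<^sup>+s. ?i * (\<integral>\<^sup>+x. ?K s x \<partial>lborel) \<partial>\<mu>)"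
    by (rule nn_integral_cmult[OF m4, symmetric])
  also have "\<dots> = (\<integral>\<^sup>+s. ennreal (atom_form s u) \<partial>\<mu>)"
  proof (rule nn_integral_cong)
    fix s assume "s \<in> space \<mu>"
    then have s: "s > 0" by (rule space_\<mu>_pos)
    show "?i * (\<integral>\<^sup>+x. ?K s x \<partial>lborel) = ennreal (atom_form s u)"
      unfolding nn_integral_atom_form(1)[OF u s] using nn_integral_atom_form(2)[OF u s]
      by (subst ennreal_mult[symmetric]) auto
  qed
  finally show ?thesis .
qed

text \<open>The matching decomposition for a finite combination of values of \<psi>, so that forms
  and diagonal sums can be compared one by one: linear part, constant part, atoms.\<close>

lemma bernstein_weight_sum:
  assumes I: "finite I" and x: "\<And>k. k \<in> I \<Longrightarrow> 0 \<le> x k" and w: "\<And>k. k \<in> I \<Longrightarrow> 0 \<le> w k"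
  shows "ennreal (\<Sum>k\<in>I. \<psi> (x k) * w k) = ennreal c1 * ennreal (\<Sum>k\<in>I. x k * w k) +
    ennreal c0 * ennreal (\<Sum>k\<in>I. w k) + ennreal (1 / pi) * (\<integral>\<^sup>+s. ennreal (\<Sum>k\<in>I. x k / (x k + s) * w k) \<partial>\<mu>)"
proof -
  have int: "integrable \<mu> (\<lambda>s. \<Sum>k\<in>I. x k / (x k + s) * w k)"
    using x by (intro Bochner_Integration.integrable_sum integrable_mult_left integrable_kernel) auto
  have nn: "AE s in \<mu>. 0 \<le> (\<Sum>k\<in>I. x k / (x k + s) * w k)"
    using x w by (intro AE_I2 sum_nonneg mult_nonneg_nonneg) (auto dest: space_\<mu>_pos)
  have eq: "(\<integral>\<^sup>+s. ennreal (\<Sum>k\<in>I. x k / (x k + s) * w k) \<partial>\<mu>) = ennreal (\<integral>s. (\<Sum>k\<in>I. x k / (x k + s) * w k) \<partial>\<mu>)"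
    by (rule nn_integral_eq_integral[OF int nn])
  have int_eq: "(\<integral>s. (\<Sum>k\<in>I. x k / (x k + s) * w k) \<partial>\<mu>) = (\<Sum>k\<in>I. (\<integral>s. x k / (x k + s) \<partial>\<mu>) * w k)"
  proof -
    have "(\<integral>s. (\<Sum>k\<in>I. x k / (x k + s) * w k) \<partial>\<mu>) = (\<Sum>k\<in>I. \<integral>s. x k / (x k + s) * w k \<partial>\<mu>)"
      by (rule Bochner_Integration.integral_sum) (intro integrable_mult_left integrable_kernel x)
    then show ?thesis by (simp only: integral_mult_left_zero)
  qed
  have "(\<Sum>k\<in>I. \<psi> (x k) * w k) = c1 * (\<Sum>k\<in>I. x k * w k) + c0 * (\<Sum>k\<in>I. w k) +
      1 / pi * (\<integral>s. (\<Sum>k\<in>I. x k / (x k + s) * w k) \<partial>\<mu>)"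
    unfolding int_eq sum_distrib_left sum.distrib[symmetric]
    by (intro sum.cong refl) (simp add: \<psi>_eq x algebra_simps)
  moreover have "0 \<le> (\<integral>s. (\<Sum>k\<in>I. x k / (x k + s) * w k) \<partial>\<mu>)" by (rule integral_nonneg_AE[OF nn])
  moreover have "0 \<le> (\<Sum>k\<in>I. x k * w k)" "0 \<le> (\<Sum>k\<in>I. w k)" using x w by (auto intro!: sum_nonneg)
  ultimately show ?thesis unfolding eq using c0 c1
    by (simp add: ennreal_plus ennreal_mult[symmetric])
qed

text \<open>The linear and the constant part satisfy the plain inequality; the whole gap comes from
  the atoms.\<close>

lemma dirichlet_form_ge:
  assumes u: "u \<in> L2_on {a<..<b}"
  shows "ennreal (\<Sum>k<N. \<psi> ((freq k)\<^sup>2) * (cmod (coef u k))\<^sup>2) + gap_form u \<le> dirichlet_form \<psi> u"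
proof -
  have [measurable]: "u \<in> borel_measurable borel" by (rule L2_on_measurable[OF u])
  let ?S = "\<lambda>s. \<Sum>k<N. (freq k)\<^sup>2 / ((freq k)\<^sup>2 + s) * (cmod (coef u k))\<^sup>2"
  let ?T = "\<lambda>s. sqrt s / 2 * tail (sqrt s) u"
  have [measurable]: "(\<lambda>s. tail (sqrt s) u) \<in> borel_measurable borel" by (rule tail_measurable) simp
  have mS: "(\<lambda>s. ennreal (?S s)) \<in> borel_measurable \<mu>" and mT: "(\<lambda>s. ennreal (?T s)) \<in> borel_measurable \<mu>"
    and mST: "(\<lambda>s. ennreal (?S s - ?T s)) \<in> borel_measurable \<mu>"
    by (intro borel_measurable_\<mu>; measurable)+
  have "(\<integral>\<^sup>+s. ennreal (?S s) \<partial>\<mu>) + (\<integral>\<^sup>+s. ennreal (?T s) \<partial>\<mu>) = (\<integral>\<^sup>+s. ennreal (?S s) + ennreal (?T s) \<partial>\<mu>)"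
    by (rule nn_integral_add[symmetric, OF mS mT])
  also have "\<dots> \<le> (\<integral>\<^sup>+s. ennreal (atom_form s u) \<partial>\<mu>)"
  proof (rule nn_integral_mono)
    fix s assume "s \<in> space \<mu>"
    then have s: "s > 0" by (rule space_\<mu>_pos)
    have "ennreal (?S s) + ennreal (?T s) = ennreal (?S s + ?T s)"
      using s by (intro ennreal_plus[symmetric] sum_nonneg) auto
    also have "\<dots> \<le> ennreal (atom_form s u)" by (rule ennreal_leI[OF atom_form_ge[OF u s]])
    finally show "ennreal (?S s) + ennreal (?T s) \<le> ennreal (atom_form s u)" .
  qed
  finally have 1: "ennreal (1 / pi) * (\<integral>\<^sup>+s. ennreal (?S s) \<partial>\<mu>) + gap_form u \<le> ennreal (1 / pi) * (\<integral>\<^sup>+s. ennreal (atom_form s u) \<partial>\<mu>)"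
    unfolding gap_form_def distrib_left[symmetric] by (rule mult_left_mono) simp
  have 2: "(\<Sum>k<N. (cmod (coef u k))\<^sup>2) \<le> sqnorm lborel u"
    by (rule sum_le_sums_nonneg[OF _ cosb_parseval[OF u]]) simp
  have "ennreal (\<Sum>k<N. \<psi> ((freq k)\<^sup>2) * (cmod (coef u k))\<^sup>2) + gap_form u =
      ennreal c1 * ennreal (\<Sum>k<N. (freq k)\<^sup>2 * (cmod (coef u k))\<^sup>2) + ennreal c0 * ennreal (\<Sum>k<N. (cmod (coef u k))\<^sup>2) +
      (ennreal (1 / pi) * (\<integral>\<^sup>+s. ennreal (?S s) \<partial>\<mu>) + gap_form u)"
    by (subst bernstein_weight_sum) (auto simp: add.assoc)
  also have "\<dots> \<le> dirichlet_form \<psi> u"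
    unfolding dirichlet_form_decompose[OF u]
    by (intro add_mono mult_left_mono energy_ge[OF u] ennreal_leI 2 1) auto
  finally show ?thesis .
qed

lemma dirichlet_form_le:
  assumes I: "finite I" "\<And>k. k \<in> I \<Longrightarrow> k \<ge> 1"
    and u_def: "u = (\<lambda>x. \<Sum>k\<in>I. c k * sinb k x)"
  shows "dirichlet_form \<psi> u + gap_form u \<le> ennreal (\<Sum>k\<in>I. \<psi> ((freq k)\<^sup>2) * (cmod (c k))\<^sup>2)"
proof -
  have u: "u \<in> L2_on {a<..<b}"
    unfolding u_def by (intro L2_on_sum L2_on_scale) simp
  have [measurable]: "u \<in> borel_measurable borel" by (rule L2_on_measurable[OF u])
  let ?S = "\<lambda>s. \<Sum>k\<in>I. (freq k)\<^sup>2 / ((freq k)\<^sup>2 + s) * (cmod (c k))\<^sup>2"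
  let ?T = "\<lambda>s. sqrt s / 2 * tail (sqrt s) u"
  have [measurable]: "(\<lambda>s. tail (sqrt s) u) \<in> borel_measurable borel" by (rule tail_measurable) simp
  have mS: "(\<lambda>s. ennreal (?S s)) \<in> borel_measurable \<mu>" and mT: "(\<lambda>s. ennreal (?T s)) \<in> borel_measurable \<mu>"
    and mST: "(\<lambda>s. ennreal (?S s - ?T s)) \<in> borel_measurable \<mu>"
    by (intro borel_measurable_\<mu>; measurable)+
  have "(\<integral>\<^sup>+s. ennreal (atom_form s u) \<partial>\<mu>) + (\<integral>\<^sup>+s. ennreal (?T s) \<partial>\<mu>) \<le> (\<integral>\<^sup>+s. ennreal (?S s) \<partial>\<mu>)"
  proof -
    \<comment> \<open>The difference is formed in the reals, where the nonnegative atom form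
      certifies that it is nonnegative; adding the tail back is then exact in the extended
      reals.\<close>
    have "(\<integral>\<^sup>+s. ennreal (atom_form s u) \<partial>\<mu>) \<le> (\<integral>\<^sup>+s. ennreal (?S s - ?T s) \<partial>\<mu>)"
    proof (rule nn_integral_mono)
      fix s assume "s \<in> space \<mu>"
      then have s: "s > 0" by (rule space_\<mu>_pos)
      show "ennreal (atom_form s u) \<le> ennreal (?S s - ?T s)"
        using atom_form_le[OF I s u_def] by (intro ennreal_leI) simp
    qed
    then have "(\<integral>\<^sup>+s. ennreal (atom_form s u) \<partial>\<mu>) + (\<integral>\<^sup>+s. ennreal (?T s) \<partial>\<mu>) \<le>
        (\<integral>\<^sup>+s. ennreal (?S s - ?T s) \<partial>\<mu>) + (\<integral>\<^sup>+s. ennreal (?T s) \<partial>\<mu>)" by (rule add_right_mono)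
    also have "\<dots> = (\<integral>\<^sup>+s. ennreal (?S s - ?T s) + ennreal (?T s) \<partial>\<mu>)"
      by (rule nn_integral_add[symmetric, OF mST mT])
    also have "\<dots> = (\<integral>\<^sup>+s. ennreal (?S s) \<partial>\<mu>)"
    proof (rule nn_integral_cong)
      fix s assume "s \<in> space \<mu>"
      then have s: "s > 0" by (rule space_\<mu>_pos)
      have "0 \<le> ?S s - ?T s" using atom_form_le[OF I s u_def] nn_integral_atom_form(2)[OF u s] by linarith
      moreover have "0 \<le> ?T s" using s by simp
      ultimately show "ennreal (?S s - ?T s) + ennreal (?T s) = ennreal (?S s)"
        by (subst ennreal_plus[symmetric]) auto
    qed
    finally show ?thesis .
  qed
  then have 1: "ennreal (1 / pi) * (\<integral>\<^sup>+s. ennreal (atom_form s u) \<partial>\<mu>) + gap_form u \<le> ennreal (1 / pi) * (\<integral>\<^sup>+s. ennreal (?S s) \<partial>\<mu>)"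
    unfolding gap_form_def distrib_left[symmetric] by (rule mult_left_mono) simp
  have 2: "sqnorm lborel u = (\<Sum>k\<in>I. (cmod (c k))\<^sup>2)"
    unfolding u_def by (rule sqnorm_sinb_sum[OF I])
  have "dirichlet_form \<psi> u + gap_form u = ennreal c1 * energy u + ennreal c0 * ennreal (sqnorm lborel u) +
      (ennreal (1 / pi) * (\<integral>\<^sup>+s. ennreal (atom_form s u) \<partial>\<mu>) + gap_form u)"
    unfolding dirichlet_form_decompose[OF u] by (simp only: add.assoc)
  also have "\<dots> \<le> ennreal c1 * ennreal (\<Sum>k\<in>I. (freq k)\<^sup>2 * (cmod (c k))\<^sup>2) + ennreal c0 * ennreal (\<Sum>k\<in>I. (cmod (c k))\<^sup>2) +
      ennreal (1 / pi) * (\<integral>\<^sup>+s. ennreal (?S s) \<partial>\<mu>)"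
    unfolding 2 by (intro add_mono mult_left_mono energy_le[OF I u_def] 1 order_refl) auto
  also have "\<dots> = ennreal (\<Sum>k\<in>I. \<psi> ((freq k)\<^sup>2) * (cmod (c k))\<^sup>2)"
    by (rule bernstein_weight_sum[OF I(1), symmetric]) auto
  finally show ?thesis .
qed

lemma gap_form_pos:
  assumes \<mu>: "emeasure \<mu> (space \<mu>) \<noteq> 0" and u: "u \<in> borel_measurable borel"
    and pos: "\<And>\<theta>. \<theta> > 0 \<Longrightarrow> tail \<theta> u > 0"
  shows "gap_form u > 0"
proof -
  note tail_measurable[OF u, measurable]
  have m: "(\<lambda>s. ennreal (sqrt s / 2 * tail (sqrt s) u)) \<in> borel_measurable \<mu>"
    by (rule borel_measurable_\<mu>) measurable
  have "(\<integral>\<^sup>+s. ennreal (sqrt s / 2 * tail (sqrt s) u) \<partial>\<mu>) \<noteq> 0"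
  proof
    assume "(\<integral>\<^sup>+s. ennreal (sqrt s / 2 * tail (sqrt s) u) \<partial>\<mu>) = 0"
    then have "AE s in \<mu>. ennreal (sqrt s / 2 * tail (sqrt s) u) = 0"
      by (simp only: nn_integral_0_iff_AE[OF m])
    moreover have "AE s in \<mu>. ennreal (sqrt s / 2 * tail (sqrt s) u) > 0"
    proof (rule AE_I2)
      fix s assume "s \<in> space \<mu>"
      then have "sqrt s > 0" by (simp add: space_\<mu>)
      then show "ennreal (sqrt s / 2 * tail (sqrt s) u) > 0"
        using pos[of "sqrt s"] by (intro ennreal_less_zero_iff[THEN iffD2] mult_pos_pos) auto
    qed
    ultimately have "AE s in \<mu>. False" by eventually_elim simp
    then show False using \<mu> by (simp add: eventually_False ae_filter_eq_bot_iff)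
  qed
  then show ?thesis unfolding gap_form_def
    by (simp add: ennreal_zero_less_mult_iff zero_less_iff_neq_zero)
qed

end

section \<open>The Courant-Fischer principle\<close>

text \<open>Fewer homogeneous equations than unknowns; each equation is removed by eliminating one
  unknown.\<close>

lemma exists_nontrivial_solution:
  fixes M :: "'i \<Rightarrow> nat \<Rightarrow> complex"
  assumes "finite I" "m < card I"
  shows "\<exists>c. (\<exists>i\<in>I. c i \<noteq> 0) \<and> (\<forall>j<m. (\<Sum>i\<in>I. c i * M i j) = 0)"
  using assms
proof (induction m arbitrary: I M)
  case 0
  then have "I \<noteq> {}" by auto
  then show ?case by (intro exI[of _ "\<lambda>_. 1"]) auto
next
  case (Suc m)
  show ?case
  proof (cases "\<forall>i\<in>I. M i m = 0")
    case True
    obtain c where c: "\<exists>i\<in>I. c i \<noteq> 0" "\<forall>j<m. (\<Sum>i\<in>I. c i * M i j) = 0"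
      using Suc.IH[of I M] Suc.prems by auto
    have "(\<Sum>i\<in>I. c i * M i j) = 0" if "j < Suc m" for j
      using that c(2) True by (cases "j = m") auto
    then show ?thesis using c(1) by (intro exI[of _ c]) auto
  next
    case False
    then obtain p where p: "p \<in> I" "M p m \<noteq> 0" by auto
    \<comment> \<open>Elimination with pivot p in column m; the reduced system omits the unknown
      p.\<close>
    define M' where "M' i j = M i j - M i m / M p m * M p j" for i j
    have "m < card (I - {p})" using Suc.prems p by simp
    then obtain c where c: "\<exists>i\<in>I - {p}. c i \<noteq> 0" "\<forall>j<m. (\<Sum>i\<in>I - {p}. c i * M' i j) = 0"
      using Suc.IH[of "I - {p}" M'] Suc.prems by auto
    \<comment> \<open>The value at p is the one that satisfies the eliminated equation m.\<close>
    define d where "d = c(p := - (\<Sum>i\<in>I - {p}. c i * (M i m / M p m)))"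
    have split: "(\<Sum>i\<in>I. d i * M i j) = (\<Sum>i\<in>I - {p}. c i * M i j) - (\<Sum>i\<in>I - {p}. c i * (M i m / M p m)) * M p j" for j
    proof -
      have "(\<Sum>i\<in>I. d i * M i j) = d p * M p j + (\<Sum>i\<in>I - {p}. d i * M i j)"
        using Suc.prems(1) p(1) by (rule sum.remove)
      also have "(\<Sum>i\<in>I - {p}. d i * M i j) = (\<Sum>i\<in>I - {p}. c i * M i j)"
        by (intro sum.cong) (auto simp: d_def)
      finally show ?thesis by (simp add: d_def)
    qed
    have "(\<Sum>i\<in>I. d i * M i j) = 0" if j: "j < Suc m" for j
    proof (cases "j = m")
      case True
      then show ?thesis unfolding split sum_distrib_right using p(2) by (simp add: mult.assoc)
    next
      case False
      then have "(\<Sum>i\<in>I - {p}. c i * M' i j) = 0" using c(2) j by auto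
      then show ?thesis unfolding split sum_distrib_right M'_def
        by (simp add: right_diff_distrib sum_subtractf mult.assoc)
    qed
    moreover have "\<exists>i\<in>I. d i \<noteq> 0" using c(1) by (auto simp: d_def)
    ultimately show ?thesis by (intro exI[of _ d]) auto
  qed
qed

text \<open>Bolzano-Weierstrass once per coordinate, intended for the finitely many low cosine
  coefficients of a minimising sequence.\<close>

lemma bounded_coordinates_convergent_subseq:
  fixes f :: "nat \<Rightarrow> nat \<Rightarrow> complex"
  assumes "\<And>j k. cmod (f j k) \<le> K"
  shows "\<exists>r. strict_mono r \<and> (\<forall>k<n. convergent (\<lambda>j. f (r j) k))"
proof (induction n)
  case 0
  show ?case by (intro exI[of _ id]) (auto simp: strict_mono_def)
next
  case (Suc n)
  then obtain r where r: "strict_mono r" "\<And>k. k < n \<Longrightarrow> convergent (\<lambda>j. f (r j) k)" by blast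
  have "bounded (range (\<lambda>j. f (r j) n))"
    using assms by (auto simp: bounded_iff)
  then obtain s l where s: "strict_mono s" "((\<lambda>j. f (r j) n) \<circ> s) \<longlonglongrightarrow> l"
    using bounded_imp_convergent_subsequence by metis
  have "convergent (\<lambda>j. f ((r \<circ> s) j) k)" if "k < Suc n" for k
  proof (cases "k = n")
    case True
    then show ?thesis using s(2) by (auto simp: convergent_def o_def)
  next
    case False
    then have "convergent ((\<lambda>j. f (r j) k) \<circ> s)"
      using that r(2) by (intro convergent_subseq_convergent s) auto
    then show ?thesis by (simp add: o_def)
  qed
  then show ?case using strict_mono_o[OF r(1) s(1)] by (intro exI[of _ "r \<circ> s"] conjI allI impI)
qed

lemma L2_inner_eq: "L2_inner = hinner lborel"
  by (simp add: fun_eq_iff L2_inner_def hinner_def)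

lemma L2_norm_eq: "L2_norm u = sqrt (sqnorm lborel u)"
  by (simp add: L2_norm_def sqnorm_def)

lemma L2_norm_eq_1_iff: "L2_norm u = 1 \<longleftrightarrow> sqnorm lborel u = 1"
  by (simp add: L2_norm_eq)

text \<open>A dimension count gives nontrivial coefficients meeting the m constraints. Independence
  modulo null sets makes the resulting function nonzero in norm, so that it can be
  normalised.\<close>

lemma subspace_contains_orthogonal_unit:
  assumes E: "L2_subspace_of_dim D n E" and m: "m < n"
    and f: "\<And>j. j < m \<Longrightarrow> square_integrable lborel (f j)"
  shows "\<exists>u\<in>E. sqnorm lborel u = 1 \<and> (\<forall>j<m. hinner lborel u (f j) = 0)"
proof -
  obtain e where e: "\<And>i. i < n \<Longrightarrow> e i \<in> L2_on D"
    and indep: "\<And>c. (AE x in lborel. (\<Sum>i<n. c i * e i x) = 0) \<Longrightarrow> \<forall>i<n. c i = 0"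
    and E_eq: "E = {u \<in> L2_on D. \<exists>c :: nat \<Rightarrow> complex. AE x in lborel. u x = (\<Sum>i<n. c i * e i x)}"
    using E unfolding L2_subspace_of_dim_def by blast
  obtain c where c: "\<exists>i\<in>{..<n}. c i \<noteq> 0" "\<forall>j<m. (\<Sum>i<n. c i * hinner lborel (e i) (f j)) = 0"
    using exists_nontrivial_solution[of "{..<n}" m "\<lambda>i j. hinner lborel (e i) (f j)"] m by auto
  define w where "w x = (\<Sum>i<n. c i * e i x)" for x
  have w: "w \<in> L2_on D" unfolding w_def[abs_def] by (intro L2_on_sum L2_on_scale e) simp
  note sw = L2_on_square_integrable[OF w]
  have "sqnorm lborel w \<noteq> 0"
  proof
    assume "sqnorm lborel w = 0"
    then have "AE x in lborel. w x = 0" using sqnorm_eq_0_iff[OF sw] by simp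
    then have "\<forall>i<n. c i = 0" unfolding w_def by (rule indep)
    then show False using c(1) by auto
  qed
  then have pos: "sqnorm lborel w > 0" by (simp add: less_le)
  define t where "t = complex_of_real (1 / sqrt (sqnorm lborel w))"
  define u where "u x = t * w x" for x
  have "u \<in> E"
    unfolding E_eq
  proof (intro CollectI conjI exI[of _ "\<lambda>i. t * c i"])
    show "u \<in> L2_on D" unfolding u_def[abs_def] by (rule L2_on_scale[OF w])
    show "AE x in lborel. u x = (\<Sum>i<n. t * c i * e i x)"
      by (simp add: u_def w_def sum_distrib_left mult.assoc)
  qed
  moreover have "sqnorm lborel u = 1"
    unfolding u_def sqnorm_scale using pos by (simp add: t_def norm_divide power_divide)
  moreover have "hinner lborel u (f j) = 0" if j: "j < m" for j
  proof -
    have "hinner lborel w (f j) = (\<Sum>i<n. c i * hinner lborel (e i) (f j))"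
      unfolding w_def by (rule hinner_sum_left) (auto intro: L2_on_square_integrable e f j)
    then show ?thesis unfolding u_def hinner_scale_left using c(2) j by simp
  qed
  ultimately show ?thesis by (intro bexI[of _ u]) auto
qed

lemma dirichlet_form_cong_AE:
  assumes "u \<in> L2_on D" "v \<in> L2_on D" "AE x in lborel. u x = v x"
  shows "dirichlet_form \<psi> u = dirichlet_form \<psi> v"
proof -
  have "fourier u = fourier v" using assms by (intro fourier_cong_AE) (auto simp: L2_on_def)
  then show ?thesis by (simp add: dirichlet_form_def)
qed

definition orthonormal :: "nat \<Rightarrow> (nat \<Rightarrow> real \<Rightarrow> complex) \<Rightarrow> bool" where
  "orthonormal n e \<longleftrightarrow> (\<forall>i<n. \<forall>j<n. hinner lborel (e i) (e j) = (if i = j then 1 else 0))"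

lemma orthonormal_subspace:
  assumes e: "\<And>i. i < n \<Longrightarrow> e i \<in> L2_on D" and on: "orthonormal n e"
  shows "L2_subspace_of_dim D n {u \<in> L2_on D. \<exists>c. AE x in lborel. u x = (\<Sum>i<n. c i * e i x)}"
  unfolding L2_subspace_of_dim_def
proof (intro exI[of _ e] conjI allI impI refl)
  fix c :: "nat \<Rightarrow> complex" and i
  assume AE: "AE x in lborel. (\<Sum>i<n. c i * e i x) = 0" and i: "i < n"
  have "square_integrable lborel (\<lambda>x. \<Sum>i<n. c i * e i x)"
    by (intro L2_on_square_integrable[where D = D] L2_on_sum L2_on_scale e) simp
  from sqnorm_eq_0_iff[OF this] AE have "sqnorm lborel (\<lambda>x. \<Sum>i<n. c i * e i x) = 0" by simp
  moreover have "sqnorm lborel (\<lambda>x. \<Sum>i<n. c i * e i x) = (\<Sum>i<n. (cmod (c i))\<^sup>2)"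
    using on by (intro sqnorm_orthonormal_sum) (auto simp: orthonormal_def intro: L2_on_square_integrable e)
  ultimately have "(\<Sum>i<n. (cmod (c i))\<^sup>2) = 0" by simp
  then show "c i = 0" using i by (subst (asm) sum_nonneg_eq_0_iff) auto
qed (use e in auto)

text \<open>The span of the family e is the trial space. Its members agree with linear combinations
  only almost everywhere, which the form cannot detect.\<close>

lemma dirichlet_eigenvalue_le:
  assumes e: "\<And>i. i < n \<Longrightarrow> e i \<in> L2_on D" and on: "orthonormal n e"
    and le: "\<And>c. (\<Sum>i<n. (cmod (c i))\<^sup>2) = 1 \<Longrightarrow> dirichlet_form \<psi> (\<lambda>x. \<Sum>i<n. c i * e i x) \<le> t"
  shows "dirichlet_eigenvalue \<psi> D n \<le> t"
  unfolding dirichlet_eigenvalue_def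
proof (rule INF_lower2)
  let ?E = "{u \<in> L2_on D. \<exists>c. AE x in lborel. u x = (\<Sum>i<n. c i * e i x)}"
  show "?E \<in> {E. L2_subspace_of_dim D n E}" using orthonormal_subspace[OF e on] by simp
  show "(SUP u\<in>{u \<in> ?E. L2_norm u = 1}. dirichlet_form \<psi> u) \<le> t"
  proof (rule SUP_least)
    fix u assume "u \<in> {u \<in> ?E. L2_norm u = 1}"
    then obtain c where u: "u \<in> L2_on D" "sqnorm lborel u = 1" and AE: "AE x in lborel. u x = (\<Sum>i<n. c i * e i x)"
      by (auto simp: L2_norm_eq_1_iff)
    have s: "(\<lambda>x. \<Sum>i<n. c i * e i x) \<in> L2_on D" by (intro L2_on_sum L2_on_scale e) simp
    have "sqnorm lborel u = sqnorm lborel (\<lambda>x. \<Sum>i<n. c i * e i x)"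
      by (rule sqnorm_cong_AE[OF _ _ AE]) (use u s in \<open>auto simp: L2_on_def\<close>)
    also have "\<dots> = (\<Sum>i<n. (cmod (c i))\<^sup>2)"
      using on by (intro sqnorm_orthonormal_sum) (auto simp: orthonormal_def intro: L2_on_square_integrable e)
    finally have "(\<Sum>i<n. (cmod (c i))\<^sup>2) = 1" using u by simp
    from le[OF this] show "dirichlet_form \<psi> u \<le> t"
      using dirichlet_form_cong_AE[OF u(1) s AE] by simp
  qed
qed

text \<open>Every trial space of dimension n contains a unit vector orthogonal to fewer than n
  prescribed functions, so a bound on such vectors bounds each supremum and hence their
  infimum.\<close>

lemma dirichlet_eigenvalue_ge:
  assumes n: "m < n" and f: "\<And>j. j < m \<Longrightarrow> square_integrable lborel (f j)"
    and ge: "\<And>u. u \<in> L2_on D \<Longrightarrow> sqnorm lborel u = 1 \<Longrightarrow> (\<And>j. j < m \<Longrightarrow> hinner lborel u (f j) = 0) \<Longrightarrow> t \<le> dirichlet_form \<psi> u"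
  shows "t \<le> dirichlet_eigenvalue \<psi> D n"
  unfolding dirichlet_eigenvalue_def
proof (rule INF_greatest)
  fix E assume "E \<in> {E. L2_subspace_of_dim D n E}"
  then have E: "L2_subspace_of_dim D n E" by simp
  obtain u where u: "u \<in> E" "sqnorm lborel u = 1" "\<forall>j<m. hinner lborel u (f j) = 0"
    using subspace_contains_orthogonal_unit[OF E n, of f] f by blast
  have "u \<in> L2_on D" using u(1) E by (auto simp: L2_subspace_of_dim_def)
  then have "t \<le> dirichlet_form \<psi> u" using u by (intro ge) auto
  also have "\<dots> \<le> (SUP u\<in>{u \<in> E. L2_norm u = 1}. dirichlet_form \<psi> u)"
    using u by (intro SUP_upper) (simp add: L2_norm_eq_1_iff)
  finally show "t \<le> (SUP u\<in>{u \<in> E. L2_norm u = 1}. dirichlet_form \<psi> u)" .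
qed

context bernstein_interval begin

section \<open>The form as a Hilbert space structure\<close>

abbreviation domain :: "(real \<Rightarrow> complex) set" where
  "domain \<equiv> form_domain \<psi> {a<..<b}"

text \<open>With \<psi> absorbed into the measure, the form is the squared norm of the Fourier
  transform, and the inner product lemmas for general measures apply to it.\<close>

definition weight :: "real measure" where
  "weight = density lborel (\<lambda>\<xi>. ennreal (1 / (2 * pi) * \<psi> (\<xi>\<^sup>2)))"

definition sesq :: "(real \<Rightarrow> complex) \<Rightarrow> (real \<Rightarrow> complex) \<Rightarrow> complex" where
  "sesq u v = hinner weight (fourier u) (fourier v)"

definition form :: "(real \<Rightarrow> complex) \<Rightarrow> real" where
  "form u = sqnorm weight (fourier u)"

lemma \<psi>_square_measurable [measurable]: "(\<lambda>\<xi>. \<psi> (\<xi>\<^sup>2)) \<in> borel_measurable borel"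
proof -
  \<comment> \<open>\<psi> is constrained only on the half-line, so measurability is derived from a
    monotone extension that agrees with it there.\<close>
  have "mono (\<lambda>x. \<psi> (max 0 x))" by (intro monoI \<psi>_mono) auto
  then have [measurable]: "(\<lambda>x. \<psi> (max 0 x)) \<in> borel_measurable borel" by (rule borel_measurable_mono)
  have "(\<lambda>\<xi>::real. \<psi> (max 0 (\<xi>\<^sup>2))) \<in> borel_measurable borel" by measurable
  then show ?thesis by (simp add: max_def)
qed

lemma sets_weight [measurable_cong]: "sets weight = sets borel"
  by (simp add: weight_def)

lemma fourier_measurable_weight:
  "u \<in> L2_on D \<Longrightarrow> fourier u \<in> borel_measurable weight"
  using fourier_measurable[of u] by (simp add: L2_on_def measurable_cong_sets[OF sets_weight refl])

lemma dirichlet_form_eq_nn_integral: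
  assumes u: "u \<in> L2_on {a<..<b}"
  shows "dirichlet_form \<psi> u = (\<integral>\<^sup>+\<xi>. ennreal ((cmod (fourier u \<xi>))\<^sup>2) \<partial>weight)"
proof -
  have [measurable]: "u \<in> borel_measurable borel" by (rule L2_on_measurable[OF u])
  have "(\<integral>\<^sup>+\<xi>. ennreal ((cmod (fourier u \<xi>))\<^sup>2) \<partial>weight) =
      (\<integral>\<^sup>+\<xi>. ennreal (1 / (2 * pi) * \<psi> (\<xi>\<^sup>2)) * ennreal ((cmod (fourier u \<xi>))\<^sup>2) \<partial>lborel)"
    unfolding weight_def by (rule nn_integral_density) measurable
  also have "\<dots> = (\<integral>\<^sup>+\<xi>. ennreal (1 / (2 * pi)) * ennreal (\<psi> (\<xi>\<^sup>2) * (cmod (fourier u \<xi>))\<^sup>2) \<partial>lborel)"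
    by (intro nn_integral_cong) (simp add: ennreal_mult[symmetric] \<psi>_nonneg)
  also have "\<dots> = dirichlet_form \<psi> u"
    unfolding dirichlet_form_def by (rule nn_integral_cmult) measurable
  finally show ?thesis by (rule sym)
qed

lemma domain_iff: "u \<in> domain \<longleftrightarrow> u \<in> L2_on {a<..<b} \<and> square_integrable weight (fourier u)"
proof -
  have "dirichlet_form \<psi> u < \<infinity> \<longleftrightarrow> square_integrable weight (fourier u)" if u: "u \<in> L2_on {a<..<b}"
    using square_integrable_if_nn_integral[OF fourier_measurable_weight[OF u]] nn_integral_cmod_square[of weight "fourier u"]
    unfolding dirichlet_form_eq_nn_integral[OF u] by auto
  then show ?thesis by (auto simp: form_domain_def)
qed

lemma domain_L2_on: "u \<in> domain \<Longrightarrow> u \<in> L2_on {a<..<b}"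
  by (simp add: domain_iff)

lemma domain_square_integrable: "u \<in> domain \<Longrightarrow> square_integrable lborel u"
  by (rule L2_on_square_integrable[OF domain_L2_on])

lemma domain_weight: "u \<in> domain \<Longrightarrow> square_integrable weight (fourier u)"
  by (simp add: domain_iff)

lemma dirichlet_form_eq_form: "u \<in> domain \<Longrightarrow> dirichlet_form \<psi> u = ennreal (form u)"
  by (simp add: domain_iff dirichlet_form_eq_nn_integral nn_integral_cmod_square form_def)

lemma dirichlet_sesq_eq_sesq:
  assumes u: "u \<in> domain" and v: "v \<in> domain"
  shows "dirichlet_sesq \<psi> u v = sesq u v"
proof -
  have [measurable]: "fourier u \<in> borel_measurable borel" "fourier v \<in> borel_measurable borel"
    using domain_L2_on[OF u] domain_L2_on[OF v] by (auto simp: L2_on_def intro: fourier_measurable)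
  have [measurable]: "cnj \<in> borel_measurable borel"
    by (intro borel_measurable_continuous_onI continuous_intros)
  have "sesq u v = (\<integral>\<xi>. (1 / (2 * pi) * \<psi> (\<xi>\<^sup>2)) *\<^sub>R (fourier u \<xi> * cnj (fourier v \<xi>)) \<partial>lborel)"
    unfolding sesq_def hinner_def weight_def
    by (rule integral_density) (auto intro!: AE_I2 divide_nonneg_pos \<psi>_nonneg)
  also have "\<dots> = (\<integral>\<xi>. complex_of_real (1 / (2 * pi)) * (complex_of_real (\<psi> (\<xi>\<^sup>2)) * fourier u \<xi> * cnj (fourier v \<xi>)) \<partial>lborel)"
    by (rule Bochner_Integration.integral_cong[OF refl]) (simp add: scaleR_conv_of_real)
  also have "\<dots> = dirichlet_sesq \<psi> u v"
    unfolding dirichlet_sesq_def by (rule integral_mult_right_zero)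
  finally show ?thesis by (rule sym)
qed

lemma fourier_add_fun:
  assumes "u \<in> L2_on {a<..<b}" "v \<in> L2_on {a<..<b}"
  shows "fourier (\<lambda>x. u x + v x) = (\<lambda>\<xi>. fourier u \<xi> + fourier v \<xi>)"
  by (rule ext) (intro fourier_add L2_on_integrable assms)

lemma fourier_scale_fun: "fourier (\<lambda>x. c * u x) = (\<lambda>\<xi>. c * fourier u \<xi>)"
  by (rule ext) (rule fourier_scale)

lemma fourier_diff_fun:
  assumes "u \<in> L2_on {a<..<b}" "v \<in> L2_on {a<..<b}"
  shows "fourier (\<lambda>x. u x - v x) = (\<lambda>\<xi>. fourier u \<xi> - fourier v \<xi>)"
  using fourier_add_fun[OF assms(1) L2_on_scale[OF assms(2), of "-1"]] fourier_scale_fun[of "-1" v] by simp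

lemma domain_add: "u \<in> domain \<Longrightarrow> v \<in> domain \<Longrightarrow> (\<lambda>x. u x + v x) \<in> domain"
  by (simp add: domain_iff fourier_add_fun L2_on_add square_integrable_add)

lemma domain_scale: "u \<in> domain \<Longrightarrow> (\<lambda>x. c * u x) \<in> domain"
  by (simp add: domain_iff fourier_scale_fun L2_on_scale square_integrable_scale)

lemma domain_diff: "u \<in> domain \<Longrightarrow> v \<in> domain \<Longrightarrow> (\<lambda>x. u x - v x) \<in> domain"
  by (simp add: domain_iff fourier_diff_fun L2_on_diff square_integrable_diff)

lemma domain_zero: "(\<lambda>x. 0) \<in> domain"
  by (simp add: domain_iff fourier_def[abs_def])

lemma domain_sum: "(\<And>i. i \<in> I \<Longrightarrow> f i \<in> domain) \<Longrightarrow> (\<lambda>x. \<Sum>i\<in>I. f i x) \<in> domain"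
  by (induction I rule: infinite_finite_induct) (auto intro: domain_add domain_zero)

lemma fourier_sum_fun:
  assumes "\<And>i. i \<in> I \<Longrightarrow> f i \<in> L2_on {a<..<b}"
  shows "fourier (\<lambda>x. \<Sum>i\<in>I. c i * f i x) = (\<lambda>\<xi>. \<Sum>i\<in>I. c i * fourier (f i) \<xi>)"
  using assms
proof (induction I rule: infinite_finite_induct)
  case (insert i I)
  then show ?case
    by (simp add: fourier_add_fun fourier_scale_fun L2_on_scale L2_on_sum)
qed (auto simp: fourier_def)

lemma sesq_cnj: "cnj (sesq u v) = sesq v u"
  unfolding sesq_def by (rule hinner_cnj)

lemma sesq_self: "sesq u u = complex_of_real (form u)"
  unfolding sesq_def form_def by (rule hinner_self)

lemma sesq_add_right: "u \<in> domain \<Longrightarrow> v \<in> domain \<Longrightarrow> w \<in> domain \<Longrightarrow> sesq w (\<lambda>x. u x + v x) = sesq w u + sesq w v"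
  unfolding sesq_def by (simp add: fourier_add_fun domain_L2_on hinner_add_right domain_weight)

lemma sesq_diff_left: "u \<in> domain \<Longrightarrow> v \<in> domain \<Longrightarrow> w \<in> domain \<Longrightarrow> sesq (\<lambda>x. u x - v x) w = sesq u w - sesq v w"
  unfolding sesq_def by (simp add: fourier_diff_fun domain_L2_on hinner_diff_left domain_weight)

lemma sesq_scale_left: "sesq (\<lambda>x. c * u x) w = c * sesq u w"
  unfolding sesq_def fourier_scale_fun by (rule hinner_scale_left)

lemma sesq_scale_right: "sesq w (\<lambda>x. c * u x) = cnj c * sesq w u"
  unfolding sesq_def fourier_scale_fun by (rule hinner_scale_right)

lemma sesq_sum_left:
  assumes "\<And>i. i \<in> I \<Longrightarrow> f i \<in> domain" "w \<in> domain"
  shows "sesq (\<lambda>x. \<Sum>i\<in>I. c i * f i x) w = (\<Sum>i\<in>I. c i * sesq (f i) w)"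
proof -
  have eq: "fourier (\<lambda>x. \<Sum>i\<in>I. c i * f i x) = (\<lambda>\<xi>. \<Sum>i\<in>I. c i * fourier (f i) \<xi>)"
    by (rule fourier_sum_fun) (intro domain_L2_on assms)
  show ?thesis
    unfolding sesq_def eq by (rule hinner_sum_left) (simp_all add: domain_weight assms)
qed

lemma sesq_sum_right:
  assumes "\<And>i. i \<in> I \<Longrightarrow> f i \<in> domain" "w \<in> domain"
  shows "sesq w (\<lambda>x. \<Sum>i\<in>I. c i * f i x) = (\<Sum>i\<in>I. cnj (c i) * sesq w (f i))"
proof -
  have eq: "fourier (\<lambda>x. \<Sum>i\<in>I. c i * f i x) = (\<lambda>\<xi>. \<Sum>i\<in>I. c i * fourier (f i) \<xi>)"
    by (rule fourier_sum_fun) (intro domain_L2_on assms)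
  show ?thesis
    unfolding sesq_def eq by (rule hinner_sum_right) (simp_all add: domain_weight assms)
qed

lemma form_nonneg [simp]: "0 \<le> form u"
  by (simp add: form_def)

lemma form_scale: "form (\<lambda>x. c * u x) = (cmod c)\<^sup>2 * form u"
  unfolding form_def fourier_scale_fun by (rule sqnorm_scale)

lemma form_add: "u \<in> domain \<Longrightarrow> v \<in> domain \<Longrightarrow> form (\<lambda>x. u x + v x) = form u + 2 * Re (sesq u v) + form v"
  unfolding form_def sesq_def by (simp add: fourier_add_fun domain_L2_on sqnorm_add domain_weight)

lemma form_diff: "u \<in> domain \<Longrightarrow> v \<in> domain \<Longrightarrow> form (\<lambda>x. u x - v x) = form u - 2 * Re (sesq u v) + form v"
  unfolding form_def sesq_def by (simp add: fourier_diff_fun domain_L2_on sqnorm_diff domain_weight)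

lemma form_triangle: "u \<in> domain \<Longrightarrow> v \<in> domain \<Longrightarrow> sqrt (form (\<lambda>x. u x + v x)) \<le> sqrt (form u) + sqrt (form v)"
  unfolding form_def by (simp add: fourier_add_fun domain_L2_on sqnorm_triangle domain_weight)

section \<open>Bounds for the eigenvalues\<close>

abbreviation level :: "nat \<Rightarrow> real" where
  "level k \<equiv> \<psi> ((freq k)\<^sup>2)"

abbreviation nontrivial :: bool where
  "nontrivial \<equiv> emeasure \<mu> (space \<mu>) \<noteq> 0"

lemma freq_square_mono: "j \<le> k \<Longrightarrow> (freq j)\<^sup>2 \<le> (freq k)\<^sup>2"
  using a_less_b unfolding freq_def by (intro power_mono divide_right_mono mult_right_mono) auto

lemma freq_square_strict_mono: "j < k \<Longrightarrow> (freq j)\<^sup>2 < (freq k)\<^sup>2"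
  using a_less_b unfolding freq_def by (intro power_strict_mono divide_strict_right_mono mult_strict_right_mono) auto

lemma level_nonneg: "0 \<le> level k"
  by (rule \<psi>_nonneg) simp

lemma level_mono: "j \<le> k \<Longrightarrow> level j \<le> level k"
  by (rule \<psi>_mono) (auto intro: freq_square_mono)

lemma level_strict_mono: "nontrivial \<Longrightarrow> j < k \<Longrightarrow> level j < level k"
  by (rule \<psi>_strict_mono) (auto intro: freq_square_strict_mono)

text \<open>Only cosine coefficients with index at least m remain, all with weight at least
  \<open>level m\<close>, and Parseval sums them. The gap is retained for the strict lower
  bound.\<close>

lemma dirichlet_form_ge_level:
  assumes u: "u \<in> L2_on {a<..<b}" and orth: "\<And>j. j < m \<Longrightarrow> coef u j = 0"
  shows "ennreal (level m * sqnorm lborel u) + gap_form u \<le> dirichlet_form \<psi> u"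
proof (rule LIMSEQ_le_const2)
  have "(\<lambda>N. \<Sum>k<N. (cmod (coef u k))\<^sup>2) \<longlonglongrightarrow> sqnorm lborel u"
    using cosb_parseval[OF u] by (simp add: sums_def)
  then show "(\<lambda>N. ennreal (level m * (\<Sum>k<N. (cmod (coef u k))\<^sup>2)) + gap_form u) \<longlonglongrightarrow>
      ennreal (level m * sqnorm lborel u) + gap_form u"
    by (intro tendsto_add tendsto_ennrealI tendsto_mult tendsto_const)
  have "ennreal (level m * (\<Sum>k<N. (cmod (coef u k))\<^sup>2)) + gap_form u \<le> dirichlet_form \<psi> u" for N
  proof -
    have "level m * (\<Sum>k<N. (cmod (coef u k))\<^sup>2) \<le> (\<Sum>k<N. level k * (cmod (coef u k))\<^sup>2)"
      unfolding sum_distrib_left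
    proof (rule sum_mono)
      fix k
      show "level m * (cmod (coef u k))\<^sup>2 \<le> level k * (cmod (coef u k))\<^sup>2"
        using orth[of k] level_mono[of m k] by (cases "k < m") (auto intro: mult_right_mono)
    qed
    then have "ennreal (level m * (\<Sum>k<N. (cmod (coef u k))\<^sup>2)) + gap_form u \<le>
        ennreal (\<Sum>k<N. level k * (cmod (coef u k))\<^sup>2) + gap_form u"
      by (intro add_right_mono ennreal_leI)
    also have "\<dots> \<le> dirichlet_form \<psi> u" by (rule dirichlet_form_ge[OF u])
    finally show ?thesis .
  qed
  then show "\<exists>N'. \<forall>N\<ge>N'. ennreal (level m * (\<Sum>k<N. (cmod (coef u k))\<^sup>2)) + gap_form u \<le> dirichlet_form \<psi> u"
    by blast
qed

text \<open>The n - 1 constraints remove the cosines with indices 0 to n - 2; as cosines are counted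
  from 0, the lowest remaining level is n - 1.\<close>

lemma eigenvalue_ge_level:
  assumes n: "n \<ge> 1"
  shows "ennreal (level (n - 1)) \<le> dirichlet_eigenvalue \<psi> {a<..<b} n"
proof (rule dirichlet_eigenvalue_ge[where m = "n - 1" and f = cosb])
  fix u assume u: "u \<in> L2_on {a<..<b}" "sqnorm lborel u = 1" "\<And>j. j < n - 1 \<Longrightarrow> coef u j = 0"
  have "ennreal (level (n - 1)) = ennreal (level (n - 1) * sqnorm lborel u)" using u by simp
  also have "\<dots> \<le> ennreal (level (n - 1) * sqnorm lborel u) + gap_form u" by simp
  also have "\<dots> \<le> dirichlet_form \<psi> u" by (rule dirichlet_form_ge_level[OF u(1,3)])
  finally show "ennreal (level (n - 1)) \<le> dirichlet_form \<psi> u" .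
qed (use n in auto)

text \<open>A shift of index: sines are counted from 1, trial coefficients from 0.\<close>

lemma sine_sum_form_le:
  "dirichlet_form \<psi> (\<lambda>x. \<Sum>i<n. c i * sinb (Suc i) x) \<le> ennreal (\<Sum>i<n. level (Suc i) * (cmod (c i))\<^sup>2)"
proof -
  have "(\<lambda>x. \<Sum>i<n. c i * sinb (Suc i) x) = (\<lambda>x. \<Sum>k\<in>{1..n}. c (k - 1) * sinb k x)"
    by (simp add: sum.atLeast1_atMost_eq)
  from dirichlet_form_le[OF _ _ this]
  have "dirichlet_form \<psi> (\<lambda>x. \<Sum>i<n. c i * sinb (Suc i) x) + gap_form (\<lambda>x. \<Sum>i<n. c i * sinb (Suc i) x) \<le>
      ennreal (\<Sum>k\<in>{1..n}. level k * (cmod (c (k - 1)))\<^sup>2)" by simp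
  then have "dirichlet_form \<psi> (\<lambda>x. \<Sum>i<n. c i * sinb (Suc i) x) \<le> ennreal (\<Sum>k\<in>{1..n}. level k * (cmod (c (k - 1)))\<^sup>2)"
    by (rule order_trans[rotated]) simp
  then show ?thesis by (simp add: sum.atLeast1_atMost_eq)
qed

lemma sine_sum_in_domain: "(\<lambda>x. \<Sum>i<n. c i * sinb (Suc i) x) \<in> domain"
proof -
  have "(\<lambda>x. \<Sum>i<n. c i * sinb (Suc i) x) \<in> L2_on {a<..<b}"
    by (intro L2_on_sum L2_on_scale) simp
  moreover have "dirichlet_form \<psi> (\<lambda>x. \<Sum>i<n. c i * sinb (Suc i) x) < \<infinity>"
    by (rule le_less_trans[OF sine_sum_form_le]) simp
  ultimately show ?thesis by (simp add: form_domain_def)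
qed

lemma form_sine_sum_le: "form (\<lambda>x. \<Sum>i<n. c i * sinb (Suc i) x) \<le> (\<Sum>i<n. level (Suc i) * (cmod (c i))\<^sup>2)"
proof -
  have "0 \<le> (\<Sum>i<n. level (Suc i) * (cmod (c i))\<^sup>2)" by (intro sum_nonneg mult_nonneg_nonneg level_nonneg) simp
  then show ?thesis
    using sine_sum_form_le[of c n] by (simp only: dirichlet_form_eq_form[OF sine_sum_in_domain] ennreal_le_iff)
qed

lemma orthonormal_sinb: "orthonormal n (\<lambda>i. sinb (Suc i))"
  by (auto simp: orthonormal_def hinner_sinb)

lemma eigenvalue_le_level: "dirichlet_eigenvalue \<psi> {a<..<b} n \<le> ennreal (level n)"
proof (rule dirichlet_eigenvalue_le[OF _ orthonormal_sinb])
  fix c :: "nat \<Rightarrow> complex" assume c: "(\<Sum>i<n. (cmod (c i))\<^sup>2) = 1"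
  have "(\<Sum>i<n. level (Suc i) * (cmod (c i))\<^sup>2) \<le> (\<Sum>i<n. level n * (cmod (c i))\<^sup>2)"
    by (intro sum_mono mult_right_mono level_mono) auto
  also have "\<dots> = level n" by (simp add: sum_distrib_left[symmetric] c)
  finally show "dirichlet_form \<psi> (\<lambda>x. \<Sum>i<n. c i * sinb (Suc i) x) \<le> ennreal (level n)"
    by (intro order_trans[OF sine_sum_form_le] ennreal_leI)
qed simp

lemma sinb_in_domain: "sinb (Suc p) \<in> domain"
  using sine_sum_in_domain[of "\<lambda>i. if i = p then 1 else 0" "Suc p"] by simp

lemma form_sinb_less:
  assumes "nontrivial"
  shows "form (sinb (Suc p)) < level (Suc p)"
proof -
  have "sinb (Suc p) = (\<lambda>x. \<Sum>k\<in>{Suc p}. 1 * sinb k x)" by simp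
  from dirichlet_form_le[OF _ _ this]
  have le: "ennreal (form (sinb (Suc p))) + gap_form (sinb (Suc p)) \<le> ennreal (level (Suc p))"
    by (simp add: dirichlet_form_eq_form[OF sinb_in_domain])
  have pos: "gap_form (sinb (Suc p)) > 0"
    by (rule gap_form_pos[OF assms sinb_measurable]) (simp add: tail_sinb_pos)
  show ?thesis
  proof (cases "gap_form (sinb (Suc p))")
    case (real g)
    then have "g > 0" using pos by simp
    have "ennreal (form (sinb (Suc p)) + g) \<le> ennreal (level (Suc p))"
      using le real by (simp add: ennreal_plus)
    then have "form (sinb (Suc p)) + g \<le> level (Suc p)" by (simp add: ennreal_le_iff level_nonneg)
    then show ?thesis using \<open>g > 0\<close> by linarith
  next
    case top
    then show ?thesis using le by (simp add: top_unique)
  qed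
qed

text \<open>Trial functions in the span of the first \<open>n\<close> sines whose form is close to the weak bound are
  close to the \<open>n\<close>-th sine, and there the gap between the form and the weak bound is positive.\<close>

lemma eigenvalue_less_level:
  assumes nt: "nontrivial" and n: "n \<ge> 1"
  shows "dirichlet_eigenvalue \<psi> {a<..<b} n < ennreal (level n)"
proof -
  obtain p where p: "n = Suc p" using n by (cases n) auto
  define E where "E = form (sinb n)"
  define P where "P = level n"
  define q where "q = level p"
  have q: "0 \<le> q" "q < P" using level_strict_mono[OF nt, of p n] by (auto simp: q_def P_def p level_nonneg)
  then have P: "P > 0" by linarith
  have E: "0 \<le> E" "E < P" using form_sinb_less[OF nt, of p] by (auto simp: E_def P_def p)
  \<comment> \<open>Half the room between the square roots of E and P. The threshold t0 below is
    chosen so that sqrt (P * t0) equals \<delta>.\<close>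
  define \<delta> where "\<delta> = (sqrt P - sqrt E) / 2"
  have \<delta>: "\<delta> > 0" using E by (simp add: \<delta>_def)
  define t0 where "t0 = \<delta>\<^sup>2 / P"
  have t0: "t0 > 0" using \<delta> P by (simp add: t0_def)
  define T where "T = max (P - (P - q) * t0) ((\<delta> + sqrt E)\<^sup>2)"
  have "\<delta> + sqrt E < sqrt P" using E by (simp add: \<delta>_def field_simps)
  then have "(\<delta> + sqrt E)\<^sup>2 < (sqrt P)\<^sup>2" using \<delta> E by (intro power_strict_mono) auto
  moreover have "(P - q) * t0 > 0" using q t0 by simp
  ultimately have T: "T < P" using P by (simp add: T_def)
  have "dirichlet_eigenvalue \<psi> {a<..<b} n \<le> ennreal T"
  proof (rule dirichlet_eigenvalue_le[OF _ orthonormal_sinb])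
    fix c :: "nat \<Rightarrow> complex" assume "(\<Sum>i<n. (cmod (c i))\<^sup>2) = 1"
    then have c: "(\<Sum>i<p. (cmod (c i))\<^sup>2) + (cmod (c p))\<^sup>2 = 1" by (simp add: p)
    define t where "t = (\<Sum>i<p. (cmod (c i))\<^sup>2)"
    have t: "0 \<le> t" "(cmod (c p))\<^sup>2 = 1 - t" using c by (auto simp: t_def sum_nonneg)
    let ?u = "\<lambda>x. \<Sum>i<n. c i * sinb (Suc i) x" and ?v = "\<lambda>x. \<Sum>i<p. c i * sinb (Suc i) x"
    have S: "(\<Sum>i<p. level (Suc i) * (cmod (c i))\<^sup>2) \<le> q * t"
      unfolding t_def sum_distrib_left q_def by (intro sum_mono mult_right_mono level_mono) auto
    have "form ?u \<le> T"
    proof (cases "t0 \<le> t")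
      case True
      \<comment> \<open>At least t0 of the mass lies on the lower sines, whose levels are at most q
        < P; this already lowers the weak bound.\<close>
      have "form ?u \<le> (\<Sum>i<p. level (Suc i) * (cmod (c i))\<^sup>2) + P * (cmod (c p))\<^sup>2"
        using form_sine_sum_le[of c n] by (simp add: p P_def)
      also have "\<dots> \<le> P - (P - q) * t" using S by (simp add: t algebra_simps)
      also have "\<dots> \<le> P - (P - q) * t0" using True q by (intro diff_left_mono mult_left_mono) auto
      finally show ?thesis by (simp add: T_def)
    next
      case False
      \<comment> \<open>Nearly all mass lies on the n-th sine. The triangle inequality for the
        square root of the form then stays below \<delta> + sqrt E, which is less than sqrt
        P.\<close>
      have v: "form ?v \<le> P * t0"
      proof -
        have "form ?v \<le> q * t" using form_sine_sum_le[of c p] S by linarith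
        also have "\<dots> \<le> P * t0" using False q t P by (intro mult_mono) auto
        finally show ?thesis .
      qed
      have s: "form (\<lambda>x. c p * sinb n x) \<le> E"
        unfolding form_scale E_def[symmetric] t(2) using E t by (simp add: mult_left_le_one_le algebra_simps)
      have "?u = (\<lambda>x. ?v x + c p * sinb n x)" by (simp add: p)
      then have "sqrt (form ?u) \<le> sqrt (form ?v) + sqrt (form (\<lambda>x. c p * sinb n x))"
        using form_triangle[OF sine_sum_in_domain[of c p] domain_scale[OF sinb_in_domain[of p], of "c p"]] by (simp add: p)
      also have "\<dots> \<le> sqrt (P * t0) + sqrt E" using v s by (intro add_mono real_sqrt_le_mono)
      also have "P * t0 = \<delta>\<^sup>2" using P by (simp add: t0_def)
      finally have "sqrt (form ?u) \<le> \<delta> + sqrt E" using \<delta> by simp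
      then have "(sqrt (form ?u))\<^sup>2 \<le> (\<delta> + sqrt E)\<^sup>2" by (intro power_mono) auto
      then show ?thesis by (simp add: T_def)
    qed
    then show "dirichlet_form \<psi> ?u \<le> ennreal T"
      by (simp only: dirichlet_form_eq_form[OF sine_sum_in_domain] ennreal_leI)
  qed simp
  also have "\<dots> < ennreal (level n)" using T P by (simp add: ennreal_less_iff P_def[symmetric] ennreal_lessI)
  finally show ?thesis .
qed

section \<open>Lower semicontinuity of the form\<close>

lemma cmod_fourier_le_sqnorm:
  assumes u: "u \<in> L2_on {a<..<b}"
  shows "(cmod (fourier u \<xi>))\<^sup>2 \<le> sqnorm lborel u * (b - a)"
proof -
  have [measurable]: "u \<in> borel_measurable borel" by (rule L2_on_measurable[OF u])
  have [measurable]: "cnj \<in> borel_measurable borel"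
    by (intro borel_measurable_continuous_onI continuous_intros)
  define e where "e x = exp (\<i> * complex_of_real (\<xi> * x)) * complex_of_real (indicator {a..b} x)" for x
  have [measurable]: "e \<in> borel_measurable borel" unfolding e_def[abs_def] by measurable
  have norm_e: "cmod (e x) = indicator {a..b} x" for x
    unfolding e_def norm_mult norm_exp_i_times by simp
  have se: "square_integrable lborel e"
    by (rule square_integrable_bounded[where M = 1]) (auto simp: norm_e)
  have "fourier u \<xi> = hinner lborel u e"
    unfolding fourier_def hinner_def
  proof (rule integral_cong_AE)
    have "AE x in lborel. x \<notin> {a<..<b} \<longrightarrow> u x = 0" using u by (simp add: L2_on_def)
    then show "AE x in lborel. exp (- (\<i> * complex_of_real (\<xi> * x))) * u x = u x * cnj (e x)"
    proof eventually_elim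
      case (elim x)
      then show ?case by (cases "x \<in> {a..b}") (auto simp: e_def exp_cnj)
    qed
  qed measurable
  then have "(cmod (fourier u \<xi>))\<^sup>2 \<le> sqnorm lborel u * sqnorm lborel e"
    using hinner_Cauchy_Schwarz[OF L2_on_square_integrable[OF u] se] by simp
  also have "sqnorm lborel e = b - a"
    unfolding sqnorm_def norm_e using a_less_b by (simp add: power2_eq_square indicator_inter_arith[symmetric])
  finally show ?thesis .
qed

text \<open>On a bounded interval, convergence in L^2 makes the Fourier transforms converge at every
  point by Cauchy-Schwarz; Fatou's lemma for \<open>weight\<close> does the rest.\<close>

lemma dirichlet_form_lsc:
  assumes w: "\<And>j. w j \<in> L2_on {a<..<b}" and g: "g \<in> L2_on {a<..<b}"
    and lim: "(\<lambda>j. sqnorm lborel (\<lambda>x. w j x - g x)) \<longlonglongrightarrow> 0"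
    and le: "\<And>j. dirichlet_form \<psi> (w j) \<le> ennreal (l + e j)" and e: "e \<longlonglongrightarrow> 0"
  shows "dirichlet_form \<psi> g \<le> ennreal l"
proof -
  have F: "(\<lambda>j. fourier (w j) \<xi>) \<longlonglongrightarrow> fourier g \<xi>" for \<xi>
  proof -
    have "(\<lambda>j. sqrt (sqnorm lborel (\<lambda>x. w j x - g x) * (b - a))) \<longlonglongrightarrow> sqrt (0 * (b - a))"
      by (intro tendsto_intros lim)
    then have "(\<lambda>j. sqrt (sqnorm lborel (\<lambda>x. w j x - g x) * (b - a))) \<longlonglongrightarrow> 0" by simp
    then have "(\<lambda>j. fourier (w j) \<xi> - fourier g \<xi>) \<longlonglongrightarrow> 0"
    proof (rule Lim_null_comparison[rotated], intro always_eventually allI)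
      fix j
      show "norm (fourier (w j) \<xi> - fourier g \<xi>) \<le> sqrt (sqnorm lborel (\<lambda>x. w j x - g x) * (b - a))"
        using cmod_fourier_le_sqnorm[OF L2_on_diff[OF w[of j] g], of \<xi>]
        by (intro real_le_rsqrt) (simp add: fourier_diff_fun[OF w g])
    qed
    then show ?thesis by (simp add: LIM_zero_iff)
  qed
  have "dirichlet_form \<psi> g = (\<integral>\<^sup>+\<xi>. liminf (\<lambda>j. ennreal ((cmod (fourier (w j) \<xi>))\<^sup>2)) \<partial>weight)"
    unfolding dirichlet_form_eq_nn_integral[OF g]
    by (intro nn_integral_cong lim_imp_Liminf[OF trivial_limit_sequentially, symmetric] tendsto_ennrealI tendsto_intros F)
  also have "\<dots> \<le> liminf (\<lambda>j. \<integral>\<^sup>+\<xi>. ennreal ((cmod (fourier (w j) \<xi>))\<^sup>2) \<partial>weight)"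
  proof (rule nn_integral_liminf)
    fix j
    have [measurable]: "fourier (w j) \<in> borel_measurable weight" by (rule fourier_measurable_weight[OF w])
    show "(\<lambda>\<xi>. ennreal ((cmod (fourier (w j) \<xi>))\<^sup>2)) \<in> borel_measurable weight" by measurable
  qed
  also have "\<dots> = liminf (\<lambda>j. dirichlet_form \<psi> (w j))"
    by (simp only: dirichlet_form_eq_nn_integral[OF w])
  also have "\<dots> \<le> liminf (\<lambda>j. ennreal (l + e j))"
    by (intro Liminf_mono always_eventually allI le)
  also have "(\<lambda>j. ennreal (l + e j)) \<longlonglongrightarrow> ennreal (l + 0)" by (intro tendsto_ennrealI tendsto_intros e)
  then have "liminf (\<lambda>j. ennreal (l + e j)) = ennreal l"
    using lim_imp_Liminf[OF trivial_limit_sequentially] by fastforce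
  finally show ?thesis .
qed

section \<open>Eigenfunctions and simplicity\<close>

text \<open>The last clause, minimality of \<open>l i\<close> on the complement of the earlier
  vectors, is what identifies \<open>l i\<close> with a minimax value. Indices start at 0, so
  \<open>l i\<close> is the eigenvalue with number i + 1.\<close>

definition eigensystem :: "nat \<Rightarrow> (nat \<Rightarrow> real \<Rightarrow> complex) \<Rightarrow> (nat \<Rightarrow> real) \<Rightarrow> bool" where
  "eigensystem n U l \<longleftrightarrow> orthonormal n U \<and> (\<forall>i<n. U i \<in> domain \<and> 0 \<le> l i \<and>
     (\<forall>v\<in>domain. sesq (U i) v = complex_of_real (l i) * hinner lborel (U i) v) \<and>
     (\<forall>v\<in>L2_on {a<..<b}. sqnorm lborel v = 1 \<longrightarrow> (\<forall>j<i. hinner lborel v (U j) = 0) \<longrightarrow>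
        ennreal (l i) \<le> dirichlet_form \<psi> v))"

lemma orthonormal_sqnorm: "orthonormal n U \<Longrightarrow> i < n \<Longrightarrow> sqnorm lborel (U i) = 1"
  by (simp add: sqnorm_Re orthonormal_def)

lemma eigensystem_form:
  assumes "eigensystem n U l" "i < n"
  shows "form (U i) = l i"
proof -
  have "complex_of_real (form (U i)) = complex_of_real (l i) * hinner lborel (U i) (U i)"
    using assms by (simp add: eigensystem_def sesq_self[symmetric])
  also have "\<dots> = complex_of_real (l i)" using assms by (simp add: eigensystem_def orthonormal_def)
  finally show ?thesis by simp
qed

text \<open>The later vector U j is a competitor in the minimum that characterises
  \<open>l i\<close>.\<close>

lemma eigensystem_mono:
  assumes es: "eigensystem n U l" and ij: "i \<le> j" "j < n"
  shows "l i \<le> l j"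
proof -
  have U: "U j \<in> domain" "sqnorm lborel (U j) = 1" "\<forall>k<i. hinner lborel (U j) (U k) = 0"
    using es ij orthonormal_sqnorm[of n U j] by (auto simp: eigensystem_def orthonormal_def)
  then have "ennreal (l i) \<le> dirichlet_form \<psi> (U j)"
    using es ij domain_L2_on[OF U(1)] by (auto simp: eigensystem_def)
  then show ?thesis
    using es ij by (simp add: dirichlet_form_eq_form[OF U(1)] eigensystem_form ennreal_le_iff eigensystem_def)
qed

lemma form_eigenvector_sum:
  assumes U: "\<And>i. i < n \<Longrightarrow> U i \<in> domain" and on: "orthonormal n U"
    and eig: "\<And>i v. i < n \<Longrightarrow> v \<in> domain \<Longrightarrow> sesq (U i) v = complex_of_real (l i) * hinner lborel (U i) v"
  shows "form (\<lambda>x. \<Sum>i<n. c i * U i x) = (\<Sum>i<n. l i * (cmod (c i))\<^sup>2)"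
proof -
  let ?u = "\<lambda>x. \<Sum>i<n. c i * U i x"
  have u: "?u \<in> domain" by (intro domain_sum domain_scale U) simp
  have inner: "hinner lborel (U i) ?u = cnj (c i)" if i: "i < n" for i
  proof -
    have "hinner lborel (U i) ?u = (\<Sum>j<n. cnj (c j) * hinner lborel (U i) (U j))"
      by (rule hinner_sum_right) (auto intro: domain_square_integrable U i)
    also have "\<dots> = (\<Sum>j<n. if i = j then cnj (c j) else 0)"
      using on i by (intro sum.cong) (auto simp: orthonormal_def)
    finally show ?thesis using i by simp
  qed
  have "complex_of_real (form ?u) = sesq ?u ?u" by (simp only: sesq_self)
  also have "\<dots> = (\<Sum>i<n. c i * sesq (U i) ?u)" by (rule sesq_sum_left) (use U u in auto)
  also have "\<dots> = (\<Sum>i<n. complex_of_real (l i * (cmod (c i))\<^sup>2))"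
  proof (intro sum.cong refl)
    fix i assume "i \<in> {..<n}"
    then have i: "i < n" by simp
    have "c i * sesq (U i) ?u = complex_of_real (l i) * (c i * cnj (c i))"
      using eig[OF i u] inner[OF i] by (simp only: mult.left_commute)
    then show "c i * sesq (U i) ?u = complex_of_real (l i * (cmod (c i))\<^sup>2)"
      by (simp only: complex_norm_square[symmetric] of_real_mult)
  qed
  also have "\<dots> = complex_of_real (\<Sum>i<n. l i * (cmod (c i))\<^sup>2)" by simp
  finally show ?thesis by (simp only: of_real_eq_iff)
qed

text \<open>Stated for orthonormal eigenvectors rather than for an \<open>eigensystem\<close>, so
  that it also covers the family enlarged by a hypothetical further eigenfunction in the proof of
  simplicity.\<close>

lemma eigenvalue_le_eigenvectors:
  assumes U: "\<And>i. i < n \<Longrightarrow> U i \<in> domain" and on: "orthonormal n U"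
    and eig: "\<And>i v. i < n \<Longrightarrow> v \<in> domain \<Longrightarrow> sesq (U i) v = complex_of_real (l i) * hinner lborel (U i) v"
    and le: "\<And>i. i < n \<Longrightarrow> l i \<le> t"
  shows "dirichlet_eigenvalue \<psi> {a<..<b} n \<le> ennreal t"
proof (rule dirichlet_eigenvalue_le[OF _ on])
  fix c :: "nat \<Rightarrow> complex" assume c: "(\<Sum>i<n. (cmod (c i))\<^sup>2) = 1"
  have u: "(\<lambda>x. \<Sum>i<n. c i * U i x) \<in> domain" by (intro domain_sum domain_scale U) simp
  have "form (\<lambda>x. \<Sum>i<n. c i * U i x) = (\<Sum>i<n. l i * (cmod (c i))\<^sup>2)"
    by (rule form_eigenvector_sum[OF U on eig])
  also have "\<dots> \<le> (\<Sum>i<n. t * (cmod (c i))\<^sup>2)" by (intro sum_mono mult_right_mono le) auto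
  also have "\<dots> = t" by (simp add: sum_distrib_left[symmetric] c)
  finally show "dirichlet_form \<psi> (\<lambda>x. \<Sum>i<n. c i * U i x) \<le> ennreal t"
    by (simp only: dirichlet_form_eq_form[OF u] ennreal_leI)
qed (use U domain_L2_on in auto)

text \<open>The span of the first i + 1 vectors gives the upper bound, the minimality of
  \<open>l i\<close> on the complement of the first i the lower one.\<close>

lemma eigensystem_eigenvalue:
  assumes es: "eigensystem n U l" and i: "i < n"
  shows "dirichlet_eigenvalue \<psi> {a<..<b} (Suc i) = ennreal (l i)"
proof (rule antisym)
  show "dirichlet_eigenvalue \<psi> {a<..<b} (Suc i) \<le> ennreal (l i)"
  proof (rule eigenvalue_le_eigenvectors[where U = U and l = l])
    show "orthonormal (Suc i) U" using es i by (auto simp: eigensystem_def orthonormal_def)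
  qed (use es i eigensystem_mono[OF es] in \<open>auto simp: eigensystem_def\<close>)
  show "ennreal (l i) \<le> dirichlet_eigenvalue \<psi> {a<..<b} (Suc i)"
  proof (rule dirichlet_eigenvalue_ge[where m = i and f = U])
    show "square_integrable lborel (U j)" if "j < i" for j
      using es i that by (auto simp: eigensystem_def intro: domain_square_integrable)
  qed (use es i in \<open>auto simp: eigensystem_def\<close>)
qed

text \<open>Coercivity with a finite-dimensional defect: this replaces compactness of the embedding,
  which fails when \<psi> is bounded.\<close>

lemma form_ge_coefficients:
  assumes u: "u \<in> domain"
  shows "level n * (sqnorm lborel u - (\<Sum>k<n. (cmod (coef u k))\<^sup>2)) \<le> form u"
proof (rule LIMSEQ_le_const2)
  have "(\<lambda>N. \<Sum>k<N. (cmod (coef u k))\<^sup>2) \<longlonglongrightarrow> sqnorm lborel u"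
    using cosb_parseval[OF domain_L2_on[OF u]] by (simp add: sums_def)
  then show "(\<lambda>N. level n * ((\<Sum>k<N. (cmod (coef u k))\<^sup>2) - (\<Sum>k<n. (cmod (coef u k))\<^sup>2))) \<longlonglongrightarrow>
      level n * (sqnorm lborel u - (\<Sum>k<n. (cmod (coef u k))\<^sup>2))"
    by (intro tendsto_intros)
  have "level n * ((\<Sum>k<N. (cmod (coef u k))\<^sup>2) - (\<Sum>k<n. (cmod (coef u k))\<^sup>2)) \<le> form u" if "N \<ge> n" for N
  proof -
    have "(\<Sum>k<N. (cmod (coef u k))\<^sup>2) - (\<Sum>k<n. (cmod (coef u k))\<^sup>2) = (\<Sum>k=n..<N. (cmod (coef u k))\<^sup>2)"
      using that by (simp add: sum_diff_nat_ivl lessThan_atLeast0)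
    then have "level n * ((\<Sum>k<N. (cmod (coef u k))\<^sup>2) - (\<Sum>k<n. (cmod (coef u k))\<^sup>2)) = (\<Sum>k=n..<N. level n * (cmod (coef u k))\<^sup>2)"
      by (simp only: sum_distrib_left)
    also have "\<dots> \<le> (\<Sum>k=n..<N. level k * (cmod (coef u k))\<^sup>2)"
      by (intro sum_mono mult_right_mono level_mono) auto
    also have "\<dots> \<le> (\<Sum>k<N. level k * (cmod (coef u k))\<^sup>2)"
      by (intro sum_mono2) (auto intro!: mult_nonneg_nonneg level_nonneg)
    also have "\<dots> \<le> form u"
    proof -
      have "ennreal (\<Sum>k<N. level k * (cmod (coef u k))\<^sup>2) \<le> ennreal (\<Sum>k<N. level k * (cmod (coef u k))\<^sup>2) + gap_form u"
        by simp
      also have "\<dots> \<le> ennreal (form u)"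
        using dirichlet_form_ge[OF domain_L2_on[OF u]] by (simp only: dirichlet_form_eq_form[OF u])
      finally show ?thesis by (simp add: ennreal_le_iff)
    qed
    finally show ?thesis .
  qed
  then show "\<exists>N'. \<forall>N\<ge>N'. level n * ((\<Sum>k<N. (cmod (coef u k))\<^sup>2) - (\<Sum>k<n. (cmod (coef u k))\<^sup>2)) \<le> form u"
    by blast
qed

lemma form_ge_orthogonal:
  assumes low: "\<And>v. v \<in> L2_on {a<..<b} \<Longrightarrow> sqnorm lborel v = 1 \<Longrightarrow> \<forall>j<n. hinner lborel v (U j) = 0 \<Longrightarrow> ennreal \<Lambda> \<le> dirichlet_form \<psi> v"
    and u: "u \<in> domain" "\<And>j. j < n \<Longrightarrow> hinner lborel u (U j) = 0"
  shows "\<Lambda> * sqnorm lborel u \<le> form u"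
proof (cases "sqnorm lborel u = 0")
  case False
  then have pos: "sqnorm lborel u > 0" by (simp add: less_le)
  define t where "t = complex_of_real (1 / sqrt (sqnorm lborel u))"
  have t: "(cmod t)\<^sup>2 = 1 / sqnorm lborel u" using pos by (simp add: t_def norm_divide power_divide)
  have "ennreal \<Lambda> \<le> dirichlet_form \<psi> (\<lambda>x. t * u x)"
    using u pos by (intro low domain_L2_on domain_scale) (auto simp: sqnorm_scale t hinner_scale_left)
  then have "\<Lambda> \<le> form (\<lambda>x. t * u x)"
    by (simp only: dirichlet_form_eq_form[OF domain_scale[OF u(1)]]) (simp add: ennreal_le_iff)
  then show ?thesis using pos by (simp add: form_scale t field_simps)
qed simp

text \<open>Minimising sequences of unit vectors orthogonal to the \<open>U j\<close> are compact: the form minus \<open>\<Lambda>\<close> times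
  the squared norm is bounded below by a positive multiple of the squared norm up to finitely many
  cosine coefficients, so after passing to a subsequence along which these coefficients converge the
  parallelogram law shows that the sequence is Cauchy.\<close>

lemma minimiser_exists:
  assumes Us: "\<And>j. j < n \<Longrightarrow> U j \<in> L2_on {a<..<b}" and \<Lambda>: "0 \<le> \<Lambda>" "\<Lambda> < level m"
    and low: "\<And>v. v \<in> L2_on {a<..<b} \<Longrightarrow> sqnorm lborel v = 1 \<Longrightarrow> \<forall>j<n. hinner lborel v (U j) = 0 \<Longrightarrow> ennreal \<Lambda> \<le> dirichlet_form \<psi> v"
    and appr: "\<And>e. e > 0 \<Longrightarrow> \<exists>v\<in>L2_on {a<..<b}. sqnorm lborel v = 1 \<and> (\<forall>j<n. hinner lborel v (U j) = 0) \<and> dirichlet_form \<psi> v < ennreal (\<Lambda> + e)"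
  shows "\<exists>g\<in>domain. sqnorm lborel g = 1 \<and> (\<forall>j<n. hinner lborel g (U j) = 0) \<and> form g = \<Lambda>"
proof -
  have "\<forall>i. \<exists>v. v \<in> L2_on {a<..<b} \<and> sqnorm lborel v = 1 \<and> (\<forall>j<n. hinner lborel v (U j) = 0) \<and>
      dirichlet_form \<psi> v < ennreal (\<Lambda> + 1 / real (Suc i))"
  proof
    fix i
    show "\<exists>v. v \<in> L2_on {a<..<b} \<and> sqnorm lborel v = 1 \<and> (\<forall>j<n. hinner lborel v (U j) = 0) \<and>
        dirichlet_form \<psi> v < ennreal (\<Lambda> + 1 / real (Suc i))"
      using appr[of "1 / real (Suc i)"] by auto
  qed
  then obtain v where v: "\<And>i. v i \<in> L2_on {a<..<b}" "\<And>i. sqnorm lborel (v i) = 1"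
    "\<And>i j. j < n \<Longrightarrow> hinner lborel (v i) (U j) = 0"
    "\<And>i. dirichlet_form \<psi> (v i) < ennreal (\<Lambda> + 1 / real (Suc i))"
    by (metis (no_types, lifting))
  have vd: "v i \<in> domain" for i
    using v(1) less_trans[OF v(4)[of i], of \<infinity>] by (simp add: form_domain_def)
  have vf: "form (v i) \<le> \<Lambda> + 1 / real (Suc i)" for i
    using v(4)[of i] by (simp only: dirichlet_form_eq_form[OF vd] ennreal_less_iff[OF form_nonneg] less_imp_le)
  have "cmod (coef (v i) k) \<le> 1" for i k
  proof -
    have "(cmod (coef (v i) k))\<^sup>2 \<le> sqnorm lborel (v i) * sqnorm lborel (cosb k)"
      by (intro hinner_Cauchy_Schwarz domain_square_integrable vd square_integrable_cosb)
    also have "sqnorm lborel (cosb k) = 1" by (simp add: sqnorm_Re hinner_cosb)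
    finally show ?thesis by (simp add: v(2) abs_square_le_1)
  qed
  then obtain r where r: "strict_mono r" and conv: "\<And>k. k < m \<Longrightarrow> convergent (\<lambda>i. coef (v (r i)) k)"
    using bounded_coordinates_convergent_subseq[of "\<lambda>i k. coef (v i) k" 1 m] by blast
  define w where "w i = v (r i)" for i
  define \<epsilon> where "\<epsilon> i = 1 / real (Suc (r i))" for i
  have eps: "\<epsilon> \<longlonglongrightarrow> 0"
    unfolding \<epsilon>_def using LIMSEQ_subseq_LIMSEQ[OF LIMSEQ_Suc[OF lim_1_over_n] r] by (simp add: o_def)
  have w: "w i \<in> L2_on {a<..<b}" "w i \<in> domain" "sqnorm lborel (w i) = 1" "form (w i) \<le> \<Lambda> + \<epsilon> i" for i
    using v(1,2) vd vf[of "r i"] by (auto simp: w_def \<epsilon>_def)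
  have worth: "hinner lborel (w i) (U j) = 0" if "j < n" for i j using v(3)[OF that] by (simp add: w_def)
  note sw = domain_square_integrable[OF w(2)]
  have lowform: "\<Lambda> * sqnorm lborel u \<le> form u"
    if "u \<in> domain" "\<And>j. j < n \<Longrightarrow> hinner lborel u (U j) = 0" for u
    by (rule form_ge_orthogonal[OF low that])
  \<comment> \<open>The parallelogram law holds for the form and for the norm. The sum of two
    members has form at least \<Lambda> times its squared norm, so the difference has nearly at most
    that, while coercivity demands \<open>level m\<close> up to low coefficients.\<close>
  have key: "(level m - \<Lambda>) * sqnorm lborel (\<lambda>x. w i x - w j x) \<le>
      2 * \<epsilon> i + 2 * \<epsilon> j + level m * (\<Sum>k<m. (cmod (coef (w i) k - coef (w j) k))\<^sup>2)" for i j
  proof -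
    have "\<Lambda> * sqnorm lborel (\<lambda>x. w i x + w j x) \<le> form (\<lambda>x. w i x + w j x)"
      by (rule lowform[OF domain_add[OF w(2) w(2)]]) (simp add: hinner_add_left sw L2_on_square_integrable[OF Us] worth)
    moreover have "form (\<lambda>x. w i x + w j x) + form (\<lambda>x. w i x - w j x) = 2 * form (w i) + 2 * form (w j)"
      by (simp add: form_add form_diff w(2))
    moreover have "sqnorm lborel (\<lambda>x. w i x + w j x) + sqnorm lborel (\<lambda>x. w i x - w j x) = 4"
      by (simp add: sqnorm_add sqnorm_diff sw w(3))
    then have "sqnorm lborel (\<lambda>x. w i x + w j x) = 4 - sqnorm lborel (\<lambda>x. w i x - w j x)" by linarith
    ultimately have 1: "\<Lambda> * (4 - sqnorm lborel (\<lambda>x. w i x - w j x)) + form (\<lambda>x. w i x - w j x) \<le> 2 * (\<Lambda> + \<epsilon> i) + 2 * (\<Lambda> + \<epsilon> j)"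
      using w(4)[of i] w(4)[of j] by simp
    have "coef (\<lambda>x. w i x - w j x) k = coef (w i) k - coef (w j) k" for k
      by (simp add: hinner_diff_left sw)
    then have 2: "level m * (sqnorm lborel (\<lambda>x. w i x - w j x) - (\<Sum>k<m. (cmod (coef (w i) k - coef (w j) k))\<^sup>2)) \<le> form (\<lambda>x. w i x - w j x)"
      using form_ge_coefficients[OF domain_diff[OF w(2) w(2)], of m i j] by simp
    from 1 2 show ?thesis by (simp add: algebra_simps)
  qed
  have Cauchy: "\<exists>N. \<forall>i\<ge>N. \<forall>j\<ge>N. sqnorm lborel (\<lambda>x. w i x - w j x) < e" if e: "e > 0" for e
  proof -
    \<comment> \<open>The right side of the previous estimate is at most 4 d from the slacks plus
      level m * m * d from the coefficients; the denominator absorbs both.\<close>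
    define d where "d = (level m - \<Lambda>) * e / (4 + level m * (real m + 1))"
    have den: "4 + level m * (real m + 1) > 0" using level_nonneg[of m] by (intro add_pos_nonneg mult_nonneg_nonneg) auto
    have d: "d > 0" using e \<Lambda> den by (simp add: d_def)
    have "\<exists>N. \<forall>i\<ge>N. \<forall>j\<ge>N. cmod (coef (w i) k - coef (w j) k) < sqrt d" if "k < m" for k
    proof -
      have "Cauchy (\<lambda>i. coef (w i) k)"
        using conv[OF that] by (simp add: w_def Cauchy_convergent_iff)
      from metric_CauchyD[OF this, of "sqrt d"] show ?thesis using d by (simp add: dist_norm)
    qed
    then have "\<forall>k. \<exists>N. k < m \<longrightarrow> (\<forall>i\<ge>N. \<forall>j\<ge>N. cmod (coef (w i) k - coef (w j) k) < sqrt d)" by blast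
    then obtain N where "\<forall>k. k < m \<longrightarrow> (\<forall>i\<ge>N k. \<forall>j\<ge>N k. cmod (coef (w i) k - coef (w j) k) < sqrt d)"
      by (rule choice[THEN exE])
    then have N: "\<And>k i j. k < m \<Longrightarrow> i \<ge> N k \<Longrightarrow> j \<ge> N k \<Longrightarrow> cmod (coef (w i) k - coef (w j) k) < sqrt d"
      by simp
    obtain N0 where N0: "\<And>i. i \<ge> N0 \<Longrightarrow> \<epsilon> i < d"
      using order_tendstoD(2)[OF eps d] by (auto simp: eventually_sequentially)
    define M where "M = N0 + (\<Sum>k<m. N k)"
    have M: "N0 \<le> M" "\<And>k. k < m \<Longrightarrow> N k \<le> M"
      unfolding M_def by (auto intro: trans_le_add2 member_le_sum)
    have "sqnorm lborel (\<lambda>x. w i x - w j x) < e" if ij: "i \<ge> M" "j \<ge> M" for i j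
    proof -
      have "(\<Sum>k<m. (cmod (coef (w i) k - coef (w j) k))\<^sup>2) \<le> (\<Sum>k<m. d)"
      proof (rule sum_mono)
        fix k assume k: "k \<in> {..<m}"
        then have "cmod (coef (w i) k - coef (w j) k) < sqrt d"
          using M(2)[of k] ij by (intro N) auto
        then have "(cmod (coef (w i) k - coef (w j) k))\<^sup>2 \<le> (sqrt d)\<^sup>2" by (intro power_mono) auto
        then show "(cmod (coef (w i) k - coef (w j) k))\<^sup>2 \<le> d" using d by simp
      qed
      then have "level m * (\<Sum>k<m. (cmod (coef (w i) k - coef (w j) k))\<^sup>2) \<le> level m * (real m * d)"
        by (intro mult_left_mono level_nonneg) simp
      moreover have "\<epsilon> i < d" "\<epsilon> j < d" using N0 M(1) ij by auto
      ultimately have "(level m - \<Lambda>) * sqnorm lborel (\<lambda>x. w i x - w j x) < 4 * d + level m * (real m * d)"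
        using key[of i j] by linarith
      also have "\<dots> \<le> (4 + level m * (real m + 1)) * d"
        using d level_nonneg[of m] by (simp add: algebra_simps)
      also have "\<dots> = (level m - \<Lambda>) * e" using den by (simp add: d_def)
      finally show ?thesis using \<Lambda> by simp
    qed
    then show ?thesis by blast
  qed
  obtain g s where g: "square_integrable lborel g" and s: "AE x in lborel. (\<lambda>i. w (s i) x) \<longlonglongrightarrow> g x"
    and lim: "(\<lambda>i. sqnorm lborel (\<lambda>x. w i x - g x)) \<longlonglongrightarrow> 0"
    using square_integrable_complete[of lborel w, OF sw Cauchy] by auto
  \<comment> \<open>One null set for the whole sequence, so that the pointwise limit vanishes
    outside the interval almost everywhere.\<close>
  have "AE x in lborel. \<forall>i. x \<notin> {a<..<b} \<longrightarrow> w i x = 0"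
    using w(1) by (subst AE_all_countable) (auto simp: L2_on_def)
  with s have "AE x in lborel. x \<notin> {a<..<b} \<longrightarrow> g x = 0"
  proof eventually_elim
    case (elim x)
    show ?case
    proof
      assume "x \<notin> {a<..<b}"
      then have "(\<lambda>i. w (s i) x) = (\<lambda>i. 0)" using elim by auto
      then have "(\<lambda>i. 0) \<longlonglongrightarrow> g x" using elim(1) by simp
      then show "g x = 0" by (simp add: LIMSEQ_const_iff)
    qed
  qed
  then have gL2: "g \<in> L2_on {a<..<b}" using g by (simp add: L2_on_def square_integrable_def)
  have inner_lim: "(\<lambda>i. hinner lborel (w i) f) \<longlonglongrightarrow> hinner lborel g f" if f: "square_integrable lborel f" for f
  proof -
    have "(\<lambda>i. sqrt (sqnorm lborel (\<lambda>x. w i x - g x) * sqnorm lborel f)) \<longlonglongrightarrow> sqrt (0 * sqnorm lborel f)"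
      by (intro tendsto_intros lim)
    then have "(\<lambda>i. sqrt (sqnorm lborel (\<lambda>x. w i x - g x) * sqnorm lborel f)) \<longlonglongrightarrow> 0" by simp
    then have "(\<lambda>i. hinner lborel (w i) f - hinner lborel g f) \<longlonglongrightarrow> 0"
    proof (rule Lim_null_comparison[rotated], intro always_eventually allI)
      fix i
      show "norm (hinner lborel (w i) f - hinner lborel g f) \<le> sqrt (sqnorm lborel (\<lambda>x. w i x - g x) * sqnorm lborel f)"
        using hinner_Cauchy_Schwarz[OF square_integrable_diff[OF sw[of i] g] f]
        by (intro real_le_rsqrt) (simp add: hinner_diff_left sw g f)
    qed
    then show ?thesis by (simp add: LIM_zero_iff)
  qed
  have orth: "hinner lborel g (U j) = 0" if j: "j < n" for j
    using inner_lim[OF L2_on_square_integrable[OF Us[OF j]]] by (simp add: worth[OF j] LIMSEQ_const_iff)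
  have norm: "sqnorm lborel g = 1"
  proof -
    have "(\<lambda>i. sqnorm lborel (w i) - 2 * Re (hinner lborel (w i) g) + sqnorm lborel g) \<longlonglongrightarrow> 1 - 2 * Re (hinner lborel g g) + sqnorm lborel g"
      unfolding w(3) by (intro tendsto_intros inner_lim g)
    then have "(\<lambda>i. sqnorm lborel (\<lambda>x. w i x - g x)) \<longlonglongrightarrow> 1 - 2 * Re (hinner lborel g g) + sqnorm lborel g"
      by (simp only: sqnorm_diff[OF sw g])
    then have "1 - 2 * Re (hinner lborel g g) + sqnorm lborel g = 0" using lim by (rule LIMSEQ_unique)
    then show ?thesis by (simp add: sqnorm_Re)
  qed
  \<comment> \<open>Lower semicontinuity also provides membership in the form domain, which
    convergence in L^2 alone would not.\<close>
  have le: "dirichlet_form \<psi> g \<le> ennreal \<Lambda>"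
  proof (rule dirichlet_form_lsc[OF w(1) gL2 lim _ eps])
    show "dirichlet_form \<psi> (w i) \<le> ennreal (\<Lambda> + \<epsilon> i)" for i
      by (simp only: dirichlet_form_eq_form[OF w(2)] ennreal_leI[OF w(4)])
  qed
  then have gd: "g \<in> domain" using gL2 by (simp add: form_domain_def le_less_trans)
  have "ennreal \<Lambda> \<le> dirichlet_form \<psi> g" using gL2 norm orth by (intro low) auto
  with le have "form g = \<Lambda>"
    by (simp only: dirichlet_form_eq_form[OF gd] ennreal_le_iff[OF \<Lambda>(1)] ennreal_le_iff[OF form_nonneg])
  then show ?thesis using gd norm orth by blast
qed

text \<open>The Euler-Lagrange equation. Variations orthogonal to the earlier eigenvectors are
  treated by minimality; in the directions of those eigenvectors both sides of the equation vanish,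
  because they satisfy their own eigenvalue equations and are orthogonal to g.\<close>

lemma minimiser_eigenvector:
  assumes U: "\<And>j. j < n \<Longrightarrow> U j \<in> domain" and on: "orthonormal n U"
    and eig: "\<And>j v. j < n \<Longrightarrow> v \<in> domain \<Longrightarrow> sesq (U j) v = complex_of_real (l j) * hinner lborel (U j) v"
    and g: "g \<in> domain" "sqnorm lborel g = 1" "\<And>j. j < n \<Longrightarrow> hinner lborel g (U j) = 0" "form g = \<Lambda>"
    and low: "\<And>u. u \<in> domain \<Longrightarrow> (\<And>j. j < n \<Longrightarrow> hinner lborel u (U j) = 0) \<Longrightarrow> \<Lambda> * sqnorm lborel u \<le> form u"
    and v: "v \<in> domain"
  shows "sesq g v = complex_of_real \<Lambda> * hinner lborel g v"
proof -
  have Ug: "hinner lborel (U j) g = 0" if "j < n" for j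
    using g(3)[OF that] hinner_cnj[of lborel g "U j"] by simp
  \<comment> \<open>The projection of v onto the earlier eigenvectors; v - P is an admissible
    variation.\<close>
  define P where "P x = (\<Sum>j<n. hinner lborel v (U j) * U j x)" for x
  have P: "P \<in> domain" unfolding P_def[abs_def] by (intro domain_sum domain_scale U) simp
  have gP: "hinner lborel g P = 0"
  proof -
    have "hinner lborel g P = (\<Sum>j<n. cnj (hinner lborel v (U j)) * hinner lborel g (U j))"
      unfolding P_def by (rule hinner_sum_right) (auto intro: domain_square_integrable U g)
    then show ?thesis using g(3) by simp
  qed
  have sgP: "sesq g P = 0"
  proof -
    have "sesq g P = (\<Sum>j<n. cnj (hinner lborel v (U j)) * sesq g (U j))"
      unfolding P_def by (rule sesq_sum_right) (auto intro: U g)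
    moreover have "sesq g (U j) = 0" if j: "j < n" for j
    proof -
      have "sesq g (U j) = cnj (sesq (U j) g)" by (simp only: sesq_cnj)
      then show ?thesis using eig[OF j g(1)] Ug[OF j] by simp
    qed
    ultimately show ?thesis by simp
  qed
  define h where "h x = v x - P x" for x
  have h: "h \<in> domain" unfolding h_def[abs_def] by (rule domain_diff[OF v P])
  have horth: "hinner lborel h (U j) = 0" if j: "j < n" for j
  proof -
    have "hinner lborel P (U j) = (\<Sum>i<n. hinner lborel v (U i) * hinner lborel (U i) (U j))"
      unfolding P_def by (rule hinner_sum_left) (auto intro: domain_square_integrable U j)
    also have "\<dots> = (\<Sum>i<n. if i = j then hinner lborel v (U i) else 0)"
      using on j by (intro sum.cong) (auto simp: orthonormal_def)
    also have "\<dots> = hinner lborel v (U j)" using j by simp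
    finally show ?thesis
      unfolding h_def by (simp add: hinner_diff_left domain_square_integrable v P U j)
  qed
  \<comment> \<open>Along g + t h the form minus \<Lambda> times the squared norm is nonnegative and
    vanishes at t = 0, so its linear coefficient must vanish.\<close>
  have "(cmod (sesq g h - complex_of_real \<Lambda> * hinner lborel g h))\<^sup>2 \<le> 0 * (form h - \<Lambda> * sqnorm lborel h)"
  proof (rule complex_quadratic_nonneg_bound)
    show "0 \<le> form h - \<Lambda> * sqnorm lborel h" using low[OF h horth] by simp
    fix t
    have gh: "(\<lambda>x. g x + t * h x) \<in> domain" by (intro domain_add domain_scale g h)
    have "\<Lambda> * sqnorm lborel (\<lambda>x. g x + t * h x) \<le> form (\<lambda>x. g x + t * h x)"
      by (rule low[OF gh]) (simp add: hinner_add_left domain_square_integrable domain_scale hinner_scale_left square_integrable_scale g h U horth)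
    moreover have "sqnorm lborel (\<lambda>x. g x + t * h x) = 1 + 2 * Re (cnj t * hinner lborel g h) + (cmod t)\<^sup>2 * sqnorm lborel h"
      by (simp add: sqnorm_add domain_square_integrable square_integrable_scale hinner_scale_right sqnorm_scale g h)
    moreover have "form (\<lambda>x. g x + t * h x) = \<Lambda> + 2 * Re (cnj t * sesq g h) + (cmod t)\<^sup>2 * form h"
      by (simp add: form_add domain_scale sesq_scale_right form_scale g h)
    ultimately show "0 \<le> 0 + 2 * Re (cnj t * (sesq g h - complex_of_real \<Lambda> * hinner lborel g h)) + (cmod t)\<^sup>2 * (form h - \<Lambda> * sqnorm lborel h)"
      by (simp add: algebra_simps)
  qed
  then have gh: "sesq g h = complex_of_real \<Lambda> * hinner lborel g h" by simp
  have "v = (\<lambda>x. h x + P x)" by (simp add: h_def)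
  then have "sesq g v = sesq g h + sesq g P" "hinner lborel g v = hinner lborel g h + hinner lborel g P"
    using sesq_add_right[OF h P g(1)]
      hinner_add_right[OF domain_square_integrable[OF h] domain_square_integrable[OF P] domain_square_integrable[OF g(1)]]
    by simp_all
  then show ?thesis using gh gP sgP by simp
qed

text \<open>Each new vector minimises the form on the complement of the earlier ones. The minimax
  principle bounds this infimum by the eigenvalue with number n + 1, which is strictly below
  \<open>level (Suc n)\<close>; precisely this strict inequality is what the existence of a
  minimiser demands.\<close>

lemma eigensystem_exists:
  assumes nt: "nontrivial"
  shows "\<exists>U l. eigensystem n U l"
proof (induction n)
  case 0
  show ?case by (simp add: eigensystem_def orthonormal_def)
next
  case (Suc n)
  then obtain U l where es: "eigensystem n U l" by blast
  define V where "V = {v \<in> L2_on {a<..<b}. sqnorm lborel v = 1 \<and> (\<forall>j<n. hinner lborel v (U j) = 0)}"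
  define L where "L = (INF v\<in>V. dirichlet_form \<psi> v)"
  have U: "U j \<in> domain" if "j < n" for j using es that by (simp add: eigensystem_def)
  have on: "orthonormal n U" using es by (simp add: eigensystem_def)
  have eig: "sesq (U j) v = complex_of_real (l j) * hinner lborel (U j) v" if "j < n" "v \<in> domain" for j v
    using es that by (simp add: eigensystem_def)
  have "L \<le> dirichlet_eigenvalue \<psi> {a<..<b} (Suc n)"
  proof (rule dirichlet_eigenvalue_ge[where m = n and f = U])
    show "L \<le> dirichlet_form \<psi> u"
      if "u \<in> L2_on {a<..<b}" "sqnorm lborel u = 1" "\<And>j. j < n \<Longrightarrow> hinner lborel u (U j) = 0" for u
      unfolding L_def by (rule INF_lower) (use that in \<open>auto simp: V_def\<close>)
  qed (auto intro: domain_square_integrable U)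
  also have "\<dots> < ennreal (level (Suc n))" by (rule eigenvalue_less_level[OF nt]) simp
  finally have Llt: "L < ennreal (level (Suc n))" .
  then obtain \<Lambda> where \<Lambda>: "L = ennreal \<Lambda>" "0 \<le> \<Lambda>" by (cases L) auto
  then have \<Lambda>lt: "\<Lambda> < level (Suc n)" using Llt by (simp add: ennreal_less_iff)
  have low: "ennreal \<Lambda> \<le> dirichlet_form \<psi> v"
    if "v \<in> L2_on {a<..<b}" "sqnorm lborel v = 1" "\<forall>j<n. hinner lborel v (U j) = 0" for v
    unfolding \<Lambda>(1)[symmetric] L_def by (rule INF_lower) (use that in \<open>auto simp: V_def\<close>)
  obtain g where g: "g \<in> domain" "sqnorm lborel g = 1" "\<forall>j<n. hinner lborel g (U j) = 0" "form g = \<Lambda>"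
  proof -
    have "\<exists>g\<in>domain. sqnorm lborel g = 1 \<and> (\<forall>j<n. hinner lborel g (U j) = 0) \<and> form g = \<Lambda>"
    proof (rule minimiser_exists[OF _ \<Lambda>(2) \<Lambda>lt low])
      fix e :: real assume "e > 0"
      then have "L < ennreal (\<Lambda> + e)" using \<Lambda> by (simp add: ennreal_less_iff)
      then show "\<exists>v\<in>L2_on {a<..<b}. sqnorm lborel v = 1 \<and> (\<forall>j<n. hinner lborel v (U j) = 0) \<and> dirichlet_form \<psi> v < ennreal (\<Lambda> + e)"
        unfolding L_def INF_less_iff by (auto simp: V_def)
    qed (auto intro: domain_L2_on U)
    then show ?thesis using that by blast
  qed
  have lowform: "\<Lambda> * sqnorm lborel u \<le> form u"
    if "u \<in> domain" "\<And>j. j < n \<Longrightarrow> hinner lborel u (U j) = 0" for u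
    by (rule form_ge_orthogonal[OF low that])
  have geig: "sesq g v = complex_of_real \<Lambda> * hinner lborel g v" if "v \<in> domain" for v
    by (rule minimiser_eigenvector[OF U on eig g(1,2) _ g(4) lowform that]) (use g(3) in auto)
  have Ug: "hinner lborel (U j) g = 0" if "j < n" for j
    using g(3) that hinner_cnj[of lborel g "U j"] by simp
  have gg: "hinner lborel g g = 1" by (simp add: hinner_self g(2))
  have "eigensystem (Suc n) (U(n := g)) (l(n := \<Lambda>))"
    unfolding eigensystem_def
  proof (intro conjI allI impI)
    show "orthonormal (Suc n) (U(n := g))"
      using on g(3) Ug gg by (auto simp: orthonormal_def less_Suc_eq)
    fix i assume i: "i < Suc n"
    show "(U(n := g)) i \<in> domain" using i U g(1) by (auto simp: less_Suc_eq)
    show "0 \<le> (l(n := \<Lambda>)) i" using i es \<Lambda>(2) by (auto simp: less_Suc_eq eigensystem_def)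
    show "\<forall>v\<in>domain. sesq ((U(n := g)) i) v = complex_of_real ((l(n := \<Lambda>)) i) * hinner lborel ((U(n := g)) i) v"
      using i eig geig by (auto simp: less_Suc_eq)
    show "\<forall>v\<in>L2_on {a<..<b}. sqnorm lborel v = 1 \<longrightarrow> (\<forall>j<i. hinner lborel v ((U(n := g)) j) = 0) \<longrightarrow>
        ennreal ((l(n := \<Lambda>)) i) \<le> dirichlet_form \<psi> v"
    proof (intro ballI impI)
      fix v assume v: "v \<in> L2_on {a<..<b}" "sqnorm lborel v = 1" "\<forall>j<i. hinner lborel v ((U(n := g)) j) = 0"
      show "ennreal ((l(n := \<Lambda>)) i) \<le> dirichlet_form \<psi> v"
      proof (cases "i = n")
        case True
        then show ?thesis using v by (auto intro!: low)
      next
        case False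
        then have "i < n" using i by simp
        then show ?thesis using v es by (auto simp: eigensystem_def)
      qed
    qed
  qed
  then show ?case by blast
qed

text \<open>Suppose equality. Some unit vector u in the span of the first n eigenvectors is
  orthogonal to the first n - 1 cosines, and it attains the lower bound. Then its gap is 0, and
  strict monotonicity of the levels removes every cosine coefficient except the one with index n -
  1. So u is a multiple of a single cosine almost everywhere, whose gap is positive.\<close>

lemma level_less_eigenvalue:
  assumes nt: "nontrivial" and n: "n \<ge> 1"
  shows "ennreal (level (n - 1)) < dirichlet_eigenvalue \<psi> {a<..<b} n"
proof -
  obtain p where p: "n = Suc p" using n by (cases n) auto
  obtain U l where es: "eigensystem n U l" using eigensystem_exists[OF nt] by blast
  have U: "U j \<in> domain" if "j < n" for j using es that by (simp add: eigensystem_def)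
  have on: "orthonormal n U" using es by (simp add: eigensystem_def)
  have ev: "dirichlet_eigenvalue \<psi> {a<..<b} n = ennreal (l p)" using eigensystem_eigenvalue[OF es, of p] by (simp add: p)
  have "level p < l p"
  proof (rule ccontr)
    assume "\<not> level p < l p"
    then have lp: "l p \<le> level p" by simp
    obtain u where u: "u \<in> {u \<in> L2_on {a<..<b}. \<exists>c. AE x in lborel. u x = (\<Sum>i<n. c i * U i x)}"
      and u1: "sqnorm lborel u = 1" and uC: "\<forall>j<p. coef u j = 0"
      using subspace_contains_orthogonal_unit[OF orthonormal_subspace[OF domain_L2_on[OF U] on], of p cosb] by (auto simp: p)
    then obtain c where uL: "u \<in> L2_on {a<..<b}" and c: "AE x in lborel. u x = (\<Sum>i<n. c i * U i x)" by auto
    let ?w = "\<lambda>x. \<Sum>i<n. c i * U i x"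
    have w: "?w \<in> domain" by (intro domain_sum domain_scale U) simp
    have "sqnorm lborel ?w = (\<Sum>i<n. (cmod (c i))\<^sup>2)"
      using on by (intro sqnorm_orthonormal_sum) (auto simp: orthonormal_def intro: domain_square_integrable U)
    moreover have "sqnorm lborel u = sqnorm lborel ?w"
      by (rule sqnorm_cong_AE[OF _ _ c]) (use uL domain_L2_on[OF w] in \<open>auto simp: L2_on_def\<close>)
    ultimately have c1: "(\<Sum>i<n. (cmod (c i))\<^sup>2) = 1" using u1 by simp
    have eig: "sesq (U i) v = complex_of_real (l i) * hinner lborel (U i) v" if "i < n" "v \<in> domain" for i v
      using es that by (simp add: eigensystem_def)
    have "form ?w = (\<Sum>i<n. l i * (cmod (c i))\<^sup>2)" by (rule form_eigenvector_sum[OF U on eig])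
    also have "\<dots> \<le> (\<Sum>i<n. l p * (cmod (c i))\<^sup>2)"
      using eigensystem_mono[OF es] by (intro sum_mono mult_right_mono) (auto simp: p)
    also have "\<dots> = l p" by (simp add: sum_distrib_left[symmetric] c1)
    finally have "form ?w \<le> level p" using lp by simp
    then have le: "dirichlet_form \<psi> u \<le> ennreal (level p)"
      using dirichlet_form_cong_AE[OF uL domain_L2_on[OF w] c] by (simp only: dirichlet_form_eq_form[OF w] ennreal_leI)
    have "ennreal (level p) + gap_form u \<le> dirichlet_form \<psi> u"
      using dirichlet_form_ge_level[OF uL, of p] uC u1 by simp
    from order_trans[OF this le] have gap0: "gap_form u = 0" by simp
    have coef0: "coef u j = 0" if j: "j \<noteq> p" for j
    proof (cases "j < p")
      case False
      then have j: "p < j" using j by simp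
      have "u \<in> domain" using uL le by (simp add: form_domain_def le_less_trans)
      then have fu: "form u \<le> level p" using le by (simp add: dirichlet_form_eq_form ennreal_le_iff level_nonneg)
      \<comment> \<open>The excess of a single higher coefficient is kept beside the weak bound; as
        the form does not exceed \<open>level p\<close>, this excess must vanish.\<close>
      have "(level j - level p) * (cmod (coef u j))\<^sup>2 + level p \<le> form u"
      proof (rule LIMSEQ_le_const2)
        have "(\<lambda>N. \<Sum>k<N. (cmod (coef u k))\<^sup>2) \<longlonglongrightarrow> 1"
          using cosb_parseval[OF uL] u1 by (simp add: sums_def)
        then have "(\<lambda>N. (level j - level p) * (cmod (coef u j))\<^sup>2 + level p * (\<Sum>k<N. (cmod (coef u k))\<^sup>2)) \<longlonglongrightarrow>
            (level j - level p) * (cmod (coef u j))\<^sup>2 + level p * 1"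
          by (intro tendsto_intros)
        then show "(\<lambda>N. (level j - level p) * (cmod (coef u j))\<^sup>2 + level p * (\<Sum>k<N. (cmod (coef u k))\<^sup>2)) \<longlonglongrightarrow>
            (level j - level p) * (cmod (coef u j))\<^sup>2 + level p" by simp
        have "(level j - level p) * (cmod (coef u j))\<^sup>2 + level p * (\<Sum>k<N. (cmod (coef u k))\<^sup>2) \<le> form u" if N: "N > j" for N
        proof -
          have "(level j - level p) * (cmod (coef u j))\<^sup>2 = (\<Sum>k<N. if k = j then (level k - level p) * (cmod (coef u k))\<^sup>2 else 0)"
            using N by simp
          also have "\<dots> \<le> (\<Sum>k<N. (level k - level p) * (cmod (coef u k))\<^sup>2)"
          proof (rule sum_mono)
            fix k
            show "(if k = j then (level k - level p) * (cmod (coef u k))\<^sup>2 else 0) \<le> (level k - level p) * (cmod (coef u k))\<^sup>2"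
              using uC level_mono[of p k] by (cases "k < p") auto
          qed
          also have "\<dots> = (\<Sum>k<N. level k * (cmod (coef u k))\<^sup>2) - level p * (\<Sum>k<N. (cmod (coef u k))\<^sup>2)"
            by (simp add: left_diff_distrib sum_subtractf sum_distrib_left)
          finally have "(level j - level p) * (cmod (coef u j))\<^sup>2 + level p * (\<Sum>k<N. (cmod (coef u k))\<^sup>2) \<le>
              (\<Sum>k<N. level k * (cmod (coef u k))\<^sup>2)" by simp
          also have "\<dots> \<le> form u"
          proof -
            have "ennreal (\<Sum>k<N. level k * (cmod (coef u k))\<^sup>2) \<le> dirichlet_form \<psi> u"
              using dirichlet_form_ge[OF uL, of N] by (rule order_trans[rotated]) simp
            then show ?thesis using \<open>u \<in> domain\<close> by (simp add: dirichlet_form_eq_form ennreal_le_iff)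
          qed
          finally show ?thesis .
        qed
        then show "\<exists>N'. \<forall>N\<ge>N'. (level j - level p) * (cmod (coef u j))\<^sup>2 + level p * (\<Sum>k<N. (cmod (coef u k))\<^sup>2) \<le> form u"
          by (intro exI[of _ "Suc j"]) auto
      qed
      then have "(level j - level p) * (cmod (coef u j))\<^sup>2 \<le> 0" using fu by linarith
      then show ?thesis using level_strict_mono[OF nt j] by (simp add: mult_le_0_iff)
    qed (use uC in auto)
    have su: "square_integrable lborel u" by (rule L2_on_square_integrable[OF uL])
    have one: "(cmod (coef u p))\<^sup>2 = 1"
    proof -
      have "(\<lambda>k. (cmod (coef u k))\<^sup>2) sums (\<Sum>k\<in>{p}. (cmod (coef u k))\<^sup>2)"
        by (rule sums_finite) (use coef0 in auto)
      then show ?thesis using sums_unique2[OF _ cosb_parseval[OF uL]] u1 by simp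
    qed
    have "sqnorm lborel (\<lambda>x. u x - (\<Sum>k\<in>{p}. coef u p * cosb k x)) = 0"
      by (subst sqnorm_diff_orthonormal_sum) (auto simp: su hinner_cosb one u1)
    then have AE: "AE x in lborel. u x = coef u p * cosb p x"
      using sqnorm_eq_0_iff[OF square_integrable_diff[OF su square_integrable_scale[OF square_integrable_cosb, of "coef u p" p]]]
      by simp
    have "tail \<theta> u > 0" if "\<theta> > 0" for \<theta>
    proof -
      have "hinner lborel u (expb (- \<theta>)) = hinner lborel (\<lambda>x. coef u p * cosb p x) (expb (- \<theta>))"
        by (rule hinner_cong_AE) (auto simp: su square_integrable_scale AE)
      then have "tail \<theta> u = tail \<theta> (cosb p)"
        by (simp add: tail_def hinner_scale_left norm_mult power_mult_distrib one)
      then show ?thesis using tail_cosb_pos[OF that] by simp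
    qed
    then have "gap_form u > 0" by (rule gap_form_pos[OF nt L2_on_measurable[OF uL]])
    then show False using gap0 by simp
  qed
  then show ?thesis unfolding ev by (simp add: p ennreal_less_iff level_nonneg)
qed

section \<open>Simplicity of the eigenvalues\<close>

lemma domain_cong_AE:
  assumes "u \<in> domain" "v \<in> L2_on {a<..<b}" "AE x in lborel. u x = v x"
  shows "v \<in> domain"
  using dirichlet_form_cong_AE[OF domain_L2_on[OF assms(1)] assms(2,3), of \<psi>] assms(1,2)
  by (simp add: form_domain_def)

lemma eigenspace_iff:
  "u \<in> dirichlet_eigenspace \<psi> {a<..<b} t \<longleftrightarrow>
     u \<in> domain \<and> (\<forall>v\<in>domain. sesq u v = complex_of_real t * hinner lborel u v)"
  unfolding dirichlet_eigenspace_def dirichlet_operator_def L2_inner_eq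
  by (auto simp: hinner_scale_left dirichlet_sesq_eq_sesq L2_on_scale domain_L2_on)

text \<open>The strict bounds interlace: the m-th eigenvalue lies below level m, the n-th above
  level n - 1, and m \<le> n - 1.\<close>

lemma eigenvalue_strict_mono:
  assumes nt: "nontrivial"
  shows "strict_mono_on {1..} (dirichlet_eigenvalue \<psi> {a<..<b})"
proof (rule strict_mono_onI)
  fix m n :: nat assume mn: "m \<in> {1..}" "n \<in> {1..}" "m < n"
  have "dirichlet_eigenvalue \<psi> {a<..<b} m < ennreal (level m)"
    by (rule eigenvalue_less_level[OF nt]) (use mn in auto)
  also have "\<dots> \<le> ennreal (level (n - 1))" using mn by (intro ennreal_leI level_mono) auto
  also have "\<dots> < dirichlet_eigenvalue \<psi> {a<..<b} n"
    by (rule level_less_eigenvalue[OF nt]) (use mn in auto)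
  finally show "dirichlet_eigenvalue \<psi> {a<..<b} m < dirichlet_eigenvalue \<psi> {a<..<b} n" .
qed

text \<open>An eigenfunction minus its component along U p is again an eigenfunction, and it is
  orthogonal to all of the first n eigenvectors. If it were nonzero, normalising and adjoining it
  would give a trial space of dimension n + 1.\<close>

lemma eigenvalue_simple:
  assumes nt: "nontrivial" and n: "n \<ge> 1"
  shows "simple_dirichlet_eigenvalue \<psi> {a<..<b} (enn2real (dirichlet_eigenvalue \<psi> {a<..<b} n))"
proof -
  obtain p where p: "n = Suc p" using n by (cases n) auto
  obtain U l where es: "eigensystem n U l" using eigensystem_exists[OF nt] by blast
  have U: "U j \<in> domain" if "j < n" for j using es that by (simp add: eigensystem_def)
  have on: "orthonormal n U" using es by (simp add: eigensystem_def)
  have eig: "sesq (U i) v = complex_of_real (l i) * hinner lborel (U i) v" if "i < n" "v \<in> domain" for i v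
    using es that by (simp add: eigensystem_def)
  have ev: "dirichlet_eigenvalue \<psi> {a<..<b} (Suc i) = ennreal (l i)" if "i < n" for i
    using eigensystem_eigenvalue[OF es that] .
  have l_less: "l i < l p" if "i < p" for i
  proof -
    have "ennreal (l i) < ennreal (l p)"
      using strict_mono_onD[OF eigenvalue_strict_mono[OF nt], of "Suc i" n] that ev[of i] ev[of p] by (simp add: p)
    then show ?thesis using es that by (simp add: ennreal_less_iff eigensystem_def p)
  qed
  have val: "enn2real (dirichlet_eigenvalue \<psi> {a<..<b} n) = l p"
    using ev[of p] es by (simp add: p eigensystem_def)
  have on1: "orthonormal 1 (\<lambda>_. U p)" using on by (simp add: orthonormal_def p)
  have "dirichlet_eigenspace \<psi> {a<..<b} (l p) =
      {u \<in> L2_on {a<..<b}. \<exists>c :: nat \<Rightarrow> complex. AE x in lborel. u x = (\<Sum>i<1. c i * U p x)}" (is "?E = ?S")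
  proof
    show "?S \<subseteq> ?E"
    proof
      fix u assume "u \<in> ?S"
      then obtain c :: "nat \<Rightarrow> complex" where u: "u \<in> L2_on {a<..<b}"
        and "AE x in lborel. u x = (\<Sum>i<1. c i * U p x)" by blast
      then have AE: "AE x in lborel. c 0 * U p x = u x" by (auto elim: eventually_mono)
      have cU: "(\<lambda>x. c 0 * U p x) \<in> domain" by (intro domain_scale U) (simp add: p)
      have ud: "u \<in> domain" by (rule domain_cong_AE[OF cU u AE])
      \<comment> \<open>Equality in \<open>?S\<close> is only almost everywhere; it changes neither
        the transform nor inner products.\<close>
      have "fourier (\<lambda>x. c 0 * U p x) = fourier u"
        by (rule fourier_cong_AE) (use AE domain_L2_on[OF cU] u in \<open>auto simp: L2_on_def\<close>)
      then have "sesq u v = sesq (\<lambda>x. c 0 * U p x) v" for v by (simp add: sesq_def)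
      moreover have "hinner lborel u v = hinner lborel (\<lambda>x. c 0 * U p x) v" if "v \<in> domain" for v
        by (rule hinner_cong_AE) (use ud cU that AE in \<open>auto simp: domain_square_integrable eq_commute\<close>)
      ultimately have "sesq u v = complex_of_real (l p) * hinner lborel u v" if "v \<in> domain" for v
        using that eig[of p v] by (simp add: sesq_scale_left hinner_scale_left p)
      then show "u \<in> ?E" using ud by (simp add: eigenspace_iff)
    qed
    show "?E \<subseteq> ?S"
    proof
      fix u assume "u \<in> ?E"
      then have u: "u \<in> domain" and ueig: "\<And>v. v \<in> domain \<Longrightarrow> sesq u v = complex_of_real (l p) * hinner lborel u v"
        by (auto simp: eigenspace_iff)
      have Up: "U p \<in> domain" by (rule U) (simp add: p)
      define c where "c = hinner lborel u (U p)"
      define w where "w x = u x - c * U p x" for x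
      have w: "w \<in> domain" unfolding w_def[abs_def] by (intro domain_diff domain_scale u Up)
      have weig: "sesq w v = complex_of_real (l p) * hinner lborel w v" if v: "v \<in> domain" for v
        unfolding w_def using v eig[of p v] ueig[OF v]
        by (simp add: sesq_diff_left domain_scale u Up sesq_scale_left hinner_diff_left domain_square_integrable
            square_integrable_scale hinner_scale_left p algebra_simps)
      have worth: "hinner lborel w (U i) = 0" if i: "i < n" for i
      proof (cases "i = p")
        case True
        then show ?thesis
          unfolding w_def using on
          by (simp add: hinner_diff_left domain_square_integrable u Up square_integrable_scale hinner_scale_left c_def orthonormal_def p)
      next
        case False
        then have "i < p" using i by (simp add: p)
        \<comment> \<open>Eigenvectors of a symmetric form for distinct eigenvalues are orthogonal;
          strict monotonicity has separated \<open>l i\<close> from \<open>l p\<close>.\<close>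
        have "complex_of_real (l p) * hinner lborel w (U i) = cnj (sesq (U i) w)"
          using weig[OF U[OF i]] by (simp only: sesq_cnj)
        also have "\<dots> = complex_of_real (l i) * hinner lborel w (U i)"
          by (simp add: eig[OF i w] hinner_cnj)
        finally have "complex_of_real (l p - l i) * hinner lborel w (U i) = 0" by (simp add: left_diff_distrib)
        then show ?thesis using l_less[OF \<open>i < p\<close>] by auto
      qed
      have "sqnorm lborel w = 0"
      proof (rule ccontr)
        assume "sqnorm lborel w \<noteq> 0"
        then have pos: "sqnorm lborel w > 0" by (simp add: less_le)
        define t where "t = complex_of_real (1 / sqrt (sqnorm lborel w))"
        have t: "(cmod t)\<^sup>2 = 1 / sqnorm lborel w" using pos by (simp add: t_def norm_divide power_divide)
        define g where "g x = t * w x" for x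
        have g: "g \<in> domain" unfolding g_def[abs_def] by (rule domain_scale[OF w])
        have gg: "hinner lborel g g = 1"
          unfolding hinner_self g_def sqnorm_scale t using pos by simp
        have gU: "hinner lborel g (U i) = 0" if "i < n" for i
          unfolding g_def hinner_scale_left using worth[OF that] by simp
        have Ug: "hinner lborel (U i) g = 0" if "i < n" for i
          using gU[OF that] hinner_cnj[of lborel g "U i"] by simp
        have geig: "sesq g v = complex_of_real (l p) * hinner lborel g v" if "v \<in> domain" for v
          unfolding g_def sesq_scale_left hinner_scale_left weig[OF that] by simp
        have "dirichlet_eigenvalue \<psi> {a<..<b} (Suc n) \<le> ennreal (l p)"
        proof (rule eigenvalue_le_eigenvectors[where U = "U(n := g)" and l = "l(n := l p)"])
          show "orthonormal (Suc n) (U(n := g))"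
            using on gU Ug gg by (auto simp: orthonormal_def less_Suc_eq)
          fix i assume i: "i < Suc n"
          show "(U(n := g)) i \<in> domain" using i U g by (auto simp: less_Suc_eq)
          show "(l(n := l p)) i \<le> l p" using i eigensystem_mono[OF es, of i p] by (auto simp: less_Suc_eq p)
          fix v assume "v \<in> domain"
          then show "sesq ((U(n := g)) i) v = complex_of_real ((l(n := l p)) i) * hinner lborel ((U(n := g)) i) v"
            using i eig geig by (auto simp: less_Suc_eq)
        qed
        moreover have "dirichlet_eigenvalue \<psi> {a<..<b} n < dirichlet_eigenvalue \<psi> {a<..<b} (Suc n)"
          by (rule strict_mono_onD[OF eigenvalue_strict_mono[OF nt]]) (use n in auto)
        ultimately show False using ev[of p] by (simp add: p)
      qed
      then have "AE x in lborel. u x = c * U p x"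
        using sqnorm_eq_0_iff[OF domain_square_integrable[OF w]] by (simp add: w_def)
      then show "u \<in> ?S" using domain_L2_on[OF u] by (auto intro!: exI[of _ "\<lambda>_. c"])
    qed
  qed
  then show ?thesis
    unfolding simple_dirichlet_eigenvalue_def val
    using orthonormal_subspace[OF _ on1, of "{a<..<b}"] domain_L2_on[OF U[of p]] by (simp add: p)
qed

end

theorem theorem1p2:
  fixes \<psi> :: "real \<Rightarrow> real" and a b :: real
  assumes "complete_bernstein \<psi>" and "a < b"
  shows "(\<forall>n\<ge>1.
            ennreal (\<psi> (((real n - 1) * pi / (b - a))\<^sup>2)) \<le> dirichlet_eigenvalue \<psi> {a<..<b} n \<and>
            dirichlet_eigenvalue \<psi> {a<..<b} n \<le> ennreal (\<psi> ((real n * pi / (b - a))\<^sup>2))) \<and>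
         (\<not> extends_meromorphically \<psi> \<longrightarrow>
            (\<forall>n\<ge>1.
               ennreal (\<psi> (((real n - 1) * pi / (b - a))\<^sup>2)) < dirichlet_eigenvalue \<psi> {a<..<b} n \<and>
               dirichlet_eigenvalue \<psi> {a<..<b} n < ennreal (\<psi> ((real n * pi / (b - a))\<^sup>2))) \<and>
            strict_mono_on {1..} (dirichlet_eigenvalue \<psi> {a<..<b}) \<and>
            (\<forall>n\<ge>1. simple_dirichlet_eigenvalue \<psi> {a<..<b}
                      (enn2real (dirichlet_eigenvalue \<psi> {a<..<b} n))))"
proof -
  obtain c0 c1 \<mu> where c: "c0 \<ge> 0" "c1 \<ge> 0" "sets \<mu> = sets (restrict_space borel {0::real<..})"
    "\<exists>\<xi>>0. integrable \<mu> (\<lambda>s. \<xi> / (\<xi> + s))"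
    "\<forall>\<xi>\<ge>0. \<psi> \<xi> = c1 * \<xi> + c0 + 1 / pi * (\<integral>s. \<xi> / (\<xi> + s) \<partial>\<mu>)"
    using assms(1) unfolding complete_bernstein_def by blast
  interpret bernstein_interval a b \<psi> c0 c1 \<mu>
    by standard (use assms(2) c in auto)
  have f: "(real n * pi / (b - a))\<^sup>2 = (freq n)\<^sup>2" for n by (simp add: freq_def)
  \<comment> \<open>The statement subtracts in the reals, \<open>freq\<close> takes a natural
    number; the two agree from n = 1 on.\<close>
  have f1: "((real n - 1) * pi / (b - a))\<^sup>2 = (freq (n - 1))\<^sup>2" if "n \<ge> 1" for n
    using that by (simp add: freq_def of_nat_diff)
  have nt: "emeasure \<mu> (space \<mu>) \<noteq> 0" if "\<not> extends_meromorphically \<psi>"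
  proof
    assume null: "emeasure \<mu> (space \<mu>) = 0"
    have "AE s in \<mu>. \<xi> / (\<xi> + s) = 0" for \<xi> :: real
    proof -
      have "ae_filter \<mu> = bot" using null by (simp add: ae_filter_eq_bot_iff)
      then show ?thesis by (simp only: eventually_bot)
    qed
    then have "(\<integral>s. \<xi> / (\<xi> + s) \<partial>\<mu>) = 0" for \<xi> by (rule integral_eq_zero_AE)
    then have "\<forall>x>0. complex_of_real c1 * complex_of_real x + complex_of_real c0 = complex_of_real (\<psi> x)"
      using c(5) by simp
    moreover have "(\<lambda>z. complex_of_real c1 * z + complex_of_real c0) meromorphic_on (- {0})"
      by (intro analytic_on_imp_meromorphic_on analytic_intros)
    ultimately have "extends_meromorphically \<psi>"
      unfolding extends_meromorphically_def
      by (intro exI[of _ "\<lambda>z. complex_of_real c1 * z + complex_of_real c0"] conjI)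
    with that show False ..
  qed
  show ?thesis
    using eigenvalue_ge_level eigenvalue_le_level level_less_eigenvalue eigenvalue_less_level
      eigenvalue_strict_mono eigenvalue_simple nt
    by (auto simp: f f1)
qed

end
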